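(* Let $N=\binom n2$, let $e_1,\dots,e_N$ be a uniformly random ordering of the edges of $K_n$ on vertex set $[n]$, and let $\mathcal G(n,m)$ be the graph on $[n]$ with edge set $\{e_1,\dots,e_m\}$. Let $M=\min\{m:\mathcal G(n,m)\text{ is connected}\}$ and $G=\mathcal G(n,M)$. Then there is a constant $C>0$ such that, with probability tending to $1$ as $n\to\infty$, $\mathcal{AC}(G)\le Cn$.
   Context: For a finite connected graph $G=(V,E)$, the acquaintance time $\mathcal{AC}(G)$ is defined as follows. Initially one agent is placed on each vertex. Two agents are acquainted (and remain so forever) once, at some time (including the start), they occupy the two endpoints of an edge. In each round one chooses a matching $M$ of $G$ (any matching, possibly a single edge) and, for every edge of the matching, swaps the agents on its endpoints. $\mathcal{AC}(G)$ is the minimum number of rounds needed until every pair of agents is acquainted. *)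

theory Defs
  imports "HOL-Probability.Probability" "HOL-Combinatorics.Multiset_Permutations"
begin

text \<open>
  A finite simple graph is given by a finite vertex set \<open>V\<close> and a set \<open>E\<close> of two-element
  subsets of \<open>V\<close>.
\<close>

definition complete_edges :: "'a set \<Rightarrow> 'a set set" where
  "complete_edges V = {e. e \<subseteq> V \<and> card e = 2}"

definition graph_connected :: "'a set \<Rightarrow> 'a set set \<Rightarrow> bool" where
  "graph_connected V E \<longleftrightarrow>
     V \<noteq> {} \<and> (\<forall>u\<in>V. \<forall>v\<in>V. (u, v) \<in> {(x, y). {x, y} \<in> E}\<^sup>*)"

definition is_matching :: "'a set set \<Rightarrow> 'a set set \<Rightarrow> bool" where
  "is_matching E M \<longleftrightarrow> M \<subseteq> E \<and> pairwise disjnt M"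

text \<open>
  The vertex to which the agent on \<open>v\<close> moves when the agents on the endpoints of each edge
  of the matching \<open>M\<close> are swapped.
\<close>

definition swap_along :: "'a set set \<Rightarrow> 'a \<Rightarrow> 'a" where
  "swap_along M v = (if v \<in> \<Union>M then (THE w. {v, w} \<in> M) else v)"

lemma swap_along_edge:
  assumes "pairwise disjnt M" "{v, w} \<in> M"
  shows "swap_along M v = w"
proof -
  have "w' = w" if "{v, w'} \<in> M" for w'
  proof -
    have "{v, w'} = {v, w}"
      using assms that by (meson disjnt_insert1 insertI1 pairwiseD)
    thus ?thesis by (auto simp: doubleton_eq_iff)
  qed
  with assms(2) have "(THE w. {v, w} \<in> M) = w" by (rule the_equality)
  with assms(2) show ?thesis by (auto simp: swap_along_def)
qed

text \<open>
  Agents are named by their initial vertices. A strategy is the list of the matchings chosen in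
  the successive rounds; \<open>agent_position Ms t a\<close> is the vertex occupied by agent \<open>a\<close>
  after the first \<open>t\<close> rounds.
\<close>

definition agent_position :: "'a set set list \<Rightarrow> nat \<Rightarrow> 'a \<Rightarrow> 'a" where
  "agent_position Ms t a = fold swap_along (take t Ms) a"

definition acquainting_strategy :: "'a set \<Rightarrow> 'a set set \<Rightarrow> 'a set set list \<Rightarrow> bool" where
  "acquainting_strategy V E Ms \<longleftrightarrow>
     (\<forall>M\<in>set Ms. is_matching E M) \<and>
     (\<forall>a\<in>V. \<forall>b\<in>V. a \<noteq> b \<longrightarrow>
        (\<exists>t\<le>length Ms. {agent_position Ms t a, agent_position Ms t b} \<in> E))"

text \<open>
  The minimum is taken in \<^typ>\<open>enat\<close>, so that the value is \<open>\<infinity>\<close>, rather than an unspecified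
  number, should no strategy acquaint all agents.
\<close>

definition acquaintance_time :: "'a set \<Rightarrow> 'a set set \<Rightarrow> enat" where
  "acquaintance_time V E = (INF Ms\<in>{Ms. acquainting_strategy V E Ms}. enat (length Ms))"

definition random_edge_ordering :: "nat \<Rightarrow> nat set list pmf" where
  "random_edge_ordering n = pmf_of_set (permutations_of_set (complete_edges {1..n}))"

definition process_edges :: "nat set list \<Rightarrow> nat \<Rightarrow> nat set set" where
  "process_edges es m = set (take m es)"

definition connectivity_time :: "nat \<Rightarrow> nat set list \<Rightarrow> nat" where
  "connectivity_time n es = (LEAST m. graph_connected {1..n} (process_edges es m))"

lemma set_pmf_random_edge_ordering:
  "set_pmf (random_edge_ordering n) = permutations_of_set (complete_edges {1..n})"
proof -
  have "finite (complete_edges {1..n})"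
    unfolding complete_edges_def by (rule finite_subset[of _ "Pow {1..n}"]) auto
  thus ?thesis unfolding random_edge_ordering_def by (intro set_pmf_of_set) auto
qed

lemma graph_connected_connectivity_time:
  assumes "n \<ge> 1" "es \<in> set_pmf (random_edge_ordering n)"
  shows "graph_connected {1..n} (process_edges es (connectivity_time n es))"
proof -
  have "set es = complete_edges {1..n}"
    using assms(2) by (simp add: set_pmf_random_edge_ordering permutations_of_set_def)
  moreover have "(u, v) \<in> {(x, y). {x, y} \<in> complete_edges {1..n}}\<^sup>*"
    if "u \<in> {1..n}" "v \<in> {1..n}" for u v
    using that by (cases "u = v") (auto simp: complete_edges_def)
  ultimately have "graph_connected {1..n} (process_edges es (length es))"
    using assms(1) by (auto simp: graph_connected_def process_edges_def)
  thus ?thesis unfolding connectivity_time_def by (rule LeastI)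
qed

end

theory Submission
  imports Defs "HOL-Real_Asymp.Real_Asymp"
begin

text \<open>
  A graph with a spanning tree of bounded degree on \<open>n\<close> vertices has acquaintance time \<open>O(n)\<close>: the
  cube of the tree has a Hamiltonian path whose steps are paths of length at most 3 in the tree,
  each vertex being used by boundedly many of them. Swapping the agents at the ends of such a step
  takes at most five rounds, and steps that share no vertex can be processed in parallel; hence a
  phase of odd-even transposition along the Hamiltonian path takes \<open>O(1)\<close> rounds. After \<open>n\<close> phases
  the order of the agents is reversed, so that every two of them have been swapped directly.

  It remains to find such a tree in the graph at the time of connectivity. With high probability
  this graph contains the first \<open>m = \<lfloor>3/8 n ln n\<rfloor>\<close> edges of the process, because some vertex is still
  isolated after \<open>m\<close> steps, and it is contained in the first \<open>\<lceil>3 n ln n\<rceil>\<close> edges. Depth-first search finds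
  a path through at least three quarters of the vertices after \<open>m\<close> steps. The remaining vertices whose
  degree after \<open>m\<close> steps is at least 18 expand well, and a Hall type argument attaches them to
  the path along an acyclic injective parent function. The vertices of low degree are pairwise
  non-adjacent and have no common neighbours, so that they can be attached as leaves to distinct
  vertices.
\<close>

section \<open>Performing hops in parallel\<close>

text \<open>The time of connectivity is random, so nothing is estimated for that graph itself.
  Properties that survive the addition of edges (expansion, edges between large sets) are proved at
  the earlier fixed time, properties that survive deletion (vertices of low degree lie far apart) at
  the later one; "low degree" always refers to the earlier graph. The final graph may have vertices
  of degree one, so a Hamiltonian path cannot be hoped for; a vertex of low degree is trusted with a
  single edge of the final graph and therefore must become a leaf. The obstacle is that an expanding
  set may lose neighbours to these reserved leaves. Expansion by a factor two pays for it: every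
  vertex has at most one neighbour of low degree, so half of the neighbours remain, which is just
  what the matching argument needs. The positions of edges in a random ordering are not independent;
  exchangeability of the edges takes the place of independence.\<close>

lemma swap_along_empty [simp]: "swap_along {} v = v"
  by (simp add: swap_along_def)

lemma swap_along_singleton:
  assumes "a \<noteq> b"
  shows "swap_along {{a, b}} = Transposition.transpose a b"
proof
  fix v
  consider "v = a" | "v = b" | "v \<noteq> a" "v \<noteq> b" by blast
  then show "swap_along {{a, b}} v = Transposition.transpose a b v"
  proof cases
    case 1
    then show ?thesis using swap_along_edge[of "{{a, b}}" a b] by simp
  next
    case 2
    then show ?thesis using swap_along_edge[of "{{a, b}}" b a] by (simp add: insert_commute)
  next
    case 3
    then show ?thesis by (simp add: swap_along_def)
  qed
qed

text \<open>Only the edges through \<open>v\<close> influence \<open>swap_along\<close> at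
  \<open>v\<close>, and disjointness of the supports \<open>S i\<close> leaves only those of
  \<open>N i\<close>.\<close>

lemma swap_along_UN:
  assumes disj: "\<And>i j. i \<in> I \<Longrightarrow> j \<in> I \<Longrightarrow> i \<noteq> j \<Longrightarrow> S i \<inter> S j = {}"
    and sub: "\<And>i. i \<in> I \<Longrightarrow> \<Union>(N i) \<subseteq> S i"
    and "i \<in> I" "v \<in> S i"
  shows "swap_along (\<Union>j\<in>I. N j) v = swap_along (N i) v"
proof -
  have mem: "e \<in> (\<Union>j\<in>I. N j) \<longleftrightarrow> e \<in> N i" if "v \<in> e" for e
  proof
    assume "e \<in> (\<Union>j\<in>I. N j)"
    then obtain j where j: "j \<in> I" "e \<in> N j" by blast
    with sub[of j] that have "v \<in> S j" by blast
    with disj[of i j] assms(3,4) j have "j = i" by blast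
    with j show "e \<in> N i" by simp
  qed (use assms(3) in blast)
  have "v \<in> \<Union>(\<Union>j\<in>I. N j) \<longleftrightarrow> v \<in> \<Union>(N i)"
    using mem by blast
  moreover have "({v, w} \<in> (\<Union>j\<in>I. N j)) = ({v, w} \<in> N i)" for w
    using mem[of "{v, w}"] by simp
  ultimately show ?thesis
    unfolding swap_along_def by presburger
qed

lemma swap_along_outside:
  "v \<notin> \<Union>M \<Longrightarrow> swap_along M v = v"
  by (simp add: swap_along_def)

definition path_in :: "'a set set \<Rightarrow> 'a list \<Rightarrow> bool" where
  "path_in E p \<longleftrightarrow> distinct p \<and> successively (\<lambda>u v. {u, v} \<in> E) p"

definition hop_in :: "'a set set \<Rightarrow> 'a list \<Rightarrow> bool" where
  "hop_in E h \<longleftrightarrow> path_in E h \<and> 2 \<le> length h \<and> length h \<le> 4"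

text \<open>The transposition of the two end vertices, written as the last swap conjugated by the
  preceding ones, so that the agents in between return to their places. Empty matchings pad every
  hop to five rounds, which keeps parallel hops in step.\<close>

fun hop_moves :: "'a list \<Rightarrow> 'a set set list" where
  "hop_moves [a, b] = [{{a, b}}, {}, {}, {}, {}]"
| "hop_moves [a, b, c] = [{{a, b}}, {{b, c}}, {{a, b}}, {}, {}]"
| "hop_moves [a, b, c, d] = [{{a, b}}, {{b, c}}, {{c, d}}, {{b, c}}, {{a, b}}]"
| "hop_moves _ = [{}, {}, {}, {}, {}]"

lemma hop_cases:
  assumes "hop_in E h"
  obtains (two) a b where "h = [a, b]" "a \<noteq> b" "{a, b} \<in> E"
  | (three) a b c where "h = [a, b, c]" "distinct [a, b, c]" "{a, b} \<in> E" "{b, c} \<in> E"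
  | (four) a b c d where "h = [a, b, c, d]" "distinct [a, b, c, d]"
      "{a, b} \<in> E" "{b, c} \<in> E" "{c, d} \<in> E"
proof -
  from assms have "length h = 2 \<or> length h = 3 \<or> length h = 4"
    by (auto simp: hop_in_def)
  then consider (l2) a b where "h = [a, b]" | (l3) a b c where "h = [a, b, c]"
    | (l4) a b c d where "h = [a, b, c, d]"
    by (auto simp: numeral_eq_Suc length_Suc_conv)
  then show thesis
    using assms by cases (auto simp: hop_in_def path_in_def intro: that)
qed

lemma length_hop_moves [simp]: "length (hop_moves h) = 5"
  by (cases h rule: hop_moves.cases) auto

lemma hop_moves_subset:
  assumes "hop_in E h" "M \<in> set (hop_moves h)"
  shows "M \<subseteq> E" "\<Union>M \<subseteq> set h" "pairwise disjnt M"
  using assms(1) by (cases rule: hop_cases; use assms(2) in \<open>auto simp: pairwise_def\<close>)+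

lemma fold_hop_moves:
  assumes "hop_in E h"
  shows "fold swap_along (hop_moves h) = Transposition.transpose (hd h) (last h)"
  using assms
  by (cases rule: hop_cases) (auto simp: swap_along_singleton fun_eq_iff Transposition.transpose_def)

text \<open>After \<open>length h - 2\<close> rounds the agent from \<open>hd h\<close> stands next
  to \<open>last h\<close>, whose agent has not moved yet.\<close>

lemma hop_moves_meet:
  assumes "hop_in E h"
  shows "\<exists>t\<le>5. {fold swap_along (take t (hop_moves h)) (hd h),
                 fold swap_along (take t (hop_moves h)) (last h)} \<in> E"
  using assms
proof (cases rule: hop_cases)
  case two
  then show ?thesis by (intro exI[of _ 0]) auto
next
  case three
  then show ?thesis by (intro exI[of _ 1]) (auto simp: swap_along_singleton Transposition.transpose_def)
next
  case four
  then show ?thesis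
    by (intro exI[of _ 2]) (auto simp: swap_along_singleton Transposition.transpose_def numeral_2_eq_2)
qed

definition parallel_moves :: "'i set \<Rightarrow> ('i \<Rightarrow> 'a list) \<Rightarrow> 'a set set list" where
  "parallel_moves I H = map (\<lambda>j. \<Union>i\<in>I. hop_moves (H i) ! j) [0..<5]"

lemma length_parallel_moves [simp]: "length (parallel_moves I H) = 5"
  by (simp add: parallel_moves_def)

lemma in_set_parallel_moves:
  assumes "M \<in> set (parallel_moves I H)"
  shows "\<exists>j<5. M = (\<Union>i\<in>I. hop_moves (H i) ! j)"
proof -
  have "M \<in> (\<lambda>j. \<Union>i\<in>I. hop_moves (H i) ! j) ` {0..<5}"
    using assms unfolding parallel_moves_def set_map set_upt .
  then show ?thesis by (rule imageE) (metis atLeastLessThan_iff)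
qed

context
  fixes E :: "'a set set" and I :: "'i set" and H :: "'i \<Rightarrow> 'a list"
  assumes hops: "\<And>i. i \<in> I \<Longrightarrow> hop_in E (H i)"
    and disj: "\<And>i j. i \<in> I \<Longrightarrow> j \<in> I \<Longrightarrow> i \<noteq> j \<Longrightarrow> set (H i) \<inter> set (H j) = {}"
begin

lemma parallel_moves_matching:
  assumes "M \<in> set (parallel_moves I H)"
  shows "is_matching E M"
proof -
  obtain j where j: "j < 5" and M: "M = (\<Union>i\<in>I. hop_moves (H i) ! j)"
    using in_set_parallel_moves[OF assms] by blast
  have *: "hop_moves (H i) ! j \<subseteq> E" "\<Union>(hop_moves (H i) ! j) \<subseteq> set (H i)"
    "pairwise disjnt (hop_moves (H i) ! j)" if "i \<in> I" for i
    using hop_moves_subset[OF hops[OF that] nth_mem, of j] j by simp_all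
  have "M \<subseteq> E" using *(1) M by blast
  moreover have "disjnt e e'" if e: "e \<in> M" and e': "e' \<in> M" and "e \<noteq> e'" for e e'
  proof -
    obtain i where i: "i \<in> I" "e \<in> hop_moves (H i) ! j"
      using e unfolding M by blast
    obtain i' where i': "i' \<in> I" "e' \<in> hop_moves (H i') ! j"
      using e' unfolding M by blast
    show ?thesis
    proof (cases "i = i'")
      case True
      then show ?thesis using *(3)[of i] i i' j \<open>e \<noteq> e'\<close> by (auto simp: pairwise_def)
    next
      case False
      have "e \<subseteq> set (H i)" "e' \<subseteq> set (H i')"
        using *(2)[of i] *(2)[of i'] i i' j by auto
      with disj[OF i(1) i'(1) False] show ?thesis by (auto simp: disjnt_def)
    qed
  qed
  ultimately show ?thesis by (auto simp: is_matching_def pairwise_def)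
qed

lemma hop_moves_stable:
  assumes "i \<in> I" "v \<in> set (H i)" "j < 5"
  shows "swap_along (hop_moves (H i) ! j) v \<in> set (H i)"
  using hops[OF assms(1)]
proof (cases rule: hop_cases)
  case two
  with assms show ?thesis
    by (auto simp: less_Suc_eq numeral_eq_Suc swap_along_singleton Transposition.transpose_def)
next
  case three
  with assms show ?thesis
    by (auto simp: less_Suc_eq numeral_eq_Suc swap_along_singleton Transposition.transpose_def)
next
  case four
  with assms show ?thesis
    by (auto simp: less_Suc_eq numeral_eq_Suc swap_along_singleton Transposition.transpose_def)
qed

text \<open>Stated for every prefix because the two agents of a hop meet in the middle of its five
  rounds. Invariance of \<open>set (H i)\<close> is what carries the induction.\<close>

lemma fold_parallel_moves_take:
  assumes "i \<in> I" "v \<in> set (H i)" "t \<le> 5"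
  shows "fold swap_along (take t (parallel_moves I H)) v =
           fold swap_along (take t (hop_moves (H i))) v \<and>
         fold swap_along (take t (hop_moves (H i))) v \<in> set (H i)"
  using assms(3)
proof (induction t)
  case 0
  then show ?case using assms by simp
next
  case (Suc t)
  let ?w = "fold swap_along (take t (hop_moves (H i))) v"
  have w: "?w \<in> set (H i)" and IH: "fold swap_along (take t (parallel_moves I H)) v = ?w"
    using Suc by auto
  have t: "t < 5" using Suc by simp
  have "swap_along (parallel_moves I H ! t) ?w = swap_along (hop_moves (H i) ! t) ?w"
  proof -
    have "parallel_moves I H ! t = (\<Union>i\<in>I. hop_moves (H i) ! t)"
      using t by (simp add: parallel_moves_def)
    moreover have "swap_along (\<Union>i\<in>I. hop_moves (H i) ! t) ?w = swap_along (hop_moves (H i) ! t) ?w"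
    proof (rule swap_along_UN[where S = "\<lambda>i. set (H i)"])
      show "\<Union> (hop_moves (H i) ! t) \<subseteq> set (H i)" if "i \<in> I" for i
        using hop_moves_subset(2)[OF hops[OF that] nth_mem, of t] t by simp
    qed (use disj assms w in auto)
    ultimately show ?thesis by simp
  qed
  then show ?case
    using IH t hop_moves_stable[OF assms(1) w t] by (simp add: take_Suc_conv_app_nth)
qed

lemma fold_parallel_moves:
  assumes "i \<in> I" "v \<in> set (H i)"
  shows "fold swap_along (parallel_moves I H) v = Transposition.transpose (hd (H i)) (last (H i)) v"
  using fold_parallel_moves_take[OF assms, of 5] fold_hop_moves[OF hops[OF assms(1)]] by simp

lemma fold_parallel_moves_outside:
  assumes "\<And>i. i \<in> I \<Longrightarrow> v \<notin> set (H i)"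
  shows "fold swap_along (parallel_moves I H) v = v"
proof -
  have "swap_along M v = v" if mem: "M \<in> set (parallel_moves I H)" for M
  proof (rule swap_along_outside)
    obtain j where j: "j < 5" and M: "M = (\<Union>i\<in>I. hop_moves (H i) ! j)"
      using in_set_parallel_moves[OF mem] by blast
    have "\<Union>(hop_moves (H i) ! j) \<subseteq> set (H i)" if "i \<in> I" for i
      using hop_moves_subset(2)[OF hops[OF that] nth_mem, of j] j by simp
    then show "v \<notin> \<Union>M" using M assms by blast
  qed
  then have "fold swap_along Ms v = v" if "set Ms \<subseteq> set (parallel_moves I H)" for Ms
    using that by (induction Ms) auto
  then show ?thesis by simp
qed

end

text \<open>A fragment of a strategy that may start from any placement: \<open>a\<close> stands for
  whichever agent occupies the vertex \<open>a\<close> when the fragment begins. Hence fragments can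
  be concatenated, with \<open>\<sigma>\<close> relabelling the agents for the second one.\<close>

definition performs ::
  "'a set \<Rightarrow> 'a set set \<Rightarrow> 'a set set list \<Rightarrow> ('a \<Rightarrow> 'a) \<Rightarrow> ('a \<times> 'a) set \<Rightarrow> bool" where
  "performs V E Ms \<sigma> Q \<longleftrightarrow>
     (\<forall>M\<in>set Ms. is_matching E M) \<and>
     (\<forall>a\<in>V. fold swap_along Ms a = \<sigma> a) \<and>
     (\<forall>(a, b)\<in>Q. \<exists>t\<le>length Ms. {fold swap_along (take t Ms) a, fold swap_along (take t Ms) b} \<in> E)"

lemma performs_append:
  assumes 1: "performs V E Ms \<sigma> Q" and 2: "performs V E Ms' \<sigma>' Q'"
    and V: "\<And>a. a \<in> V \<Longrightarrow> \<sigma> a \<in> V"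
    and sub: "Q'' \<subseteq> V \<times> V" "\<And>a b. (a, b) \<in> Q'' \<Longrightarrow> (a, b) \<in> Q \<or> (\<sigma> a, \<sigma> b) \<in> Q'"
    and eq: "\<And>a. a \<in> V \<Longrightarrow> \<sigma>'' a = \<sigma>' (\<sigma> a)"
  shows "performs V E (Ms @ Ms') \<sigma>'' Q''"
proof -
  let ?L = "Ms @ Ms'"
  have "\<exists>t\<le>length ?L. {fold swap_along (take t ?L) a, fold swap_along (take t ?L) b} \<in> E"
    if ab: "(a, b) \<in> Q''" for a b
  proof (cases "(a, b) \<in> Q")
    case True
    then obtain t where t: "t \<le> length Ms"
      "{fold swap_along (take t Ms) a, fold swap_along (take t Ms) b} \<in> E"
      using 1 unfolding performs_def by blast
    then show ?thesis by (intro exI[of _ t]) simp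
  next
    case False
    with sub(2)[OF ab] have "(\<sigma> a, \<sigma> b) \<in> Q'" by simp
    then obtain t where t: "t \<le> length Ms'"
      "{fold swap_along (take t Ms') (\<sigma> a), fold swap_along (take t Ms') (\<sigma> b)} \<in> E"
      using 2 unfolding performs_def by blast
    moreover have "fold swap_along Ms a = \<sigma> a" "fold swap_along Ms b = \<sigma> b"
      using 1 ab sub(1) unfolding performs_def by auto
    ultimately show ?thesis by (intro exI[of _ "length Ms + t"]) simp
  qed
  then show ?thesis
    using 1 2 V eq unfolding performs_def by auto
qed

section \<open>Odd-even transposition along a sequence of hops\<close>

text \<open>\<open>J\<close> collects the left positions of the swapped pairs. This is an involution
  only if \<open>J\<close> has no two consecutive elements, which the parity hypotheses below
  ensure.\<close>

definition adjacent_swaps :: "nat set \<Rightarrow> nat \<Rightarrow> nat" where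
  "adjacent_swaps J p = (if p \<in> J then Suc p else if 0 < p \<and> p - 1 \<in> J then p - 1 else p)"

text \<open>Allows one phase of odd-even transposition to be split into colour classes that are
  performed one after the other.\<close>

lemma adjacent_swaps_Un:
  assumes "\<And>i. i \<in> J \<union> J' \<Longrightarrow> even (i + q)" "J \<inter> J' = {}"
  shows "adjacent_swaps J' (adjacent_swaps J p) = adjacent_swaps (J \<union> J') p"
proof -
  have no: "\<not> (i \<in> J \<union> J' \<and> Suc i \<in> J \<union> J')" for i
    using assms(1)[of i] assms(1)[of "Suc i"] by auto
  show ?thesis
  proof (cases p)
    case 0
    then show ?thesis
      using no[of 0] assms(2) by (auto simp: adjacent_swaps_def)
  next
    case (Suc k)
    then show ?thesis
      using no[of k] no[of p] no[of "k - 1"] assms(2) by (cases k) (auto simp: adjacent_swaps_def)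
  qed
qed

lemma adjacent_swaps_involution:
  assumes "\<And>i. i \<in> J \<Longrightarrow> even (i + q)"
  shows "adjacent_swaps J (adjacent_swaps J p) = p"
proof -
  have "\<not> (i \<in> J \<and> Suc i \<in> J)" for i
    using assms(1)[of i] assms(1)[of "Suc i"] by auto
  then show ?thesis
    unfolding adjacent_swaps_def by (cases p) (auto split: if_splits)
qed

text \<open>Odd-even transposition without comparisons: every pair of the right parity is swapped,
  so the motion depends on the starting position alone.\<close>

primrec oet_position :: "nat \<Rightarrow> nat \<Rightarrow> nat \<Rightarrow> nat" where
  "oet_position n 0 p = p"
| "oet_position n (Suc t) p = adjacent_swaps {i. Suc i < n \<and> even (i + t)} (oet_position n t p)"

text \<open>
  An item circulates with unit speed on a cycle of length \<open>2 * n\<close> that is folded onto the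
  positions \<open>0, \<dots>, n - 1\<close>.
\<close>

lemma oet_position_closed_form:
  assumes "p < n" "t \<le> n"
  shows "oet_position n t p =
    (let x = (if even p then p else 2 * n - 1 - p) + t
     in if x < n then x else if x < 2 * n then 2 * n - 1 - x else x - 2 * n)"
  using assms(2)
proof (induction t)
  case 0
  then show ?case using assms by (auto simp: Let_def)
next
  case (Suc t)
  \<comment> \<open>The coordinate on the unfolded cycle: even positions start on the half that
    moves right, odd ones on the half that moves left. It starts below \<open>2 * n\<close> and
    advances by at most \<open>n\<close>, so three branches suffice.\<close>
  define x where "x = (if even p then p else 2 * n - 1 - p) + t"
  have x: "even (x + t)" "Suc x < 3 * n"
    using Suc.prems assms(1) by (auto simp: x_def)
  have IH: "oet_position n t p =
      (if x < n then x else if x < 2 * n then 2 * n - 1 - x else x - 2 * n)"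
    using Suc by (simp add: x_def Let_def)
  have "adjacent_swaps {i. Suc i < n \<and> even (i + t)} (oet_position n t p) =
      (if Suc x < n then Suc x else if Suc x < 2 * n then 2 * n - 1 - Suc x else Suc x - 2 * n)"
  proof -
    consider "x < n" | "n \<le> x" "x < 2 * n" | "2 * n \<le> x" by linarith
    then show ?thesis
    proof cases
      case 1
      then have eq: "oet_position n t p = x" by (simp add: IH)
      have "x \<noteq> 0 \<Longrightarrow> odd (x - 1 + t)" using x(1) by presburger
      then show ?thesis unfolding eq adjacent_swaps_def using 1 x by auto
    next
      case 2
      define y where "y = 2 * n - 1 - x"
      then have eq: "oet_position n t p = y" using 2 by (simp add: IH)
      have "x + y + 1 = 2 * n" using 2 by (simp add: y_def)
      then have "odd (y + t)" "y \<noteq> 0 \<Longrightarrow> even (y - 1 + t)" "y < n"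
        using x(1) 2 by presburger+
      moreover have "y \<noteq> 0 \<Longrightarrow> Suc x < 2 * n" "y = 0 \<Longrightarrow> Suc x = 2 * n" "2 * n - 1 - Suc x = y - 1"
        using 2 by (auto simp: y_def)
      ultimately show ?thesis unfolding eq adjacent_swaps_def using 2 by auto
    next
      case 3
      define y where "y = x - 2 * n"
      then have eq: "oet_position n t p = y" using 3 by (simp add: IH)
      have "even (y + t)" "Suc y < n" "Suc x - 2 * n = Suc y"
        using x 3 by (auto simp: y_def)
      then show ?thesis unfolding eq adjacent_swaps_def using 3 by auto
    qed
  qed
  then show ?case by (simp add: x_def Let_def)
qed

text \<open>\<open>n\<close> steps are half a turn of the folded cycle, which amounts to a
  reflection.\<close>

lemma oet_position_reverse:
  assumes "p < n"
  shows "oet_position n n p = n - 1 - p"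
  using assms by (subst oet_position_closed_form) (auto simp: Let_def)

lemma oet_position_less: "p < n \<Longrightarrow> oet_position n t p < n"
  by (induction t) (auto simp: adjacent_swaps_def)

lemma oet_position_inj:
  "oet_position n t a = oet_position n t b \<Longrightarrow> a = b"
proof (induction t)
  case (Suc t)
  then show ?case
    using adjacent_swaps_involution[of "{i. Suc i < n \<and> even (i + t)}" t]
    by (metis (no_types, lifting) mem_Collect_eq oet_position.simps(2))
qed auto

text \<open>Turns changes of order into meetings: two agents can exchange their order in one phase
  only by being swapped directly.\<close>

lemma adjacent_swaps_overtake:
  assumes "a < b" "adjacent_swaps J b < adjacent_swaps J a" "\<And>i. i \<in> J \<Longrightarrow> even (i + q)"
  shows "a \<in> J \<and> b = Suc a"
proof -
  have "\<not> (i \<in> J \<and> Suc i \<in> J)" for i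
    using assms(3)[of i] assms(3)[of "Suc i"] by auto
  then show ?thesis
    using assms(1,2) unfolding adjacent_swaps_def by (auto split: if_splits)
qed

section \<open>Odd-even transposition realized in a graph by coloured hops\<close>

context
  fixes V :: "'a set" and E :: "'a set set" and vs :: "'a list"
    and H :: "nat \<Rightarrow> 'a list" and col :: "nat \<Rightarrow> nat" and K n :: nat
  assumes vs: "distinct vs" "set vs = V" "length vs = n"
    and hops: "\<And>i. Suc i < n \<Longrightarrow> hop_in E (H i)"
    and ends: "\<And>i. Suc i < n \<Longrightarrow> hd (H i) = vs ! i" "\<And>i. Suc i < n \<Longrightarrow> last (H i) = vs ! Suc i"
    and col: "\<And>i. Suc i < n \<Longrightarrow> col i < K"
      "\<And>i j. Suc i < n \<Longrightarrow> Suc j < n \<Longrightarrow> i \<noteq> j \<Longrightarrow> col i = col j \<Longrightarrow> set (H i) \<inter> set (H j) = {}"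
begin

definition index_of :: "'a \<Rightarrow> nat" where
  "index_of a = inv_into {..<n} ((!) vs) a"

lemma index_of_nth [simp]: "p < n \<Longrightarrow> index_of (vs ! p) = p"
  unfolding index_of_def using vs by (intro inv_into_f_f inj_on_nth) auto

lemma in_V_nth: "a \<in> V \<Longrightarrow> \<exists>p<n. a = vs ! p"
  using vs by (auto simp: in_set_conv_nth)

definition by_index :: "(nat \<Rightarrow> nat) \<Rightarrow> 'a \<Rightarrow> 'a" where
  "by_index f a = vs ! f (index_of a)"

definition index_pairs :: "nat set \<Rightarrow> ('a \<times> 'a) set" where
  "index_pairs J = {(vs ! i, vs ! Suc i) | i. i \<in> J}"

lemma performs_parallel_moves:
  fixes q c
  defines "J \<equiv> {i. Suc i < n \<and> even (i + q) \<and> col i = c}"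
  shows "performs V E (parallel_moves J H) (by_index (adjacent_swaps J)) (index_pairs J)"
proof -
  have hJ: "hop_in E (H i)" if "i \<in> J" for i
    using that hops by (auto simp: J_def)
  have dJ: "set (H i) \<inter> set (H j) = {}" if "i \<in> J" "j \<in> J" "i \<noteq> j" for i j
    using col(2)[of i j] that by (auto simp: J_def)
  have ne: "H i \<noteq> []" if "i \<in> J" for i
    using hJ[OF that] by (auto simp: hop_in_def)
  have mem: "vs ! i \<in> set (H i)" "vs ! Suc i \<in> set (H i)" if "i \<in> J" for i
    using hd_in_set[OF ne[OF that]] last_in_set[OF ne[OF that]] ends[of i] that
    by (simp_all add: J_def)
  have "fold swap_along (parallel_moves J H) (vs ! p) = vs ! adjacent_swaps J p" if p: "p < n" for p
  proof (cases "\<exists>i\<in>J. vs ! p \<in> set (H i)")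
    case True
    then obtain i where i: "i \<in> J" "vs ! p \<in> set (H i)" by blast
    have Si: "Suc i < n" and ev: "even (i + q)" using i by (auto simp: J_def)
    have uniq: "j = i" if "j \<in> J" "vs ! p \<in> set (H j)" for j
      using dJ[of i j] i that by blast
    have other: "p \<in> J \<Longrightarrow> p = i" "0 < p \<Longrightarrow> p - 1 \<in> J \<Longrightarrow> p - 1 = i"
      using uniq[of p] uniq[of "p - 1"] mem(1)[of p] mem(2)[of "p - 1"] by simp_all
    have "fold swap_along (parallel_moves J H) (vs ! p) = Transposition.transpose (vs ! i) (vs ! Suc i) (vs ! p)"
      using fold_parallel_moves[of J E H, OF hJ dJ i] ends[OF Si] by simp
    also have "\<dots> = vs ! adjacent_swaps J p"
    proof -
      have "Suc i \<notin> J" using ev by (auto simp: J_def)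
      moreover have "vs ! p = vs ! i \<longleftrightarrow> p = i" "vs ! p = vs ! Suc i \<longleftrightarrow> p = Suc i"
        using vs Si p by (auto simp: nth_eq_iff_index_eq)
      \<comment> \<open>Here \<open>vs ! p\<close> is an inner vertex of the hop \<open>H i\<close>,
        so its agent is restored. As the hops in \<open>J\<close> are disjoint,
        \<open>vs ! p\<close> is not an end of another hop either, and both sides fix it.\<close>
      moreover have "adjacent_swaps J p = p" if "p \<noteq> i" "p \<noteq> Suc i"
        using other that by (cases p) (auto simp: adjacent_swaps_def)
      moreover have "adjacent_swaps J i = Suc i" "adjacent_swaps J (Suc i) = i"
        using i(1) \<open>Suc i \<notin> J\<close> by (simp_all add: adjacent_swaps_def)
      ultimately show ?thesis
        by (cases "p = i"; cases "p = Suc i") (simp_all add: Transposition.transpose_def)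
    qed
    finally show ?thesis .
  next
    case False
    then have "p \<notin> J" "\<not> (0 < p \<and> p - 1 \<in> J)"
      using mem[of p] mem[of "p - 1"] by auto
    moreover have "fold swap_along (parallel_moves J H) (vs ! p) = vs ! p"
      using False by (intro fold_parallel_moves_outside[of J E H, OF hJ dJ]) auto
    ultimately show ?thesis by (auto simp: adjacent_swaps_def)
  qed
  moreover have "\<exists>t\<le>5. {fold swap_along (take t (parallel_moves J H)) (vs ! i),
                        fold swap_along (take t (parallel_moves J H)) (vs ! Suc i)} \<in> E"
    if i: "i \<in> J" for i
  proof -
    obtain t where t: "t \<le> 5" "{fold swap_along (take t (hop_moves (H i))) (vs ! i),
                 fold swap_along (take t (hop_moves (H i))) (vs ! Suc i)} \<in> E"
      using hop_moves_meet[OF hJ[OF i]] ends[of i] i by (auto simp: J_def)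
    then show ?thesis
      using fold_parallel_moves_take[of J E H, OF hJ dJ i mem(1)[OF i] t(1)]
        fold_parallel_moves_take[of J E H, OF hJ dJ i mem(2)[OF i] t(1)]
      by (intro exI[of _ t]) auto
  qed
  ultimately show ?thesis
    using parallel_moves_matching[of J E H, OF hJ dJ]
    unfolding performs_def index_pairs_def by_index_def
    by (auto dest!: in_V_nth)
qed

lemma by_index_in: "(\<And>p. p < n \<Longrightarrow> f p < n) \<Longrightarrow> a \<in> V \<Longrightarrow> by_index f a \<in> V"
  using vs by (metis by_index_def in_V_nth index_of_nth nth_mem)

lemma adjacent_swaps_less: "J \<subseteq> {i. Suc i < n} \<Longrightarrow> p < n \<Longrightarrow> adjacent_swaps J p < n"
  by (auto simp: adjacent_swaps_def)

definition phase :: "nat \<Rightarrow> nat \<Rightarrow> 'a set set list" where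
  "phase q k = concat (map (\<lambda>c. parallel_moves {i. Suc i < n \<and> even (i + q) \<and> col i = c} H) [0..<k])"

lemma performs_phase:
  fixes q k
  defines "J \<equiv> {i. Suc i < n \<and> even (i + q) \<and> col i < k}"
  shows "performs V E (phase q k) (by_index (adjacent_swaps J)) (index_pairs J)"
  unfolding J_def
proof (induction k)
  case 0
  show ?case
    by (auto simp: phase_def performs_def index_pairs_def by_index_def adjacent_swaps_def dest!: in_V_nth)
next
  case (Suc k)
  let ?J = "{i. Suc i < n \<and> even (i + q) \<and> col i < k}"
  let ?J' = "{i. Suc i < n \<and> even (i + q) \<and> col i = k}"
  have Un: "{i. Suc i < n \<and> even (i + q) \<and> col i < Suc k} = ?J \<union> ?J'" by auto
  have "performs V E (phase q k @ parallel_moves ?J' H)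
          (by_index (adjacent_swaps (?J \<union> ?J'))) (index_pairs (?J \<union> ?J'))"
  proof (rule performs_append[OF Suc.IH performs_parallel_moves])
    fix a assume a: "a \<in> V"
    show "by_index (adjacent_swaps ?J) a \<in> V"
      by (intro by_index_in adjacent_swaps_less a) auto
    obtain p where p: "p < n" "a = vs ! p" using in_V_nth[OF a] by blast
    have "adjacent_swaps ?J' (adjacent_swaps ?J p) = adjacent_swaps (?J \<union> ?J') p"
      by (rule adjacent_swaps_Un[of _ _ q]) auto
    moreover have "adjacent_swaps ?J p < n" using p by (intro adjacent_swaps_less) auto
    ultimately show "by_index (adjacent_swaps (?J \<union> ?J')) a =
        by_index (adjacent_swaps ?J') (by_index (adjacent_swaps ?J) a)"
      using p by (simp add: by_index_def)
  next
    show "index_pairs (?J \<union> ?J') \<subseteq> V \<times> V"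
      using vs by (auto simp: index_pairs_def)
  next
    fix a b assume "(a, b) \<in> index_pairs (?J \<union> ?J')"
    then obtain i where i: "i \<in> ?J \<union> ?J'" "a = vs ! i" "b = vs ! Suc i"
      by (auto simp: index_pairs_def)
    show "(a, b) \<in> index_pairs ?J \<or>
       (by_index (adjacent_swaps ?J) a, by_index (adjacent_swaps ?J) b) \<in> index_pairs ?J'"
    proof (cases "i \<in> ?J")
      case True
      then show ?thesis using i by (auto simp: index_pairs_def)
    next
      case False
      then have i': "i \<in> ?J'" using i by blast
      \<comment> \<open>By parity neither \<open>i - 1\<close> nor \<open>Suc i\<close> lies in
        \<open>?J\<close>, so both agents are still in place when the colour of \<open>i\<close> has
        its turn.\<close>
      then have "adjacent_swaps ?J i = i" "adjacent_swaps ?J (Suc i) = Suc i"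
        by (auto simp: adjacent_swaps_def)
      then show ?thesis using i i' by (auto simp: index_pairs_def by_index_def)
    qed
  qed
  then show ?case unfolding Un by (simp add: phase_def)
qed

definition phases :: "nat \<Rightarrow> 'a set set list" where
  "phases T = concat (map (\<lambda>t. phase t K) [0..<T])"

text \<open>The invariant behind the method: two agents in inverted order have overtaken each other
  and hence have met. After \<open>n\<close> phases every pair is inverted.\<close>

lemma performs_phases:
  "performs V E (phases T) (by_index (oet_position n T))
     {(vs ! a, vs ! b) | a b. a < b \<and> b < n \<and> oet_position n T b < oet_position n T a}"
    (is "performs V E _ _ (?Q T)")
proof (induction T)
  case 0
  show ?case
    by (auto simp: phases_def performs_def by_index_def dest!: in_V_nth)
next
  case (Suc T)
  define J where "J = {i. Suc i < n \<and> even (i + T)}"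
  have "J = {i. Suc i < n \<and> even (i + T) \<and> col i < K}"
    using col(1) by (auto simp: J_def)
  then have ph: "performs V E (phase T K) (by_index (adjacent_swaps J)) (index_pairs J)"
    using performs_phase[of T K] by simp
  have "performs V E (phases T @ phase T K) (by_index (oet_position n (Suc T))) (?Q (Suc T))"
  proof (rule performs_append[OF Suc.IH ph])
    fix a assume a: "a \<in> V"
    show "by_index (oet_position n T) a \<in> V"
      by (intro by_index_in oet_position_less a) auto
    obtain p where p: "p < n" "a = vs ! p" using in_V_nth[OF a] by blast
    then show "by_index (oet_position n (Suc T)) a =
        by_index (adjacent_swaps J) (by_index (oet_position n T) a)"
      using oet_position_less[OF p(1), of T] by (simp add: by_index_def J_def)
  next
    show "?Q (Suc T) \<subseteq> V \<times> V" using vs by auto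
  next
    fix x y assume "(x, y) \<in> ?Q (Suc T)"
    then obtain a b where ab: "x = vs ! a" "y = vs ! b" "a < b" "b < n"
      "oet_position n (Suc T) b < oet_position n (Suc T) a" by blast
    show "(x, y) \<in> ?Q T \<or>
       (by_index (oet_position n T) x, by_index (oet_position n T) y) \<in> index_pairs J"
    proof (cases "oet_position n T b < oet_position n T a")
      case True
      then show ?thesis using ab by blast
    next
      case False
      then have lt: "oet_position n T a < oet_position n T b"
        using oet_position_inj[of n T a b] ab by fastforce
      have "oet_position n T a \<in> J \<and> oet_position n T b = Suc (oet_position n T a)"
        using ab(5) lt by (intro adjacent_swaps_overtake[of _ _ J T]) (auto simp: J_def)
      then show ?thesis
        using ab by (auto simp: index_pairs_def by_index_def)
    qed
  qed
  then show ?case by (simp add: phases_def del: oet_position.simps)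
qed

lemma length_phases: "length (phases T) = 5 * K * T"
  by (simp add: phases_def phase_def length_concat comp_def sum_list_triv)

text \<open>There are \<open>n\<close> phases, each with \<open>K\<close> colours, and five rounds
  for each colour.\<close>

lemma acquaintance_time_coloured_hops: "acquaintance_time V E \<le> enat (5 * K * n)"
proof -
  have P: "performs V E (phases n) (by_index (oet_position n n)) {(vs ! a, vs ! b) | a b. a < b \<and> b < n}"
  proof -
    have "oet_position n n b < oet_position n n a" if "a < b" "b < n" for a b
      using that by (simp add: oet_position_reverse diff_less_mono2)
    then have "{(vs ! a, vs ! b) | a b. a < b \<and> b < n \<and> oet_position n n b < oet_position n n a}
        = {(vs ! a, vs ! b) | a b. a < b \<and> b < n}" by blast
    with performs_phases[of n] show ?thesis by simp
  qed
  have "\<exists>t\<le>length (phases n). {agent_position (phases n) t x, agent_position (phases n) t y} \<in> E"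
    if xy: "x \<in> V" "y \<in> V" "x \<noteq> y" for x y
  proof -
    obtain a b where ab: "a < n" "b < n" "x = vs ! a" "y = vs ! b"
      using in_V_nth[OF xy(1)] in_V_nth[OF xy(2)] by blast
    then consider "a < b" | "b < a" using xy by (metis nat_neq_iff)
    then show ?thesis
    proof cases
      case 1
      then show ?thesis using P ab unfolding performs_def agent_position_def by blast
    next
      case 2
      then have "\<exists>t\<le>length (phases n). {agent_position (phases n) t y, agent_position (phases n) t x} \<in> E"
        using P ab unfolding performs_def agent_position_def by blast
      then show ?thesis by (simp add: insert_commute)
    qed
  qed
  then have "acquainting_strategy V E (phases n)"
    using P by (auto simp: acquainting_strategy_def performs_def)
  then have "acquaintance_time V E \<le> enat (length (phases n))"
    unfolding acquaintance_time_def by (intro INF_lower) simp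
  then show ?thesis by (simp add: length_phases)
qed

end

section \<open>Trees of bounded degree\<close>

text \<open>Numbers are coloured in increasing order, so only conflicts with smaller ones have to be
  counted.\<close>

lemma greedy_colouring:
  fixes conf :: "nat \<Rightarrow> nat \<Rightarrow> bool"
  assumes "\<And>i. i < m \<Longrightarrow> card {j. j < i \<and> conf i j} < K"
  shows "\<exists>col. (\<forall>i<m. col i < K) \<and> (\<forall>i<m. \<forall>j<i. conf i j \<longrightarrow> col i \<noteq> (col j :: nat))"
  using assms
proof (induction m)
  case (Suc m)
  then obtain col where col: "\<forall>i<m. col i < K" "\<forall>i<m. \<forall>j<i. conf i j \<longrightarrow> col i \<noteq> (col j :: nat)"
    using less_SucI by blast
  let ?S = "{j. j < m \<and> conf m j}"
  have "card (col ` ?S) \<le> card ?S" by (intro card_image_le) auto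
  also have "\<dots> < card {..<K}" using Suc.prems[of m] by simp
  finally have "\<not> {..<K} \<subseteq> col ` ?S"
    using card_mono[of "col ` ?S" "{..<K}"] by auto
  then obtain k where k: "k < K" "k \<notin> col ` ?S" by blast
  show ?case
    by (rule exI[of _ "col(m := k)"]) (use col k in \<open>auto simp: less_Suc_eq image_iff\<close>)
qed auto

section \<open>Tours of a tree by short hops, and their load on the vertices\<close>

fun chained :: "'a list \<Rightarrow> 'a list list \<Rightarrow> bool" where
  "chained (x # y # xs) (h # H) \<longleftrightarrow> hd h = x \<and> last h = y \<and> chained (y # xs) H"
| "chained [x] [] \<longleftrightarrow> True"
| "chained _ _ \<longleftrightarrow> False"

lemma chained_length: "chained xs H \<Longrightarrow> length xs = Suc (length H)"
  by (induction xs H rule: chained.induct) auto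

lemma chained_nth:
  "chained xs H \<Longrightarrow> i < length H \<Longrightarrow> hd (H ! i) = xs ! i \<and> last (H ! i) = xs ! Suc i"
proof (induction xs H arbitrary: i rule: chained.induct)
  case (1 x y xs h H)
  then show ?case by (cases i) auto
qed auto

lemma chained_append:
  "chained xs H \<Longrightarrow> chained ys H' \<Longrightarrow> hd h = last xs \<Longrightarrow> last h = hd ys
    \<Longrightarrow> chained (xs @ ys) (H @ h # H')"
proof (induction xs H rule: chained.induct)
  case (2 x)
  then show ?case by (cases ys) auto
qed auto

lemma chained_rev:
  assumes "chained xs H" "\<And>h. h \<in> set H \<Longrightarrow> h \<noteq> []"
  shows "chained (rev xs) (rev (map rev H))"
  using assms
proof (induction xs H rule: chained.induct)
  case (1 x y xs h H)
  have "chained (rev (y # xs) @ [x]) (rev (map rev H) @ rev h # [])"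
    using 1 by (intro chained_append) (auto simp: hd_rev last_rev)
  then show ?case by simp
qed auto

definition load :: "'a list list \<Rightarrow> 'a \<Rightarrow> nat" where
  "load H v = length (filter (\<lambda>h. v \<in> set h) H)"

lemma load_append: "load (H @ H') v = load H v + load H' v"
  by (simp add: load_def)

lemma load_Cons: "load (h # H) v = (if v \<in> set h then 1 else 0) + load H v"
  by (simp add: load_def)

lemma load_rev: "load (rev (map rev H)) v = load H v"
  by (simp add: load_def rev_filter[symmetric] filter_map comp_def)

lemma load_eq_0: "(\<And>h. h \<in> set H \<Longrightarrow> v \<notin> set h) \<Longrightarrow> load H v = 0"
  by (simp add: load_def)

lemma hop_in_rev: "hop_in E (rev h) \<longleftrightarrow> hop_in E h"
proof -
  have "(\<lambda>u v. {v, u} \<in> E) = (\<lambda>u v. {u, v} \<in> E)" by (simp add: insert_commute)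
  then show ?thesis
    unfolding hop_in_def path_in_def successively_rev distinct_rev length_rev
    by (metis (no_types))
qed

text \<open>
  A Hamiltonian path in the cube of a tree on \<open>X\<close> rooted at \<open>r\<close>, in the manner of Sekanina: it
  starts in \<open>r\<close> and ends next to \<open>r\<close>. The function \<open>d\<close> bounds the degrees in the tree. The root
  and the last vertex have one unit of load to spare, which the next merge of trees consumes.
\<close>

definition hop_tour :: "'a set set \<Rightarrow> 'a set \<Rightarrow> 'a \<Rightarrow> ('a \<Rightarrow> nat) \<Rightarrow> bool" where
  "hop_tour E X r d \<longleftrightarrow> (\<exists>xs H. chained xs H \<and> distinct xs \<and> set xs = X \<and> hd xs = r \<and>
     (\<forall>h\<in>set H. hop_in E h \<and> set h \<subseteq> X) \<and> (last xs = r \<or> {r, last xs} \<in> E) \<and>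
     (\<forall>v\<in>X. load H v \<le> d v + (if v = r \<or> v = last xs then 0 else 1)))"

lemma hop_tour_singleton: "hop_tour E {r} r d"
  unfolding hop_tour_def by (rule exI[of _ "[r]"], rule exI[of _ "[]"]) (simp add: load_def)

lemma hop_tour_mono:
  assumes "hop_tour E X r d" "\<And>v. d v \<le> d' v"
  shows "hop_tour E X r d'"
proof -
  obtain xs H where *: "chained xs H" "distinct xs" "set xs = X" "hd xs = r"
    "\<forall>h\<in>set H. hop_in E h \<and> set h \<subseteq> X" "last xs = r \<or> {r, last xs} \<in> E"
    "\<And>v. v \<in> X \<Longrightarrow> load H v \<le> d v + (if v = r \<or> v = last xs then 0 else 1)"
    using assms(1) unfolding hop_tour_def by blast
  have "\<forall>v\<in>X. load H v \<le> d' v + (if v = r \<or> v = last xs then 0 else 1)"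
    using *(7) assms(2) by (meson add_le_mono1 order_trans)
  with *(1-6) show ?thesis unfolding hop_tour_def by blast
qed

text \<open>The tour of \<open>Y\<close> is appended in reverse, so the result starts in
  \<open>r\<close> and ends in its neighbour \<open>c\<close>. The new hop runs from
  \<open>last xs\<close> through \<open>r\<close> and \<open>c\<close> to \<open>last ys\<close>,
  with at most four vertices; it is shorter if a tour consists of its root only. It loads these four
  vertices once more: the two former ends may take it because they stop being ends, while
  \<open>r\<close> and \<open>c\<close> pay with the increase from \<open>d\<close> to
  \<open>d'\<close>.\<close>

lemma hop_tour_join:
  assumes X: "hop_tour E X r d" and Y: "hop_tour E Y c d" and disj: "X \<inter> Y = {}"
    and rc: "{r, c} \<in> E"
    and d': "d r + 1 \<le> d' r" "d c + 1 \<le> d' c" "\<And>v. d v \<le> d' v"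
  shows "hop_tour E (X \<union> Y) r d'"
proof -
  obtain xs H where xs: "chained xs H" "distinct xs" "set xs = X" "hd xs = r"
    "\<And>h. h \<in> set H \<Longrightarrow> hop_in E h \<and> set h \<subseteq> X" "last xs = r \<or> {r, last xs} \<in> E"
    "\<And>v. v \<in> X \<Longrightarrow> load H v \<le> d v + (if v = r \<or> v = last xs then 0 else 1)"
    using X unfolding hop_tour_def by blast
  obtain ys G where ys: "chained ys G" "distinct ys" "set ys = Y" "hd ys = c"
    "\<And>h. h \<in> set G \<Longrightarrow> hop_in E h \<and> set h \<subseteq> Y" "last ys = c \<or> {c, last ys} \<in> E"
    "\<And>v. v \<in> Y \<Longrightarrow> load G v \<le> d v + (if v = c \<or> v = last ys then 0 else 1)"
    using Y unfolding hop_tour_def by blast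
  have ne: "xs \<noteq> []" "ys \<noteq> []" using xs(1) ys(1) by auto
  define x y where "x = last xs" and "y = last ys"
  have in_X: "x \<in> X" "r \<in> X" and in_Y: "y \<in> Y" "c \<in> Y"
    using ne xs(3,4) ys(3,4) by (auto simp: x_def y_def)
  define l where "l = (if x = r then [r] else [x, r]) @ (if y = c then [c] else [c, y])"
  have set_l: "set l = {x, r, c, y}" by (auto simp: l_def)
  have "hop_in E l"
    using in_X in_Y disj xs(6) ys(6) rc
    by (auto simp: l_def hop_in_def path_in_def x_def[symmetric] y_def[symmetric] insert_commute)
  moreover have "chained (xs @ rev ys) (H @ l # rev (map rev G))"
  proof (rule chained_append[OF xs(1) chained_rev[OF ys(1)]])
    show "h \<noteq> []" if "h \<in> set G" for h using ys(5)[OF that] by (auto simp: hop_in_def)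
  qed (use ne in \<open>auto simp: l_def x_def y_def hd_rev\<close>)
  moreover have "last (xs @ rev ys) = c" "hd (xs @ rev ys) = r"
    using ne xs(4) ys(4) by (auto simp: last_rev)
  moreover have "load (H @ l # rev (map rev G)) v \<le> d' v + (if v = r \<or> v = c then 0 else 1)"
    if v: "v \<in> X \<union> Y" for v
  proof (cases "v \<in> X")
    case True
    then have "load G v = 0" using ys(5) disj by (intro load_eq_0) blast
    moreover have "v \<noteq> y" "v \<noteq> c" using True in_Y disj by auto
    ultimately have "load (H @ l # rev (map rev G)) v = load H v + (if v = x \<or> v = r then 1 else 0)"
      by (simp add: load_append load_Cons load_rev set_l)
    moreover have "load H v \<le> d v + (if v = r \<or> v = x then 0 else 1)"
      using xs(7)[OF True] by (simp only: x_def)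
    moreover have "v = r \<Longrightarrow> d v + 1 \<le> d' v" using d'(1) by simp
    ultimately show ?thesis
      using d'(3)[of v] \<open>v \<noteq> c\<close> by (cases "v = r"; cases "v = x") simp_all
  next
    case False
    then have "v \<in> Y" using v by simp
    then have "load H v = 0" using xs(5) disj by (intro load_eq_0) blast
    moreover have "v \<noteq> x" "v \<noteq> r" using False in_X by auto
    ultimately have "load (H @ l # rev (map rev G)) v = load G v + (if v = y \<or> v = c then 1 else 0)"
      by (simp add: load_append load_Cons load_rev set_l)
    moreover have "load G v \<le> d v + (if v = c \<or> v = y then 0 else 1)"
      using ys(7)[OF \<open>v \<in> Y\<close>] by (simp only: y_def)
    moreover have "v = c \<Longrightarrow> d v + 1 \<le> d' v" using d'(2) by simp
    ultimately show ?thesis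
      using d'(3)[of v] \<open>v \<noteq> r\<close> by (cases "v = c"; cases "v = y") simp_all
  qed
  moreover have "\<forall>h\<in>set (H @ l # rev (map rev G)). hop_in E h \<and> set h \<subseteq> X \<union> Y"
  proof -
    have "hop_in E h \<and> set h \<subseteq> X \<union> Y" if "h \<in> set H \<or> h \<in> set G" for h
      using xs(5)[of h] ys(5)[of h] that by blast
    moreover have "hop_in E l \<and> set l \<subseteq> X \<union> Y"
      using \<open>hop_in E l\<close> set_l in_X in_Y by simp
    ultimately show ?thesis by (simp add: hop_in_rev ball_Un)
  qed
  moreover have "distinct (xs @ rev ys)" "set (xs @ rev ys) = X \<union> Y"
    using xs(2,3) ys(2,3) disj by simp_all
  ultimately show ?thesis
    unfolding hop_tour_def using rc
    by (intro exI[of _ "xs @ rev ys"] exI[of _ "H @ l # rev (map rev G)"] conjI ballI) (simp_all only: simp_thms)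
qed

text \<open>
  Each vertex is merged into its parent \<open>F v\<close>, the vertices of largest rank \<open>h\<close> first; \<open>root u\<close>
  is the root of the current tree of \<open>u\<close>.
\<close>

lemma hop_tour_parent_function:
  fixes F :: "'a \<Rightarrow> 'a" and h :: "'a \<Rightarrow> nat"
  assumes fin: "finite V" and p0: "p0 \<in> V"
    and F: "\<And>v. v \<in> V \<Longrightarrow> v \<noteq> p0 \<Longrightarrow> F v \<in> V \<and> {v, F v} \<in> E \<and> h (F v) < h v"
  shows "hop_tour E V p0 (\<lambda>v. card {u \<in> V - {p0}. F u = v} + (if v = p0 then 0 else 1))"
proof -
  \<comment> \<open>The degree of \<open>v\<close> in the forest of the edges from members of
    \<open>Z\<close> to their parents; the second summand is the edge from \<open>v\<close> to its
    own parent.\<close>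
  define dg where "dg Z v = card {u \<in> Z. F u = v} + (if v \<in> Z then 1 else 0)" for Z v
  have "\<exists>Z root. Z \<subseteq> V - {p0} \<and> card Z = k \<and> (\<forall>u\<in>Z. \<forall>v\<in>V - {p0} - Z. h v \<le> h u) \<and>
          root ` V \<subseteq> V \<and> (\<forall>u\<in>V - Z. root u = u) \<and> (\<forall>u\<in>V. root u \<in> V - Z) \<and>
          (\<forall>r\<in>V - Z. hop_tour E {u \<in> V. root u = r} r (dg Z))"
    if "k \<le> card (V - {p0})" for k
    using that
  proof (induction k)
    case 0
    have "{u \<in> V. u = r} = {r}" if "r \<in> V" for r using that by auto
    then show ?case by (intro exI[of _ "{}"] exI[of _ id]) (auto simp: hop_tour_singleton)
  next
    case (Suc k)
    then obtain Z root where Z: "Z \<subseteq> V - {p0}" "card Z = k" "\<forall>u\<in>Z. \<forall>v\<in>V - {p0} - Z. h v \<le> h u"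
      "\<forall>u\<in>V - Z. root u = u" "\<forall>u\<in>V. root u \<in> V - Z"
      "\<forall>r\<in>V - Z. hop_tour E {u \<in> V. root u = r} r (dg Z)"
      by auto
    have finZ: "finite Z" using Z(1) fin finite_subset by blast
    have ne: "V - {p0} - Z \<noteq> {}"
      using Suc.prems Z(1,2) finZ fin by (metis Diff_eq_empty_iff card_mono not_less_eq_eq)
    obtain c where c: "c \<in> V - {p0} - Z" "\<And>v. v \<in> V - {p0} - Z \<Longrightarrow> h v \<le> h c"
    proof -
      have "finite (h ` (V - {p0} - Z))" using fin by auto
      with ne have "Max (h ` (V - {p0} - Z)) \<in> h ` (V - {p0} - Z)" by (intro Max_in) auto
      then obtain c where "c \<in> V - {p0} - Z" "h c = Max (h ` (V - {p0} - Z))" by (metis imageE)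
      with \<open>finite (h ` (V - {p0} - Z))\<close> show thesis by (intro that[of c]) auto
    qed
    have Fc: "F c \<in> V" "{c, F c} \<in> E" "h (F c) < h c" using F[of c] c(1) by auto
    \<comment> \<open>Vertices merged earlier have rank at least \<open>h c\<close>, so the lower
      ranked \<open>F c\<close> is still the root of its own tree and the edge to \<open>c\<close>
      joins two roots.\<close>
    have FcZ: "F c \<notin> Z" using Z(3) c(1) Fc(3) by (metis not_less)
    have Fcc: "F c \<noteq> c" using Fc(3) by auto
    define root' where "root' u = (if root u = c then F c else root u)" for u
    have tour: "hop_tour E {u \<in> V. root' u = r} r (dg (insert c Z))" if r: "r \<in> V - insert c Z" for r
    proof -
      have dg1: "dg Z v \<le> dg (insert c Z) v" for v
        using finZ unfolding dg_def by (intro add_mono card_mono) auto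
      have dg2: "dg Z c + 1 \<le> dg (insert c Z) c"
      proof -
        have "card {u \<in> Z. F u = c} \<le> card {u \<in> insert c Z. F u = c}"
          using finZ by (intro card_mono) auto
        then show ?thesis using c(1) by (simp add: dg_def)
      qed
      have dg3: "dg Z (F c) + 1 \<le> dg (insert c Z) (F c)"
      proof -
        have "{u \<in> insert c Z. F u = F c} = insert c {u \<in> Z. F u = F c}" by auto
        then show ?thesis using c(1) finZ FcZ by (simp add: dg_def)
      qed
      have step: "hop_tour E X r (dg (insert c Z))" if "hop_tour E X r (dg Z)" for X
        using hop_tour_mono[OF that dg1] .
      show ?thesis
      proof (cases "r = F c")
        case False
        then have "{u \<in> V. root' u = r} = {u \<in> V. root u = r}" using r by (auto simp: root'_def)
        then show ?thesis using step Z(6) r by auto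
      next
        case True
        then have "{u \<in> V. root' u = r} = {u \<in> V. root u = F c} \<union> {u \<in> V. root u = c}"
          by (auto simp: root'_def)
        moreover have "hop_tour E ({u \<in> V. root u = F c} \<union> {u \<in> V. root u = c}) (F c) (dg (insert c Z))"
          using Z(6) c(1) r True Fcc Fc(2) dg1 dg2 dg3
          by (intro hop_tour_join[where d = "dg Z"]) (auto simp: insert_commute)
        ultimately show ?thesis using True by simp
      qed
    qed
    show ?case
    proof (intro exI[of _ "insert c Z"] exI[of _ root'] conjI)
      show "card (insert c Z) = Suc k" using finZ c(1) Z(2) by simp
      show "\<forall>u\<in>insert c Z. \<forall>v\<in>V - {p0} - insert c Z. h v \<le> h u" using Z(3) c by auto
      show "\<forall>u\<in>V - insert c Z. root' u = u" using Z(4) by (auto simp: root'_def)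
      show "\<forall>u\<in>V. root' u \<in> V - insert c Z" using Z(5) Fc(1) FcZ Fcc by (auto simp: root'_def)
      then show "root' ` V \<subseteq> V" by auto
    qed (use tour Z c in auto)
  qed
  from this[of "card (V - {p0})"] obtain Z root where
    Z: "Z \<subseteq> V - {p0}" "card Z = card (V - {p0})" "\<forall>u\<in>V. root u \<in> V - Z"
      "\<forall>r\<in>V - Z. hop_tour E {u \<in> V. root u = r} r (dg Z)" by auto
  then have "Z = V - {p0}" using fin by (intro card_subset_eq) auto
  then have "p0 \<in> V - Z" "V - Z \<subseteq> {p0}" using p0 by auto
  then have "{u \<in> V. root u = p0} = V" "hop_tour E {u \<in> V. root u = p0} p0 (dg Z)"
    using Z(3,4) by blast+
  moreover have "hop_tour E V p0 (\<lambda>v. card {u \<in> V - {p0}. F u = v} + (if v = p0 then 0 else 1))"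
    if "hop_tour E V p0 (dg (V - {p0}))"
    using that by (rule hop_tour_mono) (auto simp: dg_def)
  ultimately show ?thesis using \<open>Z = V - {p0}\<close> by simp
qed

text \<open>A hop has at most four vertices, each lying on at most \<open>D\<close> hops. It
  therefore meets at most \<open>4 * D\<close> earlier ones, and \<open>4 * D + 1\<close> colours
  suffice.\<close>

lemma acquaintance_time_hop_tour:
  assumes tour: "hop_tour E V r d" and d: "\<And>v. v \<in> V \<Longrightarrow> d v < D"
  shows "acquaintance_time V E \<le> enat (5 * (4 * D + 1) * card V)"
proof -
  obtain xs H where xs: "chained xs H" "distinct xs" "set xs = V"
    "\<And>h. h \<in> set H \<Longrightarrow> hop_in E h \<and> set h \<subseteq> V"
    "\<And>v. v \<in> V \<Longrightarrow> load H v \<le> d v + (if v = r \<or> v = last xs then 0 else 1)"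
    using tour unfolding hop_tour_def by blast
  have len: "length xs = card V" using xs(2,3) distinct_card by force
  have lenH: "i < length H \<longleftrightarrow> Suc i < card V" for i
    using chained_length[OF xs(1)] len by auto
  have load: "load H v \<le> D" if "v \<in> V" for v
    using xs(5)[OF that] d[OF that] by (simp split: if_splits)
  let ?conf = "\<lambda>i j. set (H ! i) \<inter> set (H ! j) \<noteq> {}"
  have "card {j. j < i \<and> ?conf i j} < 4 * D + 1" if i: "i < length H" for i
  proof -
    have h: "hop_in E (H ! i)" "set (H ! i) \<subseteq> V" using xs(4) i by auto
    have "{j. j < i \<and> ?conf i j} \<subseteq> (\<Union>v\<in>set (H ! i). {j. j < length H \<and> v \<in> set (H ! j)})"
      using i by auto
    then have "card {j. j < i \<and> ?conf i j} \<le> card (\<Union>v\<in>set (H ! i). {j. j < length H \<and> v \<in> set (H ! j)})"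
      by (intro card_mono) auto
    also have "\<dots> \<le> (\<Sum>v\<in>set (H ! i). card {j. j < length H \<and> v \<in> set (H ! j)})"
      by (intro card_UN_le) auto
    also have "\<dots> \<le> (\<Sum>v\<in>set (H ! i). D)"
      using load h(2) by (intro sum_mono) (auto simp: load_def length_filter_conv_card)
    also have "\<dots> \<le> 4 * D"
      using h(1) card_length[of "H ! i"] by (simp add: hop_in_def)
    finally show ?thesis by simp
  qed
  then obtain col where col: "\<forall>i<length H. col i < 4 * D + 1"
      "\<forall>i<length H. \<forall>j<i. ?conf i j \<longrightarrow> col i \<noteq> (col j :: nat)"
    using greedy_colouring[of "length H" ?conf "4 * D + 1"] by blast
  show ?thesis
  proof (rule acquaintance_time_coloured_hops[where vs = xs and H = "(!) H" and col = col])
    fix i j assume "Suc i < card V" "Suc j < card V" "i \<noteq> j" "col i = col j"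
    then show "set (H ! i) \<inter> set (H ! j) = {}"
      using col(2) lenH by (metis Int_commute linorder_neqE_nat)
  qed (use xs len lenH col chained_nth[OF xs(1)] in auto)
qed

text \<open>The rank \<open>h\<close> excludes cycles of the parent function. With the edge to the
  parent, degrees are at most \<open>D + 1\<close>, hence strictly below the \<open>D + 2\<close> in
  the bound.\<close>

theorem acquaintance_time_bounded_degree_tree:
  fixes F :: "'a \<Rightarrow> 'a" and h :: "'a \<Rightarrow> nat"
  assumes "finite V" "p0 \<in> V"
    and "\<And>v. v \<in> V \<Longrightarrow> v \<noteq> p0 \<Longrightarrow> F v \<in> V \<and> {v, F v} \<in> E \<and> h (F v) < h v"
    and "\<And>v. v \<in> V \<Longrightarrow> card {u \<in> V - {p0}. F u = v} \<le> D"
  shows "acquaintance_time V E \<le> enat (5 * (4 * (D + 2) + 1) * card V)"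
proof (rule acquaintance_time_hop_tour[OF hop_tour_parent_function[OF assms(1-3)]])
  fix v assume "v \<in> V"
  then show "card {u \<in> V - {p0}. F u = v} + (if v = p0 then 0 else 1) < D + 2"
    using assms(4)[of v] by (cases "v = p0") simp_all
qed

section \<open>Matchings and long paths\<close>

text \<open>The induction of Halmos and Vaughan: a tight nonempty proper subset splits the problem
  in two; if there is none, the surplus of one permits an arbitrary choice for one vertex.\<close>

theorem hall_marriage:
  assumes "finite R" "\<And>v. v \<in> R \<Longrightarrow> finite (N v)"
    and "\<And>U. U \<subseteq> R \<Longrightarrow> card U \<le> card (\<Union>(N ` U))"
  shows "\<exists>f. inj_on f R \<and> (\<forall>v\<in>R. f v \<in> N v)"
  using assms
proof (induction R arbitrary: N rule: finite_psubset_induct)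
  case (psubset R)
  note finN = psubset.prems(1) and hall = psubset.prems(2)
  show ?case
  proof (cases "\<exists>U. U \<noteq> {} \<and> U \<subset> R \<and> card (\<Union>(N ` U)) \<le> card U")
    case True
    then obtain U where U: "U \<noteq> {}" "U \<subset> R" "card (\<Union>(N ` U)) \<le> card U" by blast
    have "\<exists>f. inj_on f U \<and> (\<forall>v\<in>U. f v \<in> N v)"
    proof (rule psubset.IH[OF U(2)])
      show "finite (N v)" if "v \<in> U" for v using finN U(2) that by blast
      show "card W \<le> card (\<Union>(N ` W))" if "W \<subseteq> U" for W using hall[of W] U(2) that by blast
    qed
    then obtain f where f: "inj_on f U" "\<forall>v\<in>U. f v \<in> N v" by blast
    let ?N' = "\<lambda>v. N v - \<Union>(N ` U)"
    have finU: "finite U" using U(2) psubset.hyps finite_subset by blast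
    have finNU: "finite (\<Union>(N ` U))" using finU U(2) finN by auto
    have "card W \<le> card (\<Union>(?N' ` W))" if W: "W \<subseteq> R - U" for W
    proof -
      have finW: "finite W" using W psubset.hyps finite_subset by blast
      have "card W + card U = card (W \<union> U)"
        using W finU finW by (subst card_Un_disjoint) auto
      also have "\<dots> \<le> card (\<Union>(N ` (W \<union> U)))"
        using W U(2) by (intro hall) auto
      also have "\<Union>(N ` (W \<union> U)) = \<Union>(?N' ` W) \<union> \<Union>(N ` U)" by auto
      also have "card \<dots> \<le> card (\<Union>(?N' ` W)) + card (\<Union>(N ` U))" by (rule card_Un_le)
      finally show ?thesis using U(3) by linarith
    qed
    moreover have "R - U \<subset> R" using U(1,2) by auto
    moreover have "finite (?N' v)" if "v \<in> R - U" for v using finN that by simp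
    ultimately have "\<exists>g. inj_on g (R - U) \<and> (\<forall>v\<in>R - U. g v \<in> ?N' v)"
      by (intro psubset.IH)
    then obtain g where g: "inj_on g (R - U)" "\<forall>v\<in>R - U. g v \<in> ?N' v" by blast
    have "f ` U \<subseteq> \<Union>(N ` U)"
    proof (rule image_subsetI)
      show "f x \<in> \<Union>(N ` U)" if "x \<in> U" for x by (rule UN_I[OF that]) (use f(2) that in simp)
    qed
    moreover have "g x \<notin> \<Union>(N ` U)" if "x \<in> R - U" for x
      using bspec[OF g(2) that] unfolding Diff_iff by (rule conjunct2)
    ultimately have "f x \<noteq> g y" if "x \<in> U" "y \<in> R - U" for x y
      using that by (metis image_subset_iff)
    then have "f ` U \<inter> g ` (R - U) = {}" by blast
    then have "inj_on (\<lambda>v. if v \<in> U then f v else g v) (U \<union> (R - U))"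
      by (rule inj_on_disjoint_Un[OF f(1) g(1)])
    moreover have "U \<union> (R - U) = R" using U(2) by blast
    ultimately have "inj_on (\<lambda>v. if v \<in> U then f v else g v) R" by (simp only:)
    moreover have "\<forall>v\<in>R. (if v \<in> U then f v else g v) \<in> N v" using f(2) g(2) by simp
    ultimately show ?thesis by (intro exI conjI)
  next
    case False
    show ?thesis
    proof (cases "R = {}")
      case True
      then show ?thesis by auto
    next
      case ne: False
      then obtain v where v: "v \<in> R" by blast
      have "card {v} \<le> card (\<Union>(N ` {v}))" using v by (intro hall) auto
      then have "N v \<noteq> {}" by auto
      then obtain w where w: "w \<in> N v" by blast
      have "card U \<le> card (\<Union>((\<lambda>u. N u - {w}) ` U))" if U: "U \<subseteq> R - {v}" for U
      proof (cases "U = {}")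
        case nonempty: False
        moreover have "U \<subset> R" using U v by blast
        ultimately have "card U < card (\<Union>(N ` U))" using False by (meson not_le)
        moreover have "card (\<Union>(N ` U)) - 1 \<le> card (\<Union>(N ` U) - {w})"
          by (simp add: card_Diff_singleton_if)
        ultimately have "card U \<le> card (\<Union>(N ` U) - {w})" by linarith
        also have "\<Union>(N ` U) - {w} = \<Union>((\<lambda>u. N u - {w}) ` U)" by auto
        finally show ?thesis .
      qed auto
      moreover have "R - {v} \<subset> R" "\<And>u. u \<in> R - {v} \<Longrightarrow> finite (N u - {w})"
        using v finN by auto
      ultimately have "\<exists>f. inj_on f (R - {v}) \<and> (\<forall>u\<in>R - {v}. f u \<in> N u - {w})"
        by (intro psubset.IH)
      then obtain f where f: "inj_on f (R - {v})" "\<forall>u\<in>R - {v}. f u \<in> N u - {w}" by blast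
      then show ?thesis
        using w by (intro exI[of _ "f(v := w)"]) (auto simp: inj_on_def)
    qed
  qed
qed

text \<open>
  Take a set \<open>U\<close> of largest deficiency with respect to the neighbours outside \<open>R\<close>. The other
  vertices of \<open>R\<close> can be matched into vertices outside \<open>R\<close> that are not adjacent to \<open>U\<close>, and
  \<open>U\<close> is treated by induction.
\<close>

theorem acyclic_marriage:
  fixes N :: "'a \<Rightarrow> 'a set"
  assumes "finite R" "\<And>v. v \<in> R \<Longrightarrow> finite (N v)"
    and "\<And>U. U \<subseteq> R \<Longrightarrow> U \<noteq> {} \<Longrightarrow> card U \<le> card (\<Union>(N ` U) - U)"
  shows "\<exists>f h. inj_on f R \<and> (\<forall>v\<in>R. f v \<in> N v \<and> (f v \<in> R \<longrightarrow> h (f v) < (h v :: nat)))"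
  using assms
proof (induction R rule: finite_psubset_induct)
  case (psubset R)
  note finN = psubset.prems(1) and exp = psubset.prems(2)
  show ?case
  proof (cases "R = {}")
    case True
    then show ?thesis by auto
  next
    case ne: False
    define M where "M U = \<Union>(N ` U) - R" for U
    define defi where "defi U = int (card U) - int (card (M U))" for U
    have finM: "finite (M U)" if "U \<subseteq> R" for U
      using that finN psubset.hyps finite_subset unfolding M_def by blast
    have "defi {} = 0" by (simp add: defi_def M_def)
    have "defi R \<le> 0" using exp[of R] ne by (simp add: defi_def M_def)
    have "finite (defi ` Pow R)" using psubset.hyps by simp
    then have "Max (defi ` Pow R) \<in> defi ` Pow R" by (rule Max_in) auto
    then obtain U' where "U' \<in> Pow R" "defi U' = Max (defi ` Pow R)" by auto
    with \<open>finite (defi ` Pow R)\<close> have U': "U' \<subseteq> R" "\<And>W. W \<subseteq> R \<Longrightarrow> defi W \<le> defi U'"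
      by auto
    \<comment> \<open>The induction needs a proper subset. If the maximum is attained at
      \<open>R\<close>, expansion of \<open>R\<close> itself gives \<open>defi R \<le> 0\<close>, so
      the empty set, of deficiency zero, is a maximiser as well.\<close>
    obtain U where U: "U \<subset> R" "\<And>W. W \<subseteq> R \<Longrightarrow> defi W \<le> defi U"
    proof (cases "U' = R")
      case True
      have "defi W \<le> defi {}" if "W \<subseteq> R" for W
        using U'(2)[OF that] True \<open>defi {} = 0\<close> \<open>defi R \<le> 0\<close> by simp
      then show thesis using that[of "{}"] ne by blast
    next
      case False
      then show thesis using that[of U'] U' by blast
    qed
    have finU: "finite U" using U(1) psubset.hyps finite_subset by blast
    have "\<exists>f h. inj_on f U \<and> (\<forall>v\<in>U. f v \<in> N v \<and> (f v \<in> U \<longrightarrow> h (f v) < (h v :: nat)))"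
    proof (rule psubset.IH[OF U(1)])
      show "finite (N v)" if "v \<in> U" for v using finN U(1) that by blast
      show "card W \<le> card (\<Union>(N ` W) - W)" if "W \<subseteq> U" "W \<noteq> {}" for W
        using exp[of W] U(1) that by blast
    qed
    then obtain f h where f: "inj_on f U" "\<forall>v\<in>U. f v \<in> N v \<and> (f v \<in> U \<longrightarrow> h (f v) < (h v :: nat))"
      by blast
    \<comment> \<open>Every value of \<open>f\<close> on \<open>U\<close> lies in \<open>R\<close>
      or in \<open>M U\<close>, so removing both keeps the images of \<open>f\<close> and
      \<open>g\<close> disjoint. Hall's condition for \<open>W\<close> is the maximality of
      \<open>defi U\<close> compared with \<open>W \<union> U\<close>.\<close>
    let ?N' = "\<lambda>v. N v - R - M U"
    have "card W \<le> card (\<Union>(?N' ` W))" if W: "W \<subseteq> R - U" for W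
    proof -
      have finW: "finite W" using W psubset.hyps finite_subset by blast
      have "card W + card U = card (W \<union> U)"
        using W finU finW by (subst card_Un_disjoint) auto
      moreover have "defi (W \<union> U) \<le> defi U" using W U(1) by (intro U(2)) auto
      ultimately have "card W + card (M U) \<le> card (M (W \<union> U))"
        by (simp add: defi_def)
      also have "M (W \<union> U) = \<Union>(?N' ` W) \<union> M U" by (auto simp: M_def)
      also have "card \<dots> \<le> card (\<Union>(?N' ` W)) + card (M U)" by (rule card_Un_le)
      finally show ?thesis by linarith
    qed
    moreover have "finite (R - U)" "\<And>v. v \<in> R - U \<Longrightarrow> finite (?N' v)"
      using finN psubset.hyps by auto
    ultimately have "\<exists>g. inj_on g (R - U) \<and> (\<forall>v\<in>R - U. g v \<in> ?N' v)"
      by (intro hall_marriage)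
    then obtain g where g: "inj_on g (R - U)" "\<forall>v\<in>R - U. g v \<in> ?N' v" by blast
    have fM: "f v \<in> M U" if "v \<in> U" "f v \<notin> R" for v
      using f(2) that by (auto simp: M_def)
    have "f x \<noteq> g y" if "x \<in> U" "y \<in> R - U" for x y
      using fM[OF that(1)] bspec[OF g(2) that(2)] by (metis DiffD1 DiffD2)
    then have "f ` U \<inter> g ` (R - U) = {}" by blast
    then have "inj_on (\<lambda>v. if v \<in> U then f v else g v) (U \<union> (R - U))"
      by (rule inj_on_disjoint_Un[OF f(1) g(1)])
    moreover have "U \<union> (R - U) = R" using U(1) by blast
    ultimately have "inj_on (\<lambda>v. if v \<in> U then f v else g v) R" by (simp only:)
    \<comment> \<open>Vertices of \<open>R - U\<close> are sent outside \<open>R\<close> and get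
      rank 0. Shifting the ranks on \<open>U\<close> by one handles those values of \<open>f\<close>
      that fall into \<open>R - U\<close>.\<close>
    moreover have "\<forall>v\<in>R. (if v \<in> U then f v else g v) \<in> N v \<and>
        ((if v \<in> U then f v else g v) \<in> R \<longrightarrow>
          (if (if v \<in> U then f v else g v) \<in> U then Suc (h (if v \<in> U then f v else g v)) else 0)
            < (if v \<in> U then Suc (h v) else 0))"
      using f(2) g(2) by simp
    ultimately show ?thesis
      by (intro exI[of _ "\<lambda>v. if v \<in> U then f v else g v"]
        exI[of _ "\<lambda>v. if v \<in> U then Suc (h v) else 0"] conjI)
  qed
qed

section \<open>Depth-first search and long paths\<close>

lemma path_in_Cons:
  "path_in E (u # p) \<longleftrightarrow> u \<notin> set p \<and> path_in E p \<and> (p = [] \<or> {u, hd p} \<in> E)"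
  by (cases p) (auto simp: path_in_def)

text \<open>
  Depth-first search: \<open>S\<close> is the set of finished vertices, \<open>p\<close> the stack and \<open>U\<close> the set of
  vertices not yet visited. The quantity \<open>card S - card U\<close> increases in steps of one.
\<close>

lemma depth_first_search_state:
  assumes "finite V" "t \<le> card V"
  shows "\<exists>S p U. path_in E p \<and> V = S \<union> set p \<union> U \<and> S \<inter> set p = {} \<and> S \<inter> U = {} \<and> set p \<inter> U = {} \<and>
     (\<forall>x\<in>S. \<forall>y\<in>U. {x, y} \<notin> E) \<and> card U + t = card V + card S"
  using assms(2)
proof (induction t)
  case 0
  show ?case
    by (rule exI[of _ "{}"], rule exI[of _ "[]"], rule exI[of _ V]) (simp add: path_in_def)
next
  case (Suc t)
  then obtain S p U where *: "path_in E p" "V = S \<union> set p \<union> U" "S \<inter> set p = {}" "S \<inter> U = {}"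
    "set p \<inter> U = {}" "\<forall>x\<in>S. \<forall>y\<in>U. {x, y} \<notin> E" "card U + t = card V + card S" by auto
  have fin: "finite S" "finite U" using *(2) assms(1) by auto
  have U_ne: "U \<noteq> {}"
    using *(7) Suc.prems by auto
  show ?case
  proof (cases "\<exists>u\<in>U. p = [] \<or> {u, hd p} \<in> E")
    case True
    then obtain u where u: "u \<in> U" "p = [] \<or> {u, hd p} \<in> E" by blast
    have "card (U - {u}) + Suc t = card V + card S"
      using *(7) card_Suc_Diff1[OF fin(2) u(1)] by linarith
    moreover have "path_in E (u # p)" using *(1,5) u by (auto simp: path_in_Cons)
    moreover have "V = S \<union> set (u # p) \<union> (U - {u})" "S \<inter> set (u # p) = {}" "S \<inter> (U - {u}) = {}"
      "set (u # p) \<inter> (U - {u}) = {}" using *(2-5) u(1) by auto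
    moreover have "\<forall>x\<in>S. \<forall>y\<in>U - {u}. {x, y} \<notin> E" using *(6) by blast
    ultimately show ?thesis by blast
  next
    case False
    then obtain v q where p: "p = v # q" using U_ne by (cases p) auto
    have "card (insert v S) = Suc (card S)"
      using fin *(3) p by auto
    then have "card U + Suc t = card V + card (insert v S)" using *(7) by simp
    moreover have "path_in E q" using *(1) p by (simp add: path_in_Cons)
    moreover have "V = insert v S \<union> set q \<union> U" "insert v S \<inter> set q = {}" "insert v S \<inter> U = {}"
      "set q \<inter> U = {}" using *(1-5) p by (auto simp: path_in_Cons)
    moreover have "\<forall>x\<in>insert v S. \<forall>y\<in>U. {x, y} \<notin> E"
      using *(6) False p by (auto simp: insert_commute)
    ultimately show ?thesis by blast
  qed
qed

text \<open>After \<open>card V\<close> steps of the search, the finished and the unvisited vertices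
  are equally many with no edge between them. So each set has at most \<open>k\<close> elements, and
  all other vertices are on the stack.\<close>

lemma long_path:
  assumes fin: "finite V"
    and edge: "\<And>X Y. X \<subseteq> V \<Longrightarrow> Y \<subseteq> V \<Longrightarrow> X \<inter> Y = {} \<Longrightarrow> card X = k \<Longrightarrow> card Y = k
      \<Longrightarrow> \<exists>x\<in>X. \<exists>y\<in>Y. {x, y} \<in> E"
  shows "\<exists>p. path_in E p \<and> set p \<subseteq> V \<and> card V \<le> length p + 2 * k"
proof -
  obtain S p U where *: "path_in E p" "V = S \<union> set p \<union> U" "S \<inter> set p = {}" "S \<inter> U = {}"
    "set p \<inter> U = {}" "\<forall>x\<in>S. \<forall>y\<in>U. {x, y} \<notin> E" "card U + card V = card V + card S"
    using depth_first_search_state[OF fin order.refl, of E] by blast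
  have "card S \<le> k"
  proof (rule ccontr)
    assume "\<not> card S \<le> k"
    then have "k \<le> card S" "k \<le> card U" using *(7) by simp_all
    then obtain X Y where XY: "X \<subseteq> S" "card X = k" "Y \<subseteq> U" "card Y = k"
      using obtain_subset_with_card_n by metis
    have "X \<subseteq> V" "Y \<subseteq> V" "X \<inter> Y = {}" using XY *(2,4) by blast+
    then obtain x y where "x \<in> X" "y \<in> Y" "{x, y} \<in> E" using edge[of X Y] XY by blast
    then show False using *(6) XY by blast
  qed
  moreover have "card V = card S + length p + card U"
  proof -
    have "card V = card (S \<union> set p) + card U"
      using *(2,4,5) fin by (simp add: card_Un_disjoint Int_Un_distrib2)
    then show ?thesis
      using *(1,2,3) fin by (simp add: card_Un_disjoint path_in_def distinct_card)
  qed
  ultimately show ?thesis using * by (intro exI[of _ p]) auto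
qed

section \<open>Expanders with few vertices of low degree\<close>

lemma path_predecessor:
  assumes "path_in E p" "v \<in> set p" "v \<noteq> hd p"
  obtains i where "Suc i < length p" "v = p ! Suc i" "{v, p ! i} \<in> E"
proof -
  obtain j where j: "j < length p" "v = p ! j" using assms(2) by (auto simp: in_set_conv_nth)
  then obtain i where "j = Suc i" using assms(3) by (cases j) (auto simp: hd_conv_nth)
  then show thesis
    using that[of i] j assms(1) by (auto simp: path_in_def insert_commute dest: successively_nth)
qed

lemma card_inj_fibre: "inj_on f A \<Longrightarrow> card {u \<in> A. f u = v} \<le> 1"
proof (cases "\<exists>u\<in>A. f u = v")
  case True
  then obtain u where "u \<in> A" "f u = v" by blast
  moreover assume "inj_on f A"
  ultimately have "{u \<in> A. f u = v} = {u}" by (auto dest: inj_onD)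
  then show ?thesis by simp
next
  case False
  then have "{u \<in> A. f u = v} = {}" by blast
  then show ?thesis by (simp only: card.empty)
qed

text \<open>The deterministic core. Path vertices have their predecessor as parent, the other
  vertices outside \<open>S\<close> get one from \<open>acyclic_marriage\<close>, and those of
  \<open>S\<close> off the path become leaves below a neighbour \<open>g s\<close>. By the two
  conditions in \<open>far\<close>, \<open>g\<close> takes values outside \<open>S\<close> and is
  injective. Each of the three rules gives a vertex at most one child, hence \<open>D = 3\<close>
  and \<open>105 = 5 * (4 * (3 + 2) + 1)\<close>.\<close>

lemma acquaintance_time_expander:
  assumes fin: "finite V" and sub: "E0 \<subseteq> E" "E \<subseteq> complete_edges V"
    and S: "S \<subseteq> V" "\<And>s. s \<in> S \<Longrightarrow> \<exists>u\<in>V. {s, u} \<in> E"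
    and far: "\<And>x y. x \<in> S \<Longrightarrow> y \<in> S \<Longrightarrow> x \<noteq> y \<Longrightarrow> {x, y} \<notin> E"
      "\<And>x y z. x \<in> S \<Longrightarrow> y \<in> S \<Longrightarrow> x \<noteq> y \<Longrightarrow> \<not> ({x, z} \<in> E \<and> {y, z} \<in> E)"
    and expand: "\<And>U. U \<subseteq> V - S \<Longrightarrow> U \<noteq> {} \<Longrightarrow> card U \<le> 2 * k \<Longrightarrow>
      2 * card U \<le> card {w \<in> V - U. \<exists>u\<in>U. {u, w} \<in> E0}"
    and k: "2 * k < card V"
    and edge: "\<And>X Y. X \<subseteq> V \<Longrightarrow> Y \<subseteq> V \<Longrightarrow> X \<inter> Y = {} \<Longrightarrow> card X = k \<Longrightarrow> card Y = k
      \<Longrightarrow> \<exists>x\<in>X. \<exists>y\<in>Y. {x, y} \<in> E0"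
  shows "acquaintance_time V E \<le> enat (105 * card V)"
proof -
  obtain p where p: "path_in E0 p" "set p \<subseteq> V" "card V \<le> length p + 2 * k"
    using long_path[OF fin edge] by blast
  have dp: "distinct p" using p(1) by (simp add: path_in_def)
  have p_ne: "p \<noteq> []" using p(3) k by auto
  define R1 where "R1 = V - set p - S"
  define S1 where "S1 = S - set p"
  have finR1: "finite R1" and finS1: "finite S1"
    using fin S(1) finite_subset by (auto simp: R1_def S1_def)
  have card_R1: "card R1 \<le> 2 * k"
  proof -
    have "card R1 \<le> card (V - set p)" using fin by (intro card_mono) (auto simp: R1_def)
    also have "\<dots> = card V - length p" using p(2) dp by (simp add: card_Diff_subset distinct_card)
    finally show ?thesis using p(3) by linarith
  qed
  \<comment> \<open>The future leaves \<open>S1\<close> must not become parents; members of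
    \<open>S\<close> on the path may.\<close>
  define N where "N v = {u \<in> V - S1. {v, u} \<in> E0}" for v
  have "\<exists>f h. inj_on f R1 \<and> (\<forall>v\<in>R1. f v \<in> N v \<and> (f v \<in> R1 \<longrightarrow> h (f v) < (h v :: nat)))"
  proof (rule acyclic_marriage[OF finR1])
    show "finite (N v)" for v using fin by (simp add: N_def)
  next
    fix U assume U: "U \<subseteq> R1" "U \<noteq> {}"
    define W where "W = {w \<in> V - U. \<exists>u\<in>U. {u, w} \<in> E0}"
    define T where "T = W \<inter> S"
    have finU: "finite U" using U finR1 finite_subset by blast
    have finW: "finite W" using fin by (simp add: W_def)
    have "card U \<le> 2 * k" using card_mono[OF finR1 U(1)] card_R1 by linarith
    then have "2 * card U \<le> card W"
      unfolding W_def using U by (intro expand) (auto simp: R1_def)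
    \<comment> \<open>No vertex of \<open>U\<close> has two neighbours in \<open>S\<close>, since
      these would have a common neighbour. So at most \<open>card U\<close> of the
      \<open>2 * card U\<close> neighbours of \<open>U\<close> are lost.\<close>
    moreover have "card T \<le> card U"
    proof -
      have "\<forall>t\<in>T. \<exists>u\<in>U. {u, t} \<in> E0" by (auto simp: T_def W_def)
      then obtain c where c: "\<And>t. t \<in> T \<Longrightarrow> c t \<in> U \<and> {c t, t} \<in> E0" by metis
      have "inj_on c T"
      proof (rule inj_onI, rule ccontr)
        fix s t assume st: "s \<in> T" "t \<in> T" "c s = c t" "s \<noteq> t"
        have "{s, c s} \<in> E" "{t, c s} \<in> E"
          using c[OF st(1)] c[OF st(2)] st(3) sub(1) by (auto simp: insert_commute)
        then show False using far(2)[of s t "c s"] st by (auto simp: T_def)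
      qed
      moreover have "c ` T \<subseteq> U" using c by auto
      ultimately show ?thesis using card_inj_on_le finU by metis
    qed
    moreover have "card W \<le> card (W - T) + card T"
      using card_Un_le[of "W - T" T] by (simp add: T_def Un_Diff_Int)
    moreover have "card (W - T) \<le> card (\<Union>(N ` U) - U)"
    proof (rule card_mono)
      show "finite (\<Union>(N ` U) - U)" using finU fin by (simp add: N_def)
      show "W - T \<subseteq> \<Union>(N ` U) - U" by (auto simp: W_def T_def N_def S1_def)
    qed
    ultimately show "card U \<le> card (\<Union>(N ` U) - U)" by linarith
  qed
  then obtain f and h :: "'a \<Rightarrow> nat"
    where f: "inj_on f R1" "\<And>v. v \<in> R1 \<Longrightarrow> f v \<in> N v"
      "\<And>v. v \<in> R1 \<Longrightarrow> f v \<in> R1 \<Longrightarrow> h (f v) < h v" by blast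
  obtain g where g: "\<And>s. s \<in> S \<Longrightarrow> g s \<in> V \<and> {s, g s} \<in> E" using S(2) by metis
  have g_inj: "inj_on g S"
    using g far(2) by (intro inj_onI) metis
  have gS: "g s \<in> V - S" if s: "s \<in> S" for s
  proof -
    have "{s, g s} \<in> complete_edges V" using g[OF s] sub(2) by blast
    then have "g s \<noteq> s" by (auto simp: complete_edges_def)
    then show ?thesis using g[OF s] far(1)[of s "g s"] s by auto
  qed
  define idx where "idx = inv_into {..<length p} ((!) p)"
  have idx [simp]: "idx (p ! i) = i" if "i < length p" for i
    unfolding idx_def using that dp by (intro inv_into_f_f inj_on_nth) auto
  \<comment> \<open>At the root \<open>hd p\<close> truncated subtraction gives \<open>hd p\<close>
    itself; the facts about parents and children below leave the root out.\<close>
  define F where "F v = (if v \<in> set p then p ! (idx v - 1) else if v \<in> R1 then f v else g v)" for v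
  \<comment> \<open>The path is ranked by index, \<open>R1\<close> lies above the whole path in the
    order of \<open>h\<close>, and in \<open>r\<close> each leaf lies one above its parent.\<close>
  define r0 where "r0 v = (if v \<in> set p then idx v else length p + h v)" for v
  define r where "r v = (if v \<in> S1 then Suc (r0 (g v)) else r0 v)" for v
  have cases_V: "v \<in> set p \<or> v \<in> R1 \<or> v \<in> S1" if "v \<in> V" for v
    using that by (auto simp: R1_def S1_def)
  have idx_less: "idx v < length p" if "v \<in> set p" for v
    using that by (auto simp: in_set_conv_nth)
  have F_parent: "F v \<in> V \<and> {v, F v} \<in> E \<and> r (F v) < r v" if v: "v \<in> V" "v \<noteq> hd p" for v
    using cases_V[OF v(1)]
  proof (elim disjE)
    assume vp: "v \<in> set p"
    then obtain i where i: "Suc i < length p" "v = p ! Suc i" "{v, p ! i} \<in> E0"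
      using path_predecessor[OF p(1) vp v(2)] by blast
    then have "F v = p ! i" "F v \<in> set p" using vp by (simp_all add: F_def)
    then show ?thesis
      using i p(2) sub(1) vp by (auto simp: r_def r0_def S1_def)
  next
    assume vR: "v \<in> R1"
    then have vp: "v \<notin> set p" "v \<notin> S1" by (auto simp: R1_def S1_def)
    then have Fv: "F v = f v" using vR by (simp add: F_def)
    have "f v \<in> V - S1" "{v, f v} \<in> E0" using f(2)[OF vR] by (auto simp: N_def)
    moreover have "r (f v) < r v"
      using vp f(3)[OF vR] calculation(1) cases_V[of "f v"] idx_less[of "f v"]
      by (auto simp: r_def r0_def)
    ultimately show ?thesis using Fv sub(1) by auto
  next
    assume vS: "v \<in> S1"
    then have "v \<notin> set p" "v \<notin> R1" "v \<in> S" by (auto simp: R1_def S1_def)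
    then have "F v = g v" by (simp add: F_def)
    moreover have "g v \<notin> S1" using gS[OF \<open>v \<in> S\<close>] by (auto simp: S1_def)
    ultimately show ?thesis using g[OF \<open>v \<in> S\<close>] vS by (simp add: r_def)
  qed
  have children: "card {u \<in> V - {hd p}. F u = v} \<le> 3" for v
  proof -
    let ?A = "{u \<in> set p - {hd p}. F u = v}" and ?B = "{u \<in> R1. f u = v}" and ?C = "{u \<in> S. g u = v}"
    have "card ?A \<le> card {p ! Suc (idx v)}"
    proof (rule card_mono)
      show "?A \<subseteq> {p ! Suc (idx v)}"
      proof
        fix u assume "u \<in> ?A"
        then have u: "u \<in> set p" "u \<noteq> hd p" "F u = v" by auto
        then obtain i where i: "Suc i < length p" "u = p ! Suc i"
          using path_predecessor[OF p(1)] by metis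
        then have "v = p ! i" using u by (simp add: F_def)
        then show "u \<in> {p ! Suc (idx v)}" using i by simp
      qed
    qed simp
    moreover have "card ?B \<le> 1" "card ?C \<le> 1"
      by (rule card_inj_fibre[OF f(1)], rule card_inj_fibre[OF g_inj])
    moreover have "card {u \<in> V - {hd p}. F u = v} \<le> card (?A \<union> ?B \<union> ?C)"
    proof (rule card_mono)
      show "finite (?A \<union> ?B \<union> ?C)" using finR1 finite_subset[OF S(1) fin] by simp
      show "{u \<in> V - {hd p}. F u = v} \<subseteq> ?A \<union> ?B \<union> ?C"
      proof
        fix u assume u: "u \<in> {u \<in> V - {hd p}. F u = v}"
        then show "u \<in> ?A \<union> ?B \<union> ?C"
          using cases_V[of u] by (auto simp: F_def R1_def S1_def)
      qed
    qed
    ultimately show ?thesis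
      using card_Un_le[of "?A \<union> ?B" ?C] card_Un_le[of ?A ?B] by simp
  qed
  have "hd p \<in> V" using p_ne p(2) by auto
  from acquaintance_time_bounded_degree_tree[OF fin this F_parent children]
  show ?thesis by simp
qed

section \<open>Initial segments of a uniformly random ordering\<close>

definition perm_prob :: "'a set \<Rightarrow> ('a list \<Rightarrow> bool) \<Rightarrow> real" where
  "perm_prob S Q = measure_pmf.prob (pmf_of_set (permutations_of_set S)) {xs. Q xs}"

lemma perm_prob_card:
  assumes "finite S"
  shows "perm_prob S Q = real (card {xs \<in> permutations_of_set S. Q xs}) / real (card (permutations_of_set S))"
  unfolding perm_prob_def using assms
  by (subst measure_pmf_of_set) (auto simp: Int_def)

lemma perm_prob_nonneg: "0 \<le> perm_prob S Q"
  by (simp add: perm_prob_def)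

lemma perm_prob_mono:
  assumes "finite S" "\<And>xs. xs \<in> permutations_of_set S \<Longrightarrow> Q xs \<Longrightarrow> Q' xs"
  shows "perm_prob S Q \<le> perm_prob S Q'"
  unfolding perm_prob_card[OF assms(1)] using assms
  by (intro divide_right_mono of_nat_mono card_mono) auto

lemma perm_prob_not: "perm_prob S (\<lambda>xs. \<not> Q xs) = 1 - perm_prob S Q"
proof -
  have "{xs. \<not> Q xs} = space (measure_pmf (pmf_of_set (permutations_of_set S))) - {xs. Q xs}" by auto
  then show ?thesis
    unfolding perm_prob_def by (simp only: measure_pmf.prob_compl sets_measure_pmf UNIV_I)
qed

lemma perm_prob_UN:
  assumes "finite I"
  shows "perm_prob S (\<lambda>xs. \<exists>i\<in>I. Q i xs) \<le> (\<Sum>i\<in>I. perm_prob S (Q i))"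
proof -
  have "{xs. \<exists>i\<in>I. Q i xs} = (\<Union>i\<in>I. {xs. Q i xs})" by auto
  then show ?thesis
    unfolding perm_prob_def using assms
    by (simp only:) (intro measure_pmf.finite_measure_subadditive_finite, auto)
qed

lemma perm_prob_disj: "perm_prob S (\<lambda>xs. Q xs \<or> Q' xs) \<le> perm_prob S Q + perm_prob S Q'"
proof -
  have "{xs. Q xs \<or> Q' xs} = {xs. Q xs} \<union> {xs. Q' xs}" by auto
  then show ?thesis
    unfolding perm_prob_def by (simp only:) (intro measure_Un_le, auto)
qed

lemma in_take_transpose:
  "z \<in> set (take m (map (Transposition.transpose x y) xs)) \<longleftrightarrow>
   Transposition.transpose x y z \<in> set (take m xs)"
proof -
  let ?t = "Transposition.transpose x y"
  have "z \<in> ?t ` A \<longleftrightarrow> ?t z \<in> A" for A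
  proof
    assume "?t z \<in> A"
    then show "z \<in> ?t ` A" using image_eqI[of z ?t "?t z" A] by simp
  qed auto
  then show ?thesis by (simp add: take_map)
qed

lemma perm_prob_transpose:
  assumes "finite S" "x \<in> S" "y \<in> S"
  shows "perm_prob S (\<lambda>xs. Q (map (Transposition.transpose x y) xs)) = perm_prob S Q"
proof -
  let ?t = "Transposition.transpose x y"
  have "?t ` S = S" using assms by (simp add: transpose_image_eq)
  then have "permutations_of_set S = map ?t ` permutations_of_set S"
    using permutations_of_set_image_inj[of ?t S] by (simp add: inj_on_subset[OF inj_transpose])
  then have "map_pmf (map ?t) (pmf_of_set (permutations_of_set S)) = pmf_of_set (permutations_of_set S)"
    using assms(1) by (subst map_pmf_of_set_inj) (auto intro: inj_on_subset[OF inj_mapI[OF inj_transpose]])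
  then show ?thesis
    unfolding perm_prob_def by (metis measure_map_pmf vimage_Collect_eq)
qed

context
  fixes S D :: "'a set" and x :: 'a and Q :: "'a list \<Rightarrow> bool" and R :: "'a \<Rightarrow> 'a list \<Rightarrow> bool"
  assumes fin: "finite S" and D: "D \<subseteq> S" and x: "x \<in> S - D"
    and Q: "\<And>y xs. y \<in> S - D \<Longrightarrow> Q (map (Transposition.transpose x y) xs) \<longleftrightarrow> Q xs"
    and R: "\<And>y xs. y \<in> S - D \<Longrightarrow> R y (map (Transposition.transpose x y) xs) \<longleftrightarrow> R x xs"
begin

text \<open>Double counting of the pairs of some \<open>y\<close> outside \<open>D\<close> and an
  ordering with \<open>Q\<close> and \<open>R y\<close>. The event \<open>Q\<close> does not notice
  an exchange of \<open>x\<close> with \<open>y\<close>, so all these \<open>y\<close> are equally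
  likely to satisfy \<open>R\<close> jointly with \<open>Q\<close>. This replaces conditional
  probabilities.\<close>

lemma perm_prob_exchange:
  "real (card (S - D)) * real (card {xs \<in> permutations_of_set S. Q xs \<and> R x xs}) =
     (\<Sum>xs | xs \<in> permutations_of_set S \<and> Q xs. real (card {y \<in> S - D. R y xs}))"
proof -
  let ?P = "permutations_of_set S"
  have pos: "card ?P \<noteq> 0" using fin by simp
  have eq: "card {xs \<in> ?P. Q xs \<and> R y xs} = card {xs \<in> ?P. Q xs \<and> R x xs}" if y: "y \<in> S - D" for y
  proof -
    have "perm_prob S (\<lambda>xs. Q xs \<and> R y xs) = perm_prob S (\<lambda>xs. Q xs \<and> R x xs)"
      using perm_prob_transpose[of S x y "\<lambda>xs. Q xs \<and> R y xs"] fin x y Q R by simp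
    then show ?thesis using pos by (simp add: perm_prob_card[OF fin])
  qed
  have "real (card (S - D)) * real (card {xs \<in> ?P. Q xs \<and> R x xs}) =
      (\<Sum>y\<in>S - D. real (card {xs \<in> ?P. Q xs \<and> R y xs}))"
    using eq by simp
  also have "\<dots> = (\<Sum>y\<in>S - D. \<Sum>xs | xs \<in> ?P \<and> Q xs. if R y xs then 1 else 0)"
    using fin by (intro sum.cong refl) (simp add: sum.If_cases Int_def conj_assoc)
  also have "\<dots> = (\<Sum>xs | xs \<in> ?P \<and> Q xs. \<Sum>y\<in>S - D. if R y xs then 1 else 0)"
    by (rule sum.swap)
  also have "\<dots> = (\<Sum>xs | xs \<in> ?P \<and> Q xs. real (card {y \<in> S - D. R y xs}))"
    using fin by (intro sum.cong refl) (simp add: sum.If_cases Int_def)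
  finally show ?thesis .
qed

lemma perm_prob_exchange_le:
  assumes "\<And>xs. xs \<in> permutations_of_set S \<Longrightarrow> Q xs \<Longrightarrow> real (card {y \<in> S - D. R y xs}) \<le> c"
  shows "real (card (S - D)) * perm_prob S (\<lambda>xs. Q xs \<and> R x xs) \<le> c * perm_prob S Q"
proof -
  have "(\<Sum>xs | xs \<in> permutations_of_set S \<and> Q xs. real (card {y \<in> S - D. R y xs}))
      \<le> (\<Sum>xs | xs \<in> permutations_of_set S \<and> Q xs. c)"
    using assms by (intro sum_mono) auto
  then show ?thesis
    unfolding perm_prob_card[OF fin] times_divide_eq_right perm_prob_exchange
    by (intro divide_right_mono) (simp_all add: mult.commute)
qed

lemma perm_prob_exchange_eq:
  assumes "\<And>xs. xs \<in> permutations_of_set S \<Longrightarrow> Q xs \<Longrightarrow> real (card {y \<in> S - D. R y xs}) = c"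
  shows "real (card (S - D)) * perm_prob S (\<lambda>xs. Q xs \<and> R x xs) = c * perm_prob S Q"
proof -
  have "(\<Sum>xs | xs \<in> permutations_of_set S \<and> Q xs. real (card {y \<in> S - D. R y xs}))
      = (\<Sum>xs | xs \<in> permutations_of_set S \<and> Q xs. c)"
    using assms by (intro sum.cong) auto
  then show ?thesis
    unfolding perm_prob_card[OF fin] times_divide_eq_right perm_prob_exchange
    by (simp add: mult.commute)
qed

end

section \<open>Prefixes that contain or avoid prescribed elements\<close>

lemma card_take_permutation:
  assumes "xs \<in> permutations_of_set S" "m \<le> card S"
  shows "card (set (take m xs)) = m" "set (take m xs) \<subseteq> S"
proof -
  have xs: "distinct xs" "set xs = S" using assms(1) by (auto simp: permutations_of_set_def)
  then have "length xs = card S" using distinct_card by force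
  then show "card (set (take m xs)) = m"
    using xs(1) assms(2) by (simp add: distinct_card)
  show "set (take m xs) \<subseteq> S" using xs(2) set_take_subset by fast
qed

text \<open>Given that \<open>i\<close> elements of \<open>B\<close> lie outside the prefix, the
  next one does so with probability \<open>(N - m - i) / (N - i)\<close>, where
  \<open>N = card S\<close>, because the prefix occupies \<open>m\<close> of the
  \<open>N - i\<close> remaining elements.\<close>

lemma perm_prob_avoid:
  assumes "finite S" "B \<subseteq> S" "m \<le> card S"
  shows "perm_prob S (\<lambda>xs. \<forall>b\<in>B. b \<notin> set (take m xs)) =
    (\<Prod>i<card B. (real (card S) - real m - real i) / (real (card S) - real i))"
proof -
  have "finite B" using assms finite_subset by blast
  then show ?thesis using assms(2)
  proof (induction B)
    case empty
    have "perm_prob S (\<lambda>xs. True) = 1" by (simp add: perm_prob_def)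
    then show ?case by simp
  next
    case (insert x B)
    let ?Q = "\<lambda>xs. \<forall>b\<in>B. b \<notin> set (take m xs)"
    have card_less: "card B < card S"
      using insert psubset_card_mono[OF assms(1), of B] by auto
    have "real (card (S - B)) * perm_prob S (\<lambda>xs. ?Q xs \<and> x \<notin> set (take m xs)) =
        (real (card S) - real m - real (card B)) * perm_prob S ?Q"
    proof (rule perm_prob_exchange_eq[where R = "\<lambda>y xs. y \<notin> set (take m xs)"])
      fix xs assume xs: "xs \<in> permutations_of_set S" "?Q xs"
      note t = card_take_permutation[OF xs(1) assms(3)]
      have "{y \<in> S - B. y \<notin> set (take m xs)} = S - (B \<union> set (take m xs))" by auto
      moreover have "card (B \<union> set (take m xs)) = card B + m"
        using insert.hyps xs(2) t by (subst card_Un_disjoint) auto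
      moreover have "B \<union> set (take m xs) \<subseteq> S" using insert.prems t by auto
      ultimately show "real (card {y \<in> S - B. y \<notin> set (take m xs)}) = real (card S) - real m - real (card B)"
        using card_mono[OF assms(1), of "B \<union> set (take m xs)"] insert.hyps
        by (simp add: card_Diff_subset of_nat_diff)
    next
      fix y xs assume y: "y \<in> S - B"
      have "Transposition.transpose x y b = b" if "b \<in> B" for b
        using that y insert.hyps by (intro transpose_apply_other) auto
      then show "?Q (map (Transposition.transpose x y) xs) \<longleftrightarrow> ?Q xs"
        by (simp add: in_take_transpose)
    qed (use assms insert in \<open>auto simp: in_take_transpose\<close>)
    moreover have "real (card (S - B)) = real (card S) - real (card B)"
      using insert.hyps insert.prems card_less by (simp add: card_Diff_subset of_nat_diff)
    moreover have "(\<lambda>xs. \<forall>b\<in>insert x B. b \<notin> set (take m xs)) = (\<lambda>xs. ?Q xs \<and> x \<notin> set (take m xs))"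
      by auto
    ultimately have "perm_prob S (\<lambda>xs. \<forall>b\<in>insert x B. b \<notin> set (take m xs)) =
        (real (card S) - real m - real (card B)) / (real (card S) - real (card B)) * perm_prob S ?Q"
      using card_less by (simp add: field_simps)
    then show ?case using insert by (simp add: mult.commute)
  qed
qed

lemma perm_prob_avoid_le:
  assumes "finite S" "B \<subseteq> S" "m \<le> card S"
  shows "perm_prob S (\<lambda>xs. \<forall>b\<in>B. b \<notin> set (take m xs)) \<le> exp (- (real m / real (card S) * real (card B)))"
proof (cases "m + card B \<le> card S")
  case True
  have "perm_prob S (\<lambda>xs. \<forall>b\<in>B. b \<notin> set (take m xs)) \<le> (\<Prod>i<card B. exp (- (real m / real (card S))))"
    unfolding perm_prob_avoid[OF assms]
  proof (rule prod_mono, rule conjI)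
    fix i assume "i \<in> {..<card B}"
    then have i: "m + i < card S" using True by simp
    then show "0 \<le> (real (card S) - real m - real i) / (real (card S) - real i)" by simp
    have "(real (card S) - real m - real i) / (real (card S) - real i) = 1 - real m / (real (card S) - real i)"
      using i by (simp add: field_simps)
    also have "\<dots> \<le> 1 - real m / real (card S)"
      using i by (simp add: frac_le)
    also have "\<dots> \<le> exp (- (real m / real (card S)))"
      using exp_ge_add_one_self[of "- (real m / real (card S))"] by simp
    finally show "(real (card S) - real m - real i) / (real (card S) - real i) \<le> exp (- (real m / real (card S)))" .
  qed
  then show ?thesis by (simp add: exp_of_nat_mult[symmetric] mult.commute)
next
  case False
  \<comment> \<open>Factors of the product may be negative here, so they cannot be compared one by
    one; but the event is impossible by counting.\<close>
  have "perm_prob S (\<lambda>xs. \<forall>b\<in>B. b \<notin> set (take m xs)) \<le> perm_prob S (\<lambda>xs. False)"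
  proof (rule perm_prob_mono[OF assms(1)])
    fix xs assume xs: "xs \<in> permutations_of_set S" "\<forall>b\<in>B. b \<notin> set (take m xs)"
    note t = card_take_permutation[OF xs(1) assms(3)]
    have "card (B \<union> set (take m xs)) = card B + m"
      using assms(1,2) finite_subset xs(2) t by (subst card_Un_disjoint) auto
    then show False using card_mono[OF assms(1), of "B \<union> set (take m xs)"] assms(2) t False by simp
  qed
  also have "\<dots> = 0" by (simp add: perm_prob_def)
  finally show ?thesis by (meson exp_ge_zero order_trans)
qed

text \<open>Serves as independence of edges. The elements are exposed one at a time, those of
  \<open>B\<close> before those of \<open>A\<close> and \<open>C\<close>; at every step enough
  elements remain unexposed for \<open>q\<close> or \<open>q'\<close> to bound the conditional
  probability. Two prefixes occur because low degree is measured at the earlier time and adjacency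
  at the later one.\<close>

lemma perm_prob_constraints:
  assumes "finite S" "A \<subseteq> S" "B \<subseteq> S" "C \<subseteq> S" "A \<inter> B = {}" "A \<inter> C = {}" "B \<inter> C = {}"
    and m: "m \<le> card S"
    and q: "real m \<le> q * (real (card S) - real (card A + card B + card C))"
      "real m' \<le> q' * (real (card S) - real (card A + card B + card C))" "0 \<le> q" "0 \<le> q'"
  shows "perm_prob S (\<lambda>xs. (\<forall>b\<in>B. b \<notin> set (take m xs)) \<and> (\<forall>a\<in>A. a \<in> set (take m xs)) \<and>
      (\<forall>c\<in>C. c \<in> set (take m' xs)))
    \<le> exp (- (real m / real (card S) * real (card B))) * q ^ card A * q' ^ card C"
proof -
  have fin: "finite A" "finite B" "finite C" using assms finite_subset by blast+
  let ?B = "\<lambda>xs. \<forall>b\<in>B. b \<notin> set (take m xs)"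
  \<comment> \<open>The premise on \<open>t\<close> expresses that \<open>Q\<close> depends only on
    which elements of \<open>D\<close> lie in which prefixes; \<open>t\<close> stands for a
    transposition of elements outside \<open>D\<close>.\<close>
  have step: "perm_prob S (\<lambda>xs. Q xs \<and> x \<in> set (take l xs)) \<le> r * perm_prob S Q"
    if D: "D \<subseteq> S" "x \<in> S - D" "card D \<le> card A + card B + card C"
      and inv: "\<And>t xs. (\<And>z. z \<in> D \<Longrightarrow> t z = z) \<Longrightarrow> (\<And>z l. z \<in> set (take l (map t xs)) \<longleftrightarrow> t z \<in> set (take l xs))
         \<Longrightarrow> Q (map t xs) \<longleftrightarrow> Q xs"
      and l: "real l \<le> r * (real (card S) - real (card A + card B + card C))" "0 \<le> r"
    for D x Q l r
  proof -
    have "real (card (S - D)) * perm_prob S (\<lambda>xs. Q xs \<and> x \<in> set (take l xs)) \<le> real l * perm_prob S Q"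
    proof (rule perm_prob_exchange_le[where R = "\<lambda>y xs. y \<in> set (take l xs)"])
      fix xs :: "'a list"
      have "card {y \<in> S - D. y \<in> set (take l xs)} \<le> card (set (take l xs))"
        by (intro card_mono) auto
      also have "\<dots> \<le> l" using card_length[of "take l xs"] by simp
      finally show "real (card {y \<in> S - D. y \<in> set (take l xs)}) \<le> real l" by simp
    next
      fix y xs assume y: "y \<in> S - D"
      show "Q (map (Transposition.transpose x y) xs) \<longleftrightarrow> Q xs"
      proof (rule inv)
        show "Transposition.transpose x y z = z" if "z \<in> D" for z
          using that y D(2) by (intro transpose_apply_other) auto
      qed (rule in_take_transpose)
    qed (use assms(1) D in \<open>auto simp: in_take_transpose\<close>)
    moreover have "real l \<le> r * real (card (S - D))"
    proof -
      have "finite D" using D(1) assms(1) finite_subset by blast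
      then have "real (card (S - D)) = real (card S) - real (card D)"
        using D(1) card_mono[OF assms(1) D(1)] by (simp add: card_Diff_subset of_nat_diff)
      then have "real (card S) - real (card A + card B + card C) \<le> real (card (S - D))"
        using D(3) by linarith
      from mult_left_mono[OF this l(2)] l(1) show ?thesis by linarith
    qed
    then have "real l * perm_prob S Q \<le> r * real (card (S - D)) * perm_prob S Q"
      by (intro mult_right_mono perm_prob_nonneg)
    ultimately have "real (card (S - D)) * perm_prob S (\<lambda>xs. Q xs \<and> x \<in> set (take l xs))
        \<le> real (card (S - D)) * (r * perm_prob S Q)"
      by (simp add: mult.assoc mult.left_commute)
    moreover have "card (S - D) > 0" using assms(1) D(2) by (auto simp: card_gt_0_iff)
    ultimately show ?thesis by simp
  qed
  let ?A = "\<lambda>A xs. \<forall>a\<in>A. a \<in> set (take m xs)" and ?C = "\<lambda>C xs. \<forall>c\<in>C. c \<in> set (take m' xs)"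
  have A: "perm_prob S (\<lambda>xs. ?B xs \<and> ?A A' xs) \<le> exp (- (real m / real (card S) * real (card B))) * q ^ card A'"
    if "A' \<subseteq> A" for A'
    using finite_subset[OF that fin(1)] that
  proof (induction A')
    case empty
    then show ?case using perm_prob_avoid_le[OF assms(1,3) m] by simp
  next
    case (insert x A')
    have "perm_prob S (\<lambda>xs. ?B xs \<and> ?A (insert x A') xs) = perm_prob S (\<lambda>xs. (?B xs \<and> ?A A' xs) \<and> x \<in> set (take m xs))"
      by (rule arg_cong[where f = "perm_prob S"]) auto
    also have "\<dots> \<le> q * perm_prob S (\<lambda>xs. ?B xs \<and> ?A A' xs)"
    proof (rule step[where D = "B \<union> A'"])
      have "card A' \<le> card A" using insert.prems fin by (intro card_mono) auto
      then show "card (B \<union> A') \<le> card A + card B + card C"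
        using card_Un_le[of B A'] by linarith
    qed (use insert assms q in \<open>auto\<close>)
    also have "\<dots> \<le> q * (exp (- (real m / real (card S) * real (card B))) * q ^ card A')"
      using insert q by (intro mult_left_mono) auto
    finally show ?case using insert.hyps by (simp add: mult_ac)
  qed
  have "perm_prob S (\<lambda>xs. ?B xs \<and> ?A A xs \<and> ?C C' xs)
      \<le> exp (- (real m / real (card S) * real (card B))) * q ^ card A * q' ^ card C'"
    if "C' \<subseteq> C" for C'
    using finite_subset[OF that fin(3)] that
  proof (induction C')
    case empty
    then show ?case using A[of A] by simp
  next
    case (insert x C')
    have "perm_prob S (\<lambda>xs. ?B xs \<and> ?A A xs \<and> ?C (insert x C') xs)
        = perm_prob S (\<lambda>xs. (?B xs \<and> ?A A xs \<and> ?C C' xs) \<and> x \<in> set (take m' xs))"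
      by (rule arg_cong[where f = "perm_prob S"]) auto
    also have "\<dots> \<le> q' * perm_prob S (\<lambda>xs. ?B xs \<and> ?A A xs \<and> ?C C' xs)"
    proof (rule step[where D = "B \<union> A \<union> C'"])
      have "card C' \<le> card C" using insert.prems fin by (intro card_mono) auto
      then show "card (B \<union> A \<union> C') \<le> card A + card B + card C"
        using card_Un_le[of "B \<union> A" C'] card_Un_le[of B A] by linarith
    qed (use insert assms q in \<open>auto\<close>)
    also have "\<dots> \<le> q' * (exp (- (real m / real (card S) * real (card B))) * q ^ card A * q' ^ card C')"
      using insert q by (intro mult_left_mono) auto
    finally show ?case using insert.hyps by (simp add: mult_ac)
  qed
  from this[of C] show ?thesis by simp
qed

section \<open>Exceptional events in the random graph process\<close>

text \<open>\<open>k ^ k / fact k\<close> is a single term of the exponential series at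
  \<open>k\<close>.\<close>

lemma binomial_le_exp_pow:
  assumes "0 < k"
  shows "real (n choose k) \<le> (exp 1 * real n / real k) ^ k"
proof -
  have "real k ^ k / fact k \<le> exp (real k)"
  proof -
    have s: "(\<lambda>i. real k ^ i / fact i) sums exp (real k)"
      using exp_converges[of "real k"] by (simp add: field_simps)
    have "sum (\<lambda>i. real k ^ i / fact i) {k} \<le> suminf (\<lambda>i. real k ^ i / fact i)"
      using s by (intro sum_le_suminf) (auto simp: sums_iff)
    then show ?thesis using s by (simp add: sums_iff)
  qed
  then have "real k ^ k \<le> exp 1 ^ k * fact k"
    by (simp add: field_simps exp_of_nat_mult[symmetric])
  moreover have "real (n choose k) * fact k \<le> real n ^ k"
    using binomial_fact_pow[of n k] by (metis of_nat_fact of_nat_le_iff of_nat_mult of_nat_power)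
  ultimately have "real (n choose k) * fact k * real k ^ k \<le> real n ^ k * (exp 1 ^ k * fact k)"
    by (intro mult_mono) auto
  then have "real (n choose k) * real k ^ k \<le> real n ^ k * exp 1 ^ k"
    by (simp add: mult_ac)
  then show ?thesis
    using assms by (simp add: power_divide power_mult_distrib field_simps)
qed

text \<open>Sums the union bounds over set sizes, where size \<open>i\<close> fails with probability
  at most \<open>x ^ i\<close>.\<close>

lemma sum_powers_le:
  fixes x :: real
  assumes "0 \<le> x" "x \<le> 1 / 2" "finite I" "0 \<notin> I"
  shows "(\<Sum>i\<in>I. x ^ i) \<le> 2 * x"
proof -
  obtain m where m: "I \<subseteq> {..<m}" using finite_nat_bounded[OF assms(3)] by blast
  have "i \<in> Suc ` {..<m}" if "i \<in> I" for i
    using that m assms(4) by (cases i) auto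
  then have "(\<Sum>i\<in>I. x ^ i) \<le> (\<Sum>i\<in>Suc ` {..<m}. x ^ i)"
    using assms(1) by (intro sum_mono2) auto
  also have "\<dots> = x * (\<Sum>i<m. x ^ i)"
    by (simp add: sum.reindex sum_distrib_left)
  also have "\<dots> \<le> x * 2"
  proof (rule mult_left_mono[OF _ assms(1)])
    have "(\<Sum>i<m. x ^ i) = (1 - x ^ m) / (1 - x)" using assms(2) by (simp add: sum_gp_strict)
    also have "\<dots> \<le> 1 / (1 - x)" using assms by (intro divide_right_mono) auto
    also have "\<dots> \<le> 2" using assms by (simp add: field_simps)
    finally show "(\<Sum>i<m. x ^ i) \<le> 2" .
  qed
  finally show ?thesis by (simp only: mult.commute)
qed

text \<open>
  The factor \<open>3/8\<close> lies strictly between \<open>1/4\<close>, above which vertices of low degree are unlikely to be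
  close to each other, and \<open>1/2\<close>, below which isolated vertices are likely to exist.
\<close>

definition lower_time :: "nat \<Rightarrow> nat" where
  "lower_time n = nat \<lfloor>3 / 8 * real n * ln (real n)\<rfloor>"

text \<open>The factor 3 suits a crude union bound over cuts: each of at most \<open>n ^ k\<close>
  sets of size \<open>k\<close> is cut off with probability at most
  \<open>exp (- (3 * k * ln n))\<close>.\<close>

definition upper_time :: "nat \<Rightarrow> nat" where
  "upper_time n = nat \<lceil>3 * real n * ln (real n)\<rceil>"

abbreviation pairs :: "nat \<Rightarrow> nat set set" where
  "pairs n \<equiv> complete_edges {1..n}"

lemma finite_complete_edges [simp]: "finite V \<Longrightarrow> finite (complete_edges V)"
  unfolding complete_edges_def by (rule finite_subset[of _ "Pow V"]) auto

lemma card_complete_edges: "finite V \<Longrightarrow> card (complete_edges V) = card V choose 2"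
  unfolding complete_edges_def by (rule n_subsets)

lemma choose_two_real: "real (n choose 2) = real n * (real n - 1) / 2"
  by (induction n) (auto simp: numeral_2_eq_2 field_simps)

lemma card_pairs: "real (card (pairs n)) = real n * (real n - 1) / 2"
  by (simp add: card_complete_edges choose_two_real)

lemma time_bounds:
  assumes "1 \<le> n"
  shows "real (lower_time n) \<le> 3 / 8 * real n * ln (real n)"
    "3 / 8 * real n * ln (real n) - 1 \<le> real (lower_time n)"
    "3 * real n * ln (real n) \<le> real (upper_time n)"
    "real (upper_time n) \<le> 3 * real n * ln (real n) + 1"
proof -
  have "0 \<le> real n * ln (real n)" using assms by simp
  then show "real (lower_time n) \<le> 3 / 8 * real n * ln (real n)"
    "3 / 8 * real n * ln (real n) - 1 \<le> real (lower_time n)"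
    "3 * real n * ln (real n) \<le> real (upper_time n)"
    "real (upper_time n) \<le> 3 * real n * ln (real n) + 1"
    unfolding lower_time_def upper_time_def by linarith+
qed

text \<open>The densities at the two times are about \<open>3/4 * ln n / n\<close> and
  \<open>6 * ln n / n\<close>. They are bounded above generously, with constants 1 and 7, relative
  to half of all pairs, because at least that many pairs stay unconstrained in
  \<open>prob_constraints\<close>.\<close>

definition good_size :: "nat \<Rightarrow> bool" where
  "good_size n \<longleftrightarrow> 100 \<le> n \<and> 1 \<le> ln (real n) \<and>
     lower_time n \<le> card (pairs n) \<and> upper_time n \<le> card (pairs n) \<and> lower_time n \<le> upper_time n \<and>
     3 / 4 * ln (real n) / real n \<le> real (lower_time n) / real (card (pairs n)) \<and>
     6 * ln (real n) / real n \<le> real (upper_time n) / real (card (pairs n)) \<and>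
     real (lower_time n) \<le> 2 * ln (real n) / real n * (real (card (pairs n)) / 2) \<and>
     real (upper_time n) \<le> 14 * ln (real n) / real n * (real (card (pairs n)) / 2)"

lemma eventually_good_size: "eventually good_size sequentially"
proof -
  have "\<forall>\<^sub>F n in sequentially. 100 \<le> n" by (rule eventually_ge_at_top)
  moreover have "\<forall>\<^sub>F n in sequentially. 1 \<le> ln (real n)" by real_asymp
  moreover have "\<forall>\<^sub>F n in sequentially. 3 * real n * ln (real n) + 1 \<le> real n * (real n - 1) / 2"
    by real_asymp
  moreover have "\<forall>\<^sub>F n in sequentially. 3 / 4 * ln (real n) / real n * (real n * (real n - 1) / 2)
      \<le> 3 / 8 * real n * ln (real n) - 1"
    by real_asymp
  moreover have "\<forall>\<^sub>F n in sequentially. 6 * ln (real n) / real n * (real n * (real n - 1) / 2)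
      \<le> 3 * real n * ln (real n)"
    by real_asymp
  moreover have "\<forall>\<^sub>F n in sequentially. 3 / 8 * real n * ln (real n)
      \<le> 2 * ln (real n) / real n * (real n * (real n - 1) / 2 / 2)"
    by real_asymp
  moreover have "\<forall>\<^sub>F n in sequentially. 3 * real n * ln (real n) + 1
      \<le> 14 * ln (real n) / real n * (real n * (real n - 1) / 2 / 2)"
    by real_asymp
  ultimately show ?thesis
  proof eventually_elim
    case (elim n)
    have n: "1 \<le> n" using elim by simp
    note t = time_bounds[OF n]
    have L: "0 \<le> real n * ln (real n)" using elim by simp
    have pos: "0 < real (card (pairs n))" unfolding card_pairs using elim(1) by simp
    have "real (lower_time n) \<le> real (card (pairs n))" "real (upper_time n) \<le> real (card (pairs n))"
      "real (lower_time n) \<le> real (upper_time n)"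
      using elim(3) t L unfolding card_pairs by linarith+
    moreover have "3 / 4 * ln (real n) / real n * real (card (pairs n)) \<le> real (lower_time n)"
      "6 * ln (real n) / real n * real (card (pairs n)) \<le> real (upper_time n)"
      "real (lower_time n) \<le> 2 * ln (real n) / real n * (real (card (pairs n)) / 2)"
      "real (upper_time n) \<le> 14 * ln (real n) / real n * (real (card (pairs n)) / 2)"
      using elim(4-7) t unfolding card_pairs by linarith+
    ultimately show ?case
      unfolding good_size_def using elim(1,2) pos by (simp only: of_nat_le_iff pos_le_divide_eq simp_thms)
  qed
qed

section \<open>Missing edges between large sets, and failures of expansion\<close>

definition between :: "'a set \<Rightarrow> 'a set \<Rightarrow> 'a set set" where
  "between X Y = (\<lambda>(x, y). {x, y}) ` (X \<times> Y)"

lemma card_between: "X \<inter> Y = {} \<Longrightarrow> card (between X Y) = card X * card Y"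
  unfolding between_def by (subst card_image) (auto simp: inj_on_def doubleton_eq_iff card_cartesian_product)

lemma between_subset: "X \<subseteq> V \<Longrightarrow> Y \<subseteq> V \<Longrightarrow> X \<inter> Y = {} \<Longrightarrow> between X Y \<subseteq> complete_edges V"
  by (auto simp: between_def complete_edges_def card_insert_if)

definition separated :: "'a set set \<Rightarrow> 'a set \<Rightarrow> 'a set \<Rightarrow> bool" where
  "separated E X Y \<longleftrightarrow> (\<forall>e\<in>between X Y. e \<notin> E)"

lemma prob_separated:
  assumes "m \<le> card (pairs n)" "X \<subseteq> {1..n}" "Y \<subseteq> {1..n}" "X \<inter> Y = {}"
    and c: "c \<le> real m / real (card (pairs n))"
    and y: "y \<le> real (card Y)" and c0: "0 \<le> c" "0 \<le> y"
  shows "perm_prob (pairs n) (\<lambda>es. separated (set (take m es)) X Y) \<le> exp (- (c * (real (card X) * y)))"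
proof -
  have "perm_prob (pairs n) (\<lambda>es. separated (set (take m es)) X Y)
      \<le> exp (- (real m / real (card (pairs n)) * real (card (between X Y))))"
    unfolding separated_def using assms by (intro perm_prob_avoid_le between_subset) auto
  also have "\<dots> \<le> exp (- (c * (real (card X) * y)))"
    unfolding card_between[OF assms(4)] of_nat_mult exp_le_cancel_iff neg_le_iff_le using c0 c y
    by (intro mult_mono) auto
  finally show ?thesis .
qed

definition subsets_of_card :: "'a set \<Rightarrow> nat \<Rightarrow> 'a set set" where
  "subsets_of_card V k = {X. X \<subseteq> V \<and> card X = k}"

lemma finite_subsets_of_card [simp]: "finite V \<Longrightarrow> finite (subsets_of_card V k)"
  by (simp add: subsets_of_card_def)

lemma card_subsets_of_card: "finite V \<Longrightarrow> card (subsets_of_card V k) = card V choose k"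
  unfolding subsets_of_card_def by (rule n_subsets)

lemma perm_prob_UN_le:
  assumes "finite I" "\<And>i. i \<in> I \<Longrightarrow> perm_prob S (Q i) \<le> c"
  shows "perm_prob S (\<lambda>xs. \<exists>i\<in>I. Q i xs) \<le> real (card I) * c"
  using perm_prob_UN[OF assms(1), of S Q] sum_mono[OF assms(2)] by fastforce

definition bad_cut :: "nat \<Rightarrow> nat set list \<Rightarrow> bool" where
  "bad_cut n es \<longleftrightarrow> (\<exists>k\<in>{1..n div 2}. \<exists>K\<in>subsets_of_card {1..n} k.
     separated (set (take (upper_time n) es)) K ({1..n} - K))"

lemma prob_bad_cut:
  assumes "good_size n"
  shows "perm_prob (pairs n) (bad_cut n) \<le> 2 * exp (- (2 * ln (real n)))"
proof -
  define L where "L = ln (real n)"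
  have n: "100 \<le> n" "1 \<le> L" using assms by (auto simp: good_size_def L_def)
  have "perm_prob (pairs n) (bad_cut n) \<le> (\<Sum>k\<in>{1..n div 2}. perm_prob (pairs n)
      (\<lambda>es. \<exists>K\<in>subsets_of_card {1..n} k. separated (set (take (upper_time n) es)) K ({1..n} - K)))"
    unfolding bad_cut_def by (rule perm_prob_UN) simp
  also have "\<dots> \<le> (\<Sum>k\<in>{1..n div 2}. exp (- (2 * L)) ^ k)"
  proof (rule sum_mono)
    fix k assume k: "k \<in> {1..n div 2}"
    have "perm_prob (pairs n)
      (\<lambda>es. \<exists>K\<in>subsets_of_card {1..n} k. separated (set (take (upper_time n) es)) K ({1..n} - K))
      \<le> real (card (subsets_of_card {1..n} k)) * exp (- (6 * L / real n * (real k * (real n / 2))))"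
    proof (rule perm_prob_UN_le)
      fix K assume "K \<in> subsets_of_card {1..n} k"
      then have K: "K \<subseteq> {1..n}" "card K = k" by (auto simp: subsets_of_card_def)
      have "k \<le> n" using k by auto
      then have "real (card ({1..n} - K)) = real n - real k"
        using K by (simp add: card_Diff_subset finite_subset of_nat_diff)
      moreover have "real k \<le> real n / 2" using k by auto
      ultimately have "real n / 2 \<le> real (card ({1..n} - K))" by linarith
      then have "perm_prob (pairs n) (\<lambda>es. separated (set (take (upper_time n) es)) K ({1..n} - K))
          \<le> exp (- (6 * L / real n * (real (card K) * (real n / 2))))"
        using assms K n unfolding L_def
        by (intro prob_separated) (auto simp: good_size_def)
      then show "perm_prob (pairs n) (\<lambda>es. separated (set (take (upper_time n) es)) K ({1..n} - K))
          \<le> exp (- (6 * L / real n * (real k * (real n / 2))))" using K by simp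
    qed simp
    also have "\<dots> \<le> exp L ^ k * exp (- (6 * L / real n * (real k * (real n / 2))))"
    proof (rule mult_right_mono)
      have "real (n choose k) \<le> real n ^ k"
        using binomial_le_pow[of k n] k by (metis atLeastAtMost_iff div_le_dividend le_trans of_nat_le_iff of_nat_power)
      then show "real (card (subsets_of_card {1..n} k)) \<le> exp L ^ k"
        using n by (simp add: card_subsets_of_card L_def)
    qed simp
    also have "exp L ^ k * exp (- (6 * L / real n * (real k * (real n / 2)))) = exp (- (2 * L)) ^ k"
    proof -
      have "6 * L / real n * (real k * (real n / 2)) = 3 * L * real k" using n by (simp add: field_simps)
      then show ?thesis
        by (simp add: exp_of_nat_mult[symmetric] exp_add[symmetric] algebra_simps)
    qed
    finally show "perm_prob (pairs n)
      (\<lambda>es. \<exists>K\<in>subsets_of_card {1..n} k. separated (set (take (upper_time n) es)) K ({1..n} - K))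
      \<le> exp (- (2 * L)) ^ k" .
  qed
  also have "\<dots> \<le> 2 * exp (- (2 * L))"
  proof (rule sum_powers_le)
    have "exp (- (2 * L)) \<le> inverse (1 + 2 * L)"
      using exp_ge_add_one_self[of "2 * L"] n by (simp add: exp_minus)
    also have "\<dots> \<le> 1 / 2" using n by (simp add: field_simps)
    finally show "exp (- (2 * L)) \<le> 1 / 2" .
  qed auto
  finally show ?thesis by (simp add: L_def)
qed

text \<open>With \<open>n div 8\<close> the long path misses at most a quarter of the vertices,
  which matches the range \<open>4 * u \<le> n\<close> in \<open>bad_expansion\<close>.\<close>

definition bad_pair :: "nat \<Rightarrow> nat set list \<Rightarrow> bool" where
  "bad_pair n es \<longleftrightarrow> (\<exists>X\<in>subsets_of_card {1..n} (n div 8). \<exists>Y\<in>subsets_of_card {1..n} (n div 8).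
     X \<inter> Y = {} \<and> separated (set (take (lower_time n) es)) X Y)"

lemma prob_bad_pair:
  assumes "good_size n"
  shows "perm_prob (pairs n) (bad_pair n) \<le> 4 ^ n * exp (- (ln (real n) * real n / 108))"
proof -
  define L where "L = ln (real n)"
  have n: "100 \<le> n" "1 \<le> L" using assms by (auto simp: good_size_def L_def)
  \<comment> \<open>The 9 absorbs the rounding of \<open>n div 8\<close>; with the density constant
    \<open>3 / 4\<close> it leads to \<open>3 / 4 / 81 = 1 / 108\<close>.\<close>
  have k: "real n / 9 \<le> real (n div 8)" using n(1) by linarith
  let ?S = "subsets_of_card {1..n} (n div 8)"
  have card: "real (card ?S) \<le> 2 ^ n"
    using binomial_le_pow2[of n "n div 8"] by (simp add: card_subsets_of_card)
  have "perm_prob (pairs n) (bad_pair n) \<le> real (card ?S) * (real (card ?S) * exp (- (L * real n / 108)))"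
    unfolding bad_pair_def
  proof (intro perm_prob_UN_le)
    fix X Y assume XY: "X \<in> ?S" "Y \<in> ?S"
    show "perm_prob (pairs n) (\<lambda>es. X \<inter> Y = {} \<and> separated (set (take (lower_time n) es)) X Y)
       \<le> exp (- (L * real n / 108))"
    proof (cases "X \<inter> Y = {}")
      case True
      have "perm_prob (pairs n) (\<lambda>es. separated (set (take (lower_time n) es)) X Y)
        \<le> exp (- (3 / 4 * L / real n * (real (card X) * (real n / 9))))"
        using assms XY True k n unfolding L_def
        by (intro prob_separated) (auto simp: good_size_def subsets_of_card_def)
      also have "\<dots> \<le> exp (- (L * real n / 108))"
        unfolding exp_le_cancel_iff neg_le_iff_le
      proof -
        have "real n / 9 \<le> real (card X)" using XY k by (simp add: subsets_of_card_def)
        then have "3 / 4 * L / real n * (real n / 9 * (real n / 9)) \<le> 3 / 4 * L / real n * (real (card X) * (real n / 9))"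
          using n by (intro mult_left_mono mult_right_mono) auto
        moreover have "3 / 4 * L / real n * (real n / 9 * (real n / 9)) = L * real n / 108"
          using n by (simp add: field_simps)
        ultimately show "L * real n / 108 \<le> 3 / 4 * L / real n * (real (card X) * (real n / 9))"
          by simp
      qed
      finally show ?thesis using True by simp
    next
      case False
      then show ?thesis by (simp add: perm_prob_def)
    qed
  qed auto
  also have "\<dots> \<le> 2 ^ n * (2 ^ n * exp (- (L * real n / 108)))"
    using card by (intro mult_mono) auto
  also have "\<dots> = 4 ^ n * exp (- (L * real n / 108))"
    by (simp add: mult.assoc[symmetric] power_mult_distrib[symmetric])
  finally show ?thesis by (simp add: L_def)
qed

text \<open>Sets with at most about \<open>n / (ln n)\<^sup>2\<close> vertices are left to \<open>bad_dense\<close>.\<close>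

definition bad_expansion :: "nat \<Rightarrow> nat set list \<Rightarrow> bool" where
  "bad_expansion n es \<longleftrightarrow> (\<exists>u\<in>{u. 4 * u \<le> n \<and> real n < 3 * real u * ln (real n) ^ 2}.
     \<exists>U\<in>subsets_of_card {1..n} u. \<exists>T\<in>subsets_of_card {1..n} (2 * u).
     separated (set (take (lower_time n) es)) U ({1..n} - U - T))"

text \<open>The set \<open>T\<close> contains all neighbours of \<open>U\<close> outside
  \<open>U\<close>, so at least \<open>n / 4\<close> vertices send no edge to \<open>U\<close>. As
  \<open>n / u\<close> is below \<open>3 * (ln n) ^ 2\<close>, choosing \<open>U\<close> and
  \<open>T\<close> costs only a power of \<open>ln n\<close> for each vertex of \<open>U\<close>,
  whereas the missing edges contribute \<open>exp (- (3 / 16 * ln n))\<close>.\<close>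

lemma prob_bad_expansion:
  assumes "good_size n" and small: "(3 * exp 1 * ln (real n) ^ 2) ^ 3 * exp (- (3 / 16 * ln (real n))) \<le> 1 / 2"
  shows "perm_prob (pairs n) (bad_expansion n)
    \<le> 2 * ((3 * exp 1 * ln (real n) ^ 2) ^ 3 * exp (- (3 / 16 * ln (real n))))"
proof -
  define L where "L = ln (real n)"
  have n: "100 \<le> n" "1 \<le> L" using assms by (auto simp: good_size_def L_def)
  let ?I = "{u. 4 * u \<le> n \<and> real n < 3 * real u * L ^ 2}"
  let ?Q = "\<lambda>u U es. \<exists>T\<in>subsets_of_card {1..n} (2 * u). separated (set (take (lower_time n) es)) U ({1..n} - U - T)"
  have finI: "finite ?I" by (rule finite_subset[of _ "{..n}"]) auto
  have "perm_prob (pairs n) (bad_expansion n) \<le> (\<Sum>u\<in>?I. perm_prob (pairs n)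
      (\<lambda>es. \<exists>U\<in>subsets_of_card {1..n} u. ?Q u U es))"
    unfolding bad_expansion_def L_def[symmetric] by (rule perm_prob_UN[OF finI])
  also have "\<dots> \<le> (\<Sum>u\<in>?I. ((3 * exp 1 * L ^ 2) ^ 3 * exp (- (3 / 16 * L))) ^ u)"
  proof (rule sum_mono)
    fix u assume u: "u \<in> ?I"
    then have u0: "0 < u" using n by (auto intro: gr0I)
    have "perm_prob (pairs n) (\<lambda>es. \<exists>U\<in>subsets_of_card {1..n} u. ?Q u U es)
      \<le> real (card (subsets_of_card {1..n} u)) * (real (card (subsets_of_card {1..n} (2 * u))) *
          exp (- (3 / 4 * L / real n * (real u * (real n / 4)))))"
    proof (intro perm_prob_UN_le)
      fix U T assume UT: "U \<in> subsets_of_card {1..n} u" "T \<in> subsets_of_card {1..n} (2 * u)"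
      have "n \<le> card ({1..n} - U - T) + card U + card T"
      proof -
        have "card {1..n} \<le> card (({1..n} - U - T) \<union> U \<union> T)"
          using UT by (intro card_mono) (auto simp: subsets_of_card_def intro: finite_subset)
        also have "\<dots> \<le> card ({1..n} - U - T) + card U + card T"
          using card_Un_le[of "({1..n} - U - T) \<union> U" T] card_Un_le[of "{1..n} - U - T" U] by linarith
        finally show ?thesis by simp
      qed
      then have "n \<le> card ({1..n} - U - T) + 3 * u" using UT by (simp add: subsets_of_card_def)
      then have "real n / 4 \<le> real (card ({1..n} - U - T))" using u by auto
      then have "perm_prob (pairs n) (\<lambda>es. separated (set (take (lower_time n) es)) U ({1..n} - U - T))
          \<le> exp (- (3 / 4 * L / real n * (real (card U) * (real n / 4))))"
        using assms UT n unfolding L_def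
        by (intro prob_separated) (auto simp: good_size_def subsets_of_card_def)
      then show "perm_prob (pairs n) (\<lambda>es. separated (set (take (lower_time n) es)) U ({1..n} - U - T))
          \<le> exp (- (3 / 4 * L / real n * (real u * (real n / 4))))"
        using UT(1) by (simp only: subsets_of_card_def mem_Collect_eq)
    qed auto
    also have "\<dots> \<le> (3 * exp 1 * L ^ 2) ^ u * ((3 * exp 1 * L ^ 2) ^ (2 * u) *
          exp (- (3 / 4 * L / real n * (real u * (real n / 4)))))"
    proof -
      \<comment> \<open>One estimate for the choice of both \<open>U\<close> and \<open>T\<close>:
        \<open>n / j\<close> only decreases when \<open>j\<close> grows.\<close>
      have ub: "real (n choose j) \<le> (3 * exp 1 * L ^ 2) ^ j" if "u \<le> j" for j
      proof -
        have j: "0 < j" using u0 that by simp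
        have "real n \<le> 3 * real u * L ^ 2" using u by simp
        also have "\<dots> \<le> 3 * real j * L ^ 2" using that by (intro mult_right_mono) auto
        finally have "exp 1 * real n / real j \<le> 3 * exp 1 * L ^ 2"
          using j by (simp add: field_simps)
        then show ?thesis
          using binomial_le_exp_pow[OF j, of n] power_mono[of "exp 1 * real n / real j" "3 * exp 1 * L ^ 2" j]
          by (simp add: order_trans)
      qed
      show ?thesis
        using ub[of u] ub[of "2 * u"]
        by (intro mult_mono) (auto simp: card_subsets_of_card)
    qed
    also have "\<dots> = ((3 * exp 1 * L ^ 2) ^ 3 * exp (- (3 / 16 * L))) ^ u"
    proof -
      have "3 / 4 * L / real n * (real u * (real n / 4)) = real u * (3 / 16 * L)" using n by (simp add: field_simps)
      then have "exp (- (3 / 4 * L / real n * (real u * (real n / 4)))) = exp (- (3 / 16 * L)) ^ u"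
        by (simp add: exp_of_nat_mult[symmetric])
      moreover have "(3 * exp 1 * L ^ 2) ^ u * (3 * exp 1 * L ^ 2) ^ (2 * u) = ((3 * exp 1 * L ^ 2) ^ 3) ^ u"
        by (simp add: power_add[symmetric] power_mult[symmetric])
      ultimately show ?thesis by (simp only: mult.assoc[symmetric] power_mult_distrib)
    qed
    finally show "perm_prob (pairs n) (\<lambda>es. \<exists>U\<in>subsets_of_card {1..n} u. ?Q u U es)
      \<le> ((3 * exp 1 * L ^ 2) ^ 3 * exp (- (3 / 16 * L))) ^ u" .
  qed
  also have "\<dots> \<le> 2 * ((3 * exp 1 * L ^ 2) ^ 3 * exp (- (3 / 16 * L)))"
    using small n finI by (intro sum_powers_le) (auto simp: L_def)
  finally show ?thesis by (simp add: L_def)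
qed

lemma good_sizeD:
  assumes "good_size n"
  shows "100 \<le> n" "1 \<le> ln (real n)" "lower_time n \<le> card (pairs n)" "upper_time n \<le> card (pairs n)"
    "lower_time n \<le> upper_time n"
    "3 / 4 * ln (real n) / real n \<le> real (lower_time n) / real (card (pairs n))"
    "real (lower_time n) \<le> 2 * ln (real n) / real n * (real (card (pairs n)) / 2)"
    "real (upper_time n) \<le> 14 * ln (real n) / real n * (real (card (pairs n)) / 2)"
  using assms unfolding good_size_def by blast+

lemma prob_constraints:
  fixes n :: nat
  defines "L \<equiv> ln (real n)"
  assumes n: "good_size n" and sub: "A \<subseteq> pairs n" "B \<subseteq> pairs n" "C \<subseteq> pairs n"
    and disj: "A \<inter> B = {}" "A \<inter> C = {}" "B \<inter> C = {}"
    and total: "2 * (card A + card B + card C) \<le> card (pairs n)"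
  shows "perm_prob (pairs n) (\<lambda>es. (\<forall>b\<in>B. b \<notin> set (take (lower_time n) es)) \<and>
      (\<forall>a\<in>A. a \<in> set (take (lower_time n) es)) \<and> (\<forall>c\<in>C. c \<in> set (take (upper_time n) es)))
    \<le> exp (- (3 / 4 * L / real n * real (card B))) * (2 * L / real n) ^ card A * (14 * L / real n) ^ card C"
proof -
  note g = good_sizeD[OF n, folded L_def]
  have half: "real (card (pairs n)) / 2 \<le> real (card (pairs n)) - real (card A + card B + card C)"
  proof -
    have "real (2 * (card A + card B + card C)) \<le> real (card (pairs n))"
      using total by (simp only: of_nat_le_iff)
    then show ?thesis by simp
  qed
  have "perm_prob (pairs n) (\<lambda>es. (\<forall>b\<in>B. b \<notin> set (take (lower_time n) es)) \<and>
      (\<forall>a\<in>A. a \<in> set (take (lower_time n) es)) \<and> (\<forall>c\<in>C. c \<in> set (take (upper_time n) es)))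
    \<le> exp (- (real (lower_time n) / real (card (pairs n)) * real (card B))) *
        (2 * L / real n) ^ card A * (14 * L / real n) ^ card C"
  proof (rule perm_prob_constraints)
    show "real (lower_time n) \<le> 2 * L / real n * (real (card (pairs n)) - real (card A + card B + card C))"
      using mult_left_mono[OF half, of "2 * L / real n"] g by simp
    show "real (upper_time n) \<le> 14 * L / real n * (real (card (pairs n)) - real (card A + card B + card C))"
      using mult_left_mono[OF half, of "14 * L / real n"] g by simp
  qed (use sub disj g in auto)
  also have "\<dots> \<le> exp (- (3 / 4 * L / real n * real (card B))) * (2 * L / real n) ^ card A * (14 * L / real n) ^ card C"
  proof (intro mult_right_mono)
    show "exp (- (real (lower_time n) / real (card (pairs n)) * real (card B)))
        \<le> exp (- (3 / 4 * L / real n * real (card B)))"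
      unfolding exp_le_cancel_iff neg_le_iff_le by (rule mult_right_mono[OF g(6)]) simp
  qed (use g in auto)
  finally show ?thesis .
qed

definition bad_dense :: "nat \<Rightarrow> nat set list \<Rightarrow> bool" where
  "bad_dense n es \<longleftrightarrow> (\<exists>w\<in>{w. 0 < w \<and> real w * ln (real n) ^ 2 \<le> real n}.
     \<exists>W\<in>subsets_of_card {1..n} w. \<exists>A\<in>subsets_of_card (complete_edges W) (3 * w).
     \<forall>e\<in>A. e \<in> set (take (lower_time n) es))"

text \<open>Up to constants, a set of size \<open>w\<close> contributes
  \<open>(n / w) * (w * ln n / n) ^ 3\<close> per vertex, which is at most \<open>1 / ln n\<close>
  in the range considered. Two edges per vertex instead of three would only give
  \<open>w * (ln n) ^ 2 / n\<close>, which is not small for the largest \<open>w\<close>.\<close>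

lemma prob_bad_dense:
  assumes "good_size n" and small: "exp 1 ^ 4 / 27 / ln (real n) \<le> 1 / 2"
  shows "perm_prob (pairs n) (bad_dense n) \<le> 2 * (exp 1 ^ 4 / 27 / ln (real n))"
proof -
  define L where "L = ln (real n)"
  have n: "100 \<le> n" "1 \<le> L" using assms by (auto simp: good_size_def L_def)
  let ?I = "{w. 0 < w \<and> real w * L ^ 2 \<le> real n}"
  let ?Q = "\<lambda>w W es. \<exists>A\<in>subsets_of_card (complete_edges W) (3 * w). \<forall>e\<in>A. e \<in> set (take (lower_time n) es)"
  have w_le: "w \<le> n" if "w \<in> ?I" for w
  proof -
    have "real w * 1 \<le> real w * L ^ 2" using n by (intro mult_left_mono) auto
    then have "real w \<le> real n" using that unfolding mem_Collect_eq by linarith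
    then show ?thesis by simp
  qed
  have "?I \<subseteq> {..n}"
  proof
    fix w assume "w \<in> ?I"
    then have "w \<le> n" by (rule w_le)
    then show "w \<in> {..n}" by simp
  qed
  then have finI: "finite ?I" by (rule finite_subset) simp
  have "perm_prob (pairs n) (bad_dense n) \<le> (\<Sum>w\<in>?I. perm_prob (pairs n)
      (\<lambda>es. \<exists>W\<in>subsets_of_card {1..n} w. ?Q w W es))"
    unfolding bad_dense_def L_def[symmetric] by (rule perm_prob_UN[OF finI])
  also have "\<dots> \<le> (\<Sum>w\<in>?I. (exp 1 ^ 4 / 27 / L) ^ w)"
  proof (rule sum_mono)
    fix w assume w: "w \<in> ?I"
    let ?c = "real ((w choose 2) choose (3 * w)) * (2 * L / real n) ^ (3 * w)"
    have "perm_prob (pairs n) (\<lambda>es. \<exists>W\<in>subsets_of_card {1..n} w. ?Q w W es)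
      \<le> real (card (subsets_of_card {1..n} w)) * ?c"
    proof (intro perm_prob_UN_le)
      fix W assume "W \<in> subsets_of_card {1..n} w"
      then have W: "W \<subseteq> {1..n}" "card W = w" "finite W"
        by (auto simp: subsets_of_card_def intro: finite_subset)
      have "perm_prob (pairs n) (?Q w W) \<le>
          real (card (subsets_of_card (complete_edges W) (3 * w))) * (2 * L / real n) ^ (3 * w)"
      proof (intro perm_prob_UN_le)
        fix A assume "A \<in> subsets_of_card (complete_edges W) (3 * w)"
        then have A: "A \<subseteq> pairs n" "card A = 3 * w"
          using W by (auto simp: subsets_of_card_def complete_edges_def)
        have "real (2 * (3 * w)) \<le> real (card (pairs n))"
        proof -
          have "12 * real n \<le> real n * (real n - 1)" using n by (simp add: algebra_simps)
          then show ?thesis using w_le[OF w] unfolding card_pairs by simp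
        qed
        then have "perm_prob (pairs n) (\<lambda>es. (\<forall>b\<in>{}. b \<notin> set (take (lower_time n) es)) \<and>
            (\<forall>a\<in>A. a \<in> set (take (lower_time n) es)) \<and> (\<forall>c\<in>{}. c \<in> set (take (upper_time n) es)))
          \<le> exp (- (3 / 4 * L / real n * real (card ({} :: nat set set)))) * (2 * L / real n) ^ card A *
              (14 * L / real n) ^ card ({} :: nat set set)"
          using A assms(1) unfolding L_def by (intro prob_constraints) auto
        then show "perm_prob (pairs n) (\<lambda>es. \<forall>e\<in>A. e \<in> set (take (lower_time n) es)) \<le> (2 * L / real n) ^ (3 * w)"
          using A by simp
      qed (use W in simp)
      then show "perm_prob (pairs n) (?Q w W) \<le> ?c"
        using W by (simp add: card_subsets_of_card card_complete_edges)
    qed simp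
    also have "\<dots> \<le> (exp 1 * real n / real w) ^ w * ((exp 1 * real w / 6) ^ (3 * w) * (2 * L / real n) ^ (3 * w))"
    proof (intro mult_mono)
      show "real (card (subsets_of_card {1..n} w)) \<le> (exp 1 * real n / real w) ^ w"
        using binomial_le_exp_pow[of w n] w by (simp add: card_subsets_of_card)
      have "real (w choose 2) \<le> real w ^ 2 / 2"
        by (simp add: choose_two_real power2_eq_square algebra_simps)
      then have "exp 1 * real (w choose 2) / real (3 * w) \<le> exp 1 * (real w ^ 2 / 2) / real (3 * w)"
        by (intro divide_right_mono mult_left_mono) auto
      also have "\<dots> = exp 1 * real w / 6" using w by (simp add: power2_eq_square field_simps)
      finally have "(exp 1 * real (w choose 2) / real (3 * w)) ^ (3 * w) \<le> (exp 1 * real w / 6) ^ (3 * w)"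
        by (intro power_mono) auto
      then show "real ((w choose 2) choose (3 * w)) \<le> (exp 1 * real w / 6) ^ (3 * w)"
        using binomial_le_exp_pow[of "3 * w" "w choose 2"] w by (simp add: order_trans)
    qed (use n in auto)
    also have "\<dots> = (exp 1 * real n / real w * (exp 1 * real w / 6 * (2 * L / real n)) ^ 3) ^ w"
      by (simp only: power_mult_distrib power_mult)
    also have "\<dots> = (exp 1 ^ 4 / 27 * ((real w * L ^ 2 / real n) ^ 2 / L)) ^ w"
      using w n by (simp add: field_simps power2_eq_square power3_eq_cube power4_eq_xxxx)
    also have "\<dots> \<le> (exp 1 ^ 4 / 27 / L) ^ w"
    proof (rule power_mono)
      have "(real w * L ^ 2 / real n) ^ 2 \<le> 1 ^ 2"
        using w n by (intro power_mono) auto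
      then have "(real w * L ^ 2 / real n) ^ 2 / L \<le> 1 / L" using n by (intro divide_right_mono) auto
      then have "exp 1 ^ 4 / 27 * ((real w * L ^ 2 / real n) ^ 2 / L) \<le> exp 1 ^ 4 / 27 * (1 / L)"
        by (intro mult_left_mono) auto
      then show "exp 1 ^ 4 / 27 * ((real w * L ^ 2 / real n) ^ 2 / L) \<le> exp 1 ^ 4 / 27 / L" by simp
    qed (use n in auto)
    finally show "perm_prob (pairs n) (\<lambda>es. \<exists>W\<in>subsets_of_card {1..n} w. ?Q w W es)
      \<le> (exp 1 ^ 4 / 27 / L) ^ w" .
  qed
  also have "\<dots> \<le> 2 * (exp 1 ^ 4 / 27 / L)"
    using small n finI by (intro sum_powers_le) (auto simp: L_def)
  finally show ?thesis by (simp add: L_def)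
qed

section \<open>Vertices of low degree that are close to each other\<close>

definition incident :: "nat \<Rightarrow> nat \<Rightarrow> nat set set" where
  "incident n v = {e \<in> pairs n. v \<in> e}"

lemma incident_subset: "incident n v \<subseteq> pairs n"
  by (auto simp: incident_def)

lemma incident_eq_between: "v \<in> {1..n} \<Longrightarrow> incident n v = between {v} ({1..n} - {v})"
  unfolding incident_def between_def complete_edges_def card_2_iff
  by (auto simp: doubleton_eq_iff)

lemma card_incident: "v \<in> {1..n} \<Longrightarrow> card (incident n v) = n - 1"
  by (simp add: incident_eq_between card_between)

lemma card_incident_Un:
  assumes "x \<in> {1..n}" "y \<in> {1..n}" "x \<noteq> y"
  shows "card (incident n x \<union> incident n y) = 2 * n - 3"
proof -
  have "incident n x \<inter> incident n y = {{x, y}}"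
    using assms unfolding incident_def complete_edges_def card_2_iff by auto
  moreover have fin: "finite (incident n v)" for v
    by (rule finite_subset[OF incident_subset]) simp
  ultimately have "card (incident n x \<union> incident n y) + 1 = (n - 1) + (n - 1)"
    using card_Un_Int[of "incident n x" "incident n y"] assms by (simp add: card_incident)
  then show ?thesis by linarith
qed

text \<open>The threshold is \<open>2 * 3 * 3\<close>: a factor 2 as an edge is counted at both
  ends, a 3 since \<open>U\<close> with its neighbours is less than three times as large as
  \<open>U\<close>, and a 3 for the density excluded by \<open>bad_dense\<close>.\<close>

definition low_degree :: "nat \<Rightarrow> nat set list \<Rightarrow> nat \<Rightarrow> bool" where
  "low_degree n es v \<longleftrightarrow> card {e \<in> set (take (lower_time n) es). v \<in> e} < 18"

text \<open>Two vertices of low degree have together at most \<open>34 = 17 + 17\<close> edges,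
  hence 35 possible counts. Of the \<open>2 * n - 3\<close> pairs at the two vertices, up to 2 are
  set aside and up to 34 are present, so at least \<open>2 * n - 39\<close> are absent. The last
  factor stands for \<open>c\<close> edges present at the later time.\<close>

definition close_bound :: "nat \<Rightarrow> nat \<Rightarrow> real" where
  "close_bound n c = 35 * ((4 * ln (real n)) ^ 34 *
     exp (- (3 / 4 * ln (real n) / real n * (2 * real n - 39))) * (14 * ln (real n) / real n) ^ c)"

text \<open>Union bound over the exact set \<open>A\<close> of edges at \<open>x\<close> or
  \<open>y\<close>, outside \<open>C\<close>, that are present at the earlier time. There are at
  most \<open>(2 * n) ^ a\<close> sets of size \<open>a\<close>, each weighted by
  \<open>(2 * ln n / n) ^ a\<close>; this produces \<open>(4 * ln n) ^ a\<close>. The pairs in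
  \<open>C\<close> are set aside because they are constrained at the later time.\<close>

lemma prob_low_degree_pair:
  assumes good: "good_size n" and xy: "x \<in> {1..n}" "y \<in> {1..n}" "x \<noteq> y"
    and C: "C \<subseteq> incident n x \<union> incident n y" "card C \<le> 2"
  shows "perm_prob (pairs n) (\<lambda>es. low_degree n es x \<and> low_degree n es y \<and>
      (\<forall>e\<in>C. e \<in> set (take (upper_time n) es))) \<le> close_bound n (card C)"
proof -
  define L where "L = ln (real n)"
  note g = good_sizeD[OF good, folded L_def]
  define B where "B = incident n x \<union> incident n y - C"
  define E where "E es = set (take (lower_time n) es)" for es :: "nat set list"
  have sub: "B \<subseteq> pairs n" "C \<subseteq> pairs n" using C(1) incident_subset by (auto simp: B_def)
  have fin: "finite B" "finite C" using sub finite_subset by fastforce+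
  have cardB: "2 * real n - 5 \<le> real (card B)" "card B \<le> 2 * n"
  proof -
    have "card B = 2 * n - 3 - card C"
      unfolding B_def using C(1) fin(2) by (simp add: card_Diff_subset card_incident_Un[OF xy])
    then show "2 * real n - 5 \<le> real (card B)" "card B \<le> 2 * n" using C(2) g(1) by linarith+
  qed
  let ?Q = "\<lambda>A es. (\<forall>b\<in>B - A. b \<notin> E es) \<and> (\<forall>a\<in>A. a \<in> E es) \<and> (\<forall>c\<in>C. c \<in> set (take (upper_time n) es))"
  have "perm_prob (pairs n) (\<lambda>es. low_degree n es x \<and> low_degree n es y \<and>
      (\<forall>e\<in>C. e \<in> set (take (upper_time n) es)))
    \<le> perm_prob (pairs n) (\<lambda>es. \<exists>a\<in>{..34}. \<exists>A\<in>subsets_of_card B a. ?Q A es)"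
  proof (rule perm_prob_mono)
    fix es assume es: "es \<in> permutations_of_set (pairs n)"
      "low_degree n es x \<and> low_degree n es y \<and> (\<forall>e\<in>C. e \<in> set (take (upper_time n) es))"
    let ?A = "{e \<in> B. e \<in> E es}"
    have "card ?A \<le> card ({e \<in> E es. x \<in> e} \<union> {e \<in> E es. y \<in> e})"
      by (intro card_mono) (auto simp: B_def incident_def E_def)
    also have "\<dots> \<le> 34"
      using es(2) card_Un_le[of "{e \<in> E es. x \<in> e}" "{e \<in> E es. y \<in> e}"]
      unfolding low_degree_def E_def[symmetric] by linarith
    finally have "card ?A \<in> {..34}" by simp
    moreover have "?A \<in> subsets_of_card B (card ?A)" by (auto simp: subsets_of_card_def)
    moreover have "?Q ?A es" using es(2) by blast
    ultimately show "\<exists>a\<in>{..34}. \<exists>A\<in>subsets_of_card B a. ?Q A es" by blast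
  qed simp
  also have "\<dots> \<le> (\<Sum>a\<in>{..34}. perm_prob (pairs n) (\<lambda>es. \<exists>A\<in>subsets_of_card B a. ?Q A es))"
    by (rule perm_prob_UN) simp
  also have "\<dots> \<le> (\<Sum>a\<in>{..34::nat}. (4 * L) ^ 34 *
     exp (- (3 / 4 * L / real n * (2 * real n - 39))) * (14 * L / real n) ^ card C)"
  proof (rule sum_mono)
    fix a :: nat assume a: "a \<in> {..34}"
    let ?e = "exp (- (3 / 4 * L / real n * (2 * real n - 39))) * (14 * L / real n) ^ card C"
    have "perm_prob (pairs n) (\<lambda>es. \<exists>A\<in>subsets_of_card B a. ?Q A es)
        \<le> real (card (subsets_of_card B a)) * ((2 * L / real n) ^ a * ?e)"
    proof (rule perm_prob_UN_le)
      fix A assume "A \<in> subsets_of_card B a"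
      then have A: "A \<subseteq> B" "card A = a" "finite A"
        using fin finite_subset by (auto simp: subsets_of_card_def)
      have cBA: "card (B - A) = card B - a" using A by (simp add: card_Diff_subset)
      have "real (2 * (card A + card (B - A) + card C)) \<le> real (card (pairs n))"
      proof -
        have "a \<le> card B" using A fin card_mono by blast
        then have "real (2 * (card A + card (B - A) + card C)) \<le> 4 * real n + 4"
          using cBA A cardB C(2) by simp
        also have "\<dots> \<le> 50 * (real n - 1)" using g(1) by simp
        also have "\<dots> \<le> real n / 2 * (real n - 1)" using g(1) by (intro mult_right_mono) auto
        finally show ?thesis unfolding card_pairs by simp
      qed
      then have "perm_prob (pairs n) (?Q A) \<le>
          exp (- (3 / 4 * L / real n * real (card (B - A)))) * (2 * L / real n) ^ card A * (14 * L / real n) ^ card C"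
        unfolding E_def L_def using A sub good by (intro prob_constraints) (auto simp: B_def)
      also have "\<dots> \<le> exp (- (3 / 4 * L / real n * (2 * real n - 39))) * (2 * L / real n) ^ card A * (14 * L / real n) ^ card C"
      proof (intro mult_right_mono)
        have "2 * real n - 39 \<le> real (card (B - A))" using cBA cardB a by simp
        then have "3 / 4 * L / real n * (2 * real n - 39) \<le> 3 / 4 * L / real n * real (card (B - A))"
          using g by (intro mult_left_mono) auto
        then show "exp (- (3 / 4 * L / real n * real (card (B - A)))) \<le> exp (- (3 / 4 * L / real n * (2 * real n - 39)))"
          by simp
      qed (use g in auto)
      finally show "perm_prob (pairs n) (?Q A) \<le> (2 * L / real n) ^ a * ?e"
        using A by (simp only: mult_ac)
    qed (use fin in simp)
    also have "\<dots> \<le> (2 * real n) ^ a * ((2 * L / real n) ^ a * ?e)"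
    proof (rule mult_right_mono)
      have "card B choose a \<le> (2 * n) ^ a"
      proof (cases "a \<le> card B")
        case True
        then show ?thesis using binomial_le_pow[OF True] power_mono[OF cardB(2), of a] by simp
      next
        case False
        then show ?thesis by (simp add: binomial_eq_0)
      qed
      then have "real (card B choose a) \<le> real ((2 * n) ^ a)" by (simp only: of_nat_le_iff)
      then show "real (card (subsets_of_card B a)) \<le> (2 * real n) ^ a"
        using fin by (simp add: card_subsets_of_card)
    qed (use g in auto)
    also have "\<dots> = (4 * L) ^ a * ?e"
    proof -
      have "2 * real n * (2 * L / real n) = 4 * L" using g(1) by simp
      then show ?thesis by (simp only: mult.assoc[symmetric] power_mult_distrib[symmetric])
    qed
    also have "\<dots> \<le> (4 * L) ^ 34 * ?e"
      using a g by (intro mult_right_mono power_increasing) auto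
    finally show "perm_prob (pairs n) (\<lambda>es. \<exists>A\<in>subsets_of_card B a. ?Q A es) \<le> (4 * L) ^ 34 *
     exp (- (3 / 4 * L / real n * (2 * real n - 39))) * (14 * L / real n) ^ card C"
      by (simp only: mult.assoc)
  qed
  also have "\<dots> = close_bound n (card C)" by (simp add: close_bound_def L_def)
  finally show ?thesis .
qed

definition bad_close :: "nat \<Rightarrow> nat set list \<Rightarrow> bool" where
  "bad_close n es \<longleftrightarrow> (\<exists>x\<in>{1..n}. \<exists>y\<in>{1..n}.
     (x \<noteq> y \<and> low_degree n es x \<and> low_degree n es y \<and> {x, y} \<in> set (take (upper_time n) es)) \<or>
     (\<exists>z\<in>{1..n}. x \<noteq> y \<and> z \<noteq> x \<and> z \<noteq> y \<and> low_degree n es x \<and> low_degree n es y \<and>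
        {x, z} \<in> set (take (upper_time n) es) \<and> {y, z} \<in> set (take (upper_time n) es)))"

text \<open>Up to powers of \<open>ln n\<close>, two low degrees cost \<open>n\<close> to the power
  \<open>-3/2\<close> and each connecting edge costs \<open>1 / n\<close>. Both the adjacent pairs
  and the triples with a common neighbour thus contribute \<open>n\<close> to the power
  \<open>-1/2\<close>.\<close>

lemma prob_bad_close:
  assumes "good_size n"
  shows "perm_prob (pairs n) (bad_close n) \<le> real n * (real n * (close_bound n 1 + real n * close_bound n 2))"
proof -
  note g = good_sizeD[OF assms]
  have pos: "0 \<le> close_bound n c" for c using g by (simp add: close_bound_def)
  have null: "perm_prob (pairs n) (\<lambda>es. False) = 0" by (simp add: perm_prob_def)
  have one: "perm_prob (pairs n) (\<lambda>es. x \<noteq> y \<and> low_degree n es x \<and> low_degree n es y \<and>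
      {x, y} \<in> set (take (upper_time n) es)) \<le> close_bound n 1" if "x \<in> {1..n}" "y \<in> {1..n}" for x y
  proof (cases "x = y")
    case True
    then show ?thesis using null pos by simp
  next
    case False
    then have "{{x, y}} \<subseteq> incident n x \<union> incident n y"
      using that by (simp add: incident_def complete_edges_def)
    from prob_low_degree_pair[OF assms that False this] False show ?thesis by simp
  qed
  have two: "perm_prob (pairs n) (\<lambda>es. x \<noteq> y \<and> z \<noteq> x \<and> z \<noteq> y \<and> low_degree n es x \<and> low_degree n es y \<and>
        {x, z} \<in> set (take (upper_time n) es) \<and> {y, z} \<in> set (take (upper_time n) es)) \<le> close_bound n 2"
    if "x \<in> {1..n}" "y \<in> {1..n}" "z \<in> {1..n}" for x y z
  proof (cases "x = y \<or> z = x \<or> z = y")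
    case True
    then show ?thesis using null pos by auto
  next
    case False
    then have "{{x, z}, {y, z}} \<subseteq> incident n x \<union> incident n y"
      using that by (auto simp: incident_def complete_edges_def)
    moreover have "card {{x, z}, {y, z}} = 2" using False by (simp add: doubleton_eq_iff)
    ultimately show ?thesis using prob_low_degree_pair[OF assms that(1,2), of "{{x, z}, {y, z}}"] False by simp
  qed
  have "perm_prob (pairs n) (bad_close n) \<le>
      real (card {1..n}) * (real (card {1..n}) * (close_bound n 1 + real (card {1..n}) * close_bound n 2))"
    unfolding bad_close_def
    by (intro perm_prob_UN_le order_trans[OF perm_prob_disj] add_mono one two) auto
  then show ?thesis by simp
qed

section \<open>Isolated vertices\<close>

text \<open>Chebyshev's inequality for the number \<open>X\<close> of those \<open>v\<close> with
  \<open>I v\<close>, cleared of denominators: with \<open>k\<close> the mean,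
  \<open>(X - k)\<^sup>2\<close> equals \<open>k\<^sup>2\<close> wherever
  \<open>X = 0\<close>.\<close>

lemma second_moment:
  assumes fin: "finite S" "finite V"
    and a: "\<And>v. v \<in> V \<Longrightarrow> perm_prob S (I v) = a"
    and b: "\<And>u v. u \<in> V \<Longrightarrow> v \<in> V \<Longrightarrow> u \<noteq> v \<Longrightarrow> perm_prob S (\<lambda>xs. I u xs \<and> I v xs) \<le> b"
  shows "(real (card V) * a)\<^sup>2 * perm_prob S (\<lambda>xs. \<forall>v\<in>V. \<not> I v xs)
    \<le> real (card V) * a + real (card V) * (real (card V) - 1) * b - (real (card V) * a)\<^sup>2"
proof -
  define P where "P = permutations_of_set S"
  define c where "c = real (card P)"
  have finP: "finite P" using fin by (simp add: P_def)
  have c: "0 < c" unfolding c_def P_def using fin(1) by simp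
  define X where "X xs = (\<Sum>v\<in>V. if I v xs then 1 else 0 :: real)" for xs
  define k where "k = real (card V) * a"
  have ind: "(\<Sum>xs\<in>P. if Q xs then 1 else 0) = c * perm_prob S Q" for Q
    unfolding perm_prob_card[OF fin(1)] P_def[symmetric] c_def[symmetric]
    using c finP by (simp add: sum.If_cases Int_def)
  have X1: "(\<Sum>xs\<in>P. X xs) = c * k"
  proof -
    have "(\<Sum>xs\<in>P. X xs) = (\<Sum>v\<in>V. \<Sum>xs\<in>P. if I v xs then 1 else 0)"
      unfolding X_def by (rule sum.swap)
    also have "\<dots> = (\<Sum>v\<in>V. c * a)" using ind a by (intro sum.cong) auto
    finally show ?thesis by (simp add: k_def)
  qed
  have X2: "(\<Sum>xs\<in>P. (X xs)\<^sup>2) \<le> c * (k + real (card V) * (real (card V) - 1) * b)"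
  proof -
    have "(\<Sum>xs\<in>P. (X xs)\<^sup>2) = (\<Sum>xs\<in>P. \<Sum>u\<in>V. \<Sum>v\<in>V. if I u xs \<and> I v xs then 1 else 0)"
      unfolding X_def power2_eq_square sum_product by (intro sum.cong refl) simp
    also have "\<dots> = (\<Sum>u\<in>V. \<Sum>v\<in>V. \<Sum>xs\<in>P. if I u xs \<and> I v xs then 1 else 0)"
      by (subst sum.swap) (intro sum.cong refl sum.swap)
    also have "\<dots> \<le> (\<Sum>u\<in>V. \<Sum>v\<in>V. c * (if u = v then a else b))"
      unfolding ind using a b c by (intro sum_mono mult_left_mono) auto
    also have "\<dots> = (\<Sum>u\<in>V. c * (a + (real (card V) - 1) * b))"
    proof (rule sum.cong[OF refl])
      fix u assume u: "u \<in> V"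
      have "(\<Sum>v\<in>V. c * (if u = v then a else b)) = c * a + (\<Sum>v\<in>V - {u}. c * b)"
      proof -
        have "(\<Sum>v\<in>V - {u}. c * (if u = v then a else b)) = (\<Sum>v\<in>V - {u}. c * b)"
          by (intro sum.cong) auto
        then show ?thesis using sum.remove[OF fin(2) u, of "\<lambda>v. c * (if u = v then a else b)"] by simp
      qed
      also have "(\<Sum>v\<in>V - {u}. c * b) = (real (card V) - 1) * (c * b)"
        using u fin(2) card_gt_0_iff[of V] by (auto simp: card_Diff_singleton of_nat_diff Suc_le_eq)
      finally show "(\<Sum>v\<in>V. c * (if u = v then a else b)) = c * (a + (real (card V) - 1) * b)"
        by (simp add: algebra_simps)
    qed
    finally show ?thesis by (simp add: k_def algebra_simps)
  qed
  have "k\<^sup>2 * (c * perm_prob S (\<lambda>xs. \<forall>v\<in>V. \<not> I v xs)) = (\<Sum>xs\<in>P. if \<forall>v\<in>V. \<not> I v xs then k\<^sup>2 else 0)"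
    unfolding ind[symmetric] sum_distrib_left by (intro sum.cong refl) simp
  also have "\<dots> \<le> (\<Sum>xs\<in>P. (X xs - k)\<^sup>2)"
  proof (rule sum_mono)
    fix xs
    show "(if \<forall>v\<in>V. \<not> I v xs then k\<^sup>2 else 0) \<le> (X xs - k)\<^sup>2"
    proof (cases "\<forall>v\<in>V. \<not> I v xs")
      case True
      then have "X xs = 0" by (simp add: X_def)
      then show ?thesis by simp
    next
      case False
      then show ?thesis by (subst if_not_P) simp_all
    qed
  qed
  also have "\<dots> = (\<Sum>xs\<in>P. (X xs)\<^sup>2 - 2 * k * X xs + k\<^sup>2)"
    by (intro sum.cong refl) (simp add: power2_eq_square algebra_simps)
  also have "\<dots> = (\<Sum>xs\<in>P. (X xs)\<^sup>2) - 2 * k * (c * k) + c * k\<^sup>2"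
    unfolding X1[symmetric] by (simp add: sum.distrib sum_subtractf sum_distrib_left c_def)
  also have "\<dots> \<le> c * (k + real (card V) * (real (card V) - 1) * b) - 2 * k * (c * k) + c * k\<^sup>2"
    using X2 by simp
  also have "\<dots> = c * (k + real (card V) * (real (card V) - 1) * b - k\<^sup>2)"
    by (simp add: power2_eq_square algebra_simps)
  finally have "c * (k\<^sup>2 * perm_prob S (\<lambda>xs. \<forall>v\<in>V. \<not> I v xs))
      \<le> c * (k + real (card V) * (real (card V) - 1) * b - k\<^sup>2)" by (simp only: mult.left_commute)
  then show ?thesis using c by (simp add: k_def)
qed

lemma prod_lessThan_add:
  fixes f :: "nat \<Rightarrow> real"
  shows "(\<Prod>i<p + q. f i) = (\<Prod>i<p. f i) * (\<Prod>i<q. f (p + i))"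
  by (induction q) (simp_all add: mult_ac)

definition bad_cover :: "nat \<Rightarrow> nat set list \<Rightarrow> bool" where
  "bad_cover n es \<longleftrightarrow> (\<forall>v\<in>{1..n}. \<not> (\<forall>e\<in>incident n v. e \<notin> set (take (lower_time n) es)))"

text \<open>\<open>t i\<close> is the chance that one more pair is missed after \<open>i\<close>
  missed ones, so \<open>a\<close> and \<open>b\<close> are the probabilities that one vertex, or
  two given vertices, are isolated. The mean \<open>n * a\<close> is at least
  \<open>n * s ^ n\<close>, of order \<open>n\<close> to the power \<open>1/4\<close>, and
  \<open>b\<close> exceeds \<open>a * a\<close> by at most the factor \<open>1 / r\<close>, which
  tends to 1.\<close>

lemma prob_bad_cover:
  assumes good: "good_size n" and small: "2 * ln (real n) / real n < 1"
    "3 / 4 * ln (real n) / (real n - 3) < 1"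
  shows "perm_prob (pairs n) (bad_cover n) \<le>
    1 / (real n * (1 - 3 / 4 * ln (real n) / (real n - 3)) ^ n) + (1 / (1 - 2 * ln (real n) / real n) - 1)"
proof -
  define L where "L = ln (real n)"
  note g = good_sizeD[OF good, folded L_def]
  define m where "m = real (lower_time n)"
  define N where "N = real (card (pairs n))"
  define t where "t i = (N - m - real i) / (N - real i)" for i :: nat
  define a where "a = (\<Prod>i<n - 1. t i)"
  define b where "b = (\<Prod>i<2 * n - 3. t i)"
  define r where "r = 1 - 2 * L / real n"
  define s where "s = 1 - 3 / 4 * L / (real n - 3)"
  have n: "100 \<le> real n" using g(1) by simp
  have N: "N = real n * (real n - 1) / 2" unfolding N_def by (rule card_pairs)
  have N_large: "49 * real n \<le> N"
  proof -
    have "98 \<le> real n - 1" using n by simp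
    then have "real n * 98 \<le> real n * (real n - 1)" by (intro mult_left_mono) auto
    then show ?thesis unfolding N by simp
  qed
  have m_le: "m \<le> 2 * L / real n * (N / 2)" unfolding m_def N_def by (rule g(7))
  have m0: "0 \<le> m" by (simp add: m_def)
  have r0: "0 < r" and s0: "0 < s" using small by (simp_all add: r_def s_def L_def)
  have t_eq: "t i = 1 - m / (N - real i)" if "i < 2 * n" for i
  proof -
    have "real i < 2 * real n" using that by simp
    then have "N - real i > 0" using N_large n by linarith
    then show ?thesis by (simp add: t_def field_simps)
  qed
  have t_r: "r \<le> t i" if "i < 2 * n" for i
  proof -
    have i: "real i < 2 * real n" using that by simp
    then have half: "N / 2 \<le> N - real i" "0 < N - real i" using N_large n by linarith+
    have "m \<le> 2 * L / real n * (N - real i)"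
      using m_le mult_left_mono[OF half(1), of "2 * L / real n"] g(2) n by simp
    then have "m / (N - real i) \<le> 2 * L / real n" using half(2) by (simp add: pos_divide_le_eq)
    then show ?thesis unfolding t_eq[OF that] r_def by simp
  qed
  have t0: "0 < t i" if "i < 2 * n" for i using t_r[OF that] r0 by linarith
  have t_anti: "t j \<le> t i" if "i \<le> j" "j < 2 * n" for i j
  proof -
    have "real i \<le> real j" "real j < 2 * real n" using that by simp_all
    then have "N - real j > 0" "N - real j \<le> N - real i" using N_large n by linarith+
    then have "m / (N - real i) \<le> m / (N - real j)" using m0 by (intro divide_left_mono) auto
    then show ?thesis using that by (simp add: t_eq)
  qed
  have a_pos: "0 < a" unfolding a_def by (intro prod_pos) (auto intro!: t0)
  \<comment> \<open>The stars at two vertices share one pair, so \<open>b\<close> has one factor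
    fewer than \<open>a * a\<close>; \<open>r\<close> is a lower bound for that factor. The later
    factors of \<open>b\<close> compare favourably because \<open>t\<close> is decreasing.\<close>
  have ab: "b * r \<le> a\<^sup>2"
  proof -
    have split: "2 * n - 3 = (n - 1) + (n - 2)" "n - 1 = Suc (n - 2)" using g(1) by linarith+
    have "b = a * (\<Prod>i<n - 2. t (n - 1 + i))"
      unfolding a_def b_def split(1) by (rule prod_lessThan_add)
    also have "\<dots> \<le> a * (\<Prod>i<n - 2. t i)"
      using a_pos t0 t_anti by (intro mult_left_mono prod_mono conjI) (auto intro!: less_imp_le[OF t0] t_anti)
    finally have "b * r \<le> a * (\<Prod>i<n - 2. t i) * r" using r0 by simp
    also have "\<dots> \<le> a * (\<Prod>i<n - 2. t i) * t (n - 2)"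
      using a_pos t_r[of "n - 2"] g(1) by (intro mult_left_mono mult_nonneg_nonneg prod_nonneg) (auto intro!: less_imp_le[OF t0])
    also have "\<dots> = a * a" unfolding a_def split(2) by (simp add: mult_ac)
    finally show ?thesis by (simp add: power2_eq_square)
  qed
  \<comment> \<open>At least \<open>N - n = n * (n - 3) / 2\<close> pairs remain at each step, which
    is where \<open>n - 3\<close> comes from.\<close>
  have a_ge: "s ^ n \<le> a"
  proof -
    have ts: "s \<le> t i" if "i < n" for i
    proof -
      have "N - real n = real n * (real n - 3) / 2" unfolding N by (simp add: field_simps)
      then have i: "real n * (real n - 3) / 2 \<le> N - real i" "0 < N - real i"
        using that N_large n by linarith+
      have "m \<le> 3 / 8 * real n * L"
        using time_bounds(1)[of n] g(1) by (simp add: m_def L_def)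
      also have "\<dots> = 3 / 4 * L / (real n - 3) * (real n * (real n - 3) / 2)" using n by (simp add: field_simps)
      also have "\<dots> \<le> 3 / 4 * L / (real n - 3) * (N - real i)"
        using i(1) g(2) n by (intro mult_left_mono) auto
      finally have "m / (N - real i) \<le> 3 / 4 * L / (real n - 3)" using i(2) by (simp add: pos_divide_le_eq)
      then show ?thesis using that by (simp add: t_eq s_def)
    qed
    have "s \<le> 1" using n g(2) by (simp add: s_def)
    then have "s ^ n \<le> s ^ (n - 1)" using s0 by (intro power_decreasing) auto
    also have "\<dots> = (\<Prod>i<n - 1. s)" by simp
    also have "\<dots> \<le> a" unfolding a_def using s0 ts by (intro prod_mono) auto
    finally show ?thesis .
  qed
  have one: "perm_prob (pairs n) (\<lambda>es. \<forall>e\<in>incident n v. e \<notin> set (take (lower_time n) es)) = a"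
    if "v \<in> {1..n}" for v
    unfolding a_def t_def m_def N_def card_incident[OF that, symmetric]
    by (rule perm_prob_avoid) (use g incident_subset in auto)
  have two: "perm_prob (pairs n) (\<lambda>es. (\<forall>e\<in>incident n u. e \<notin> set (take (lower_time n) es)) \<and>
      (\<forall>e\<in>incident n v. e \<notin> set (take (lower_time n) es))) \<le> b"
    if uv: "u \<in> {1..n}" "v \<in> {1..n}" "u \<noteq> v" for u v
  proof -
    have "perm_prob (pairs n) (\<lambda>es. \<forall>e\<in>incident n u \<union> incident n v. e \<notin> set (take (lower_time n) es)) = b"
      unfolding b_def t_def m_def N_def card_incident_Un[OF uv, symmetric]
      by (rule perm_prob_avoid) (use g incident_subset in auto)
    then show ?thesis by (simp add: ball_Un)
  qed
  let ?p = "perm_prob (pairs n) (bad_cover n)"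
  define k where "k = real n * a"
  have k0: "0 < k" using a_pos n by (simp add: k_def)
  have "k\<^sup>2 * ?p \<le> k + real n * (real n - 1) * b - k\<^sup>2"
    using second_moment[of "pairs n" "{1..n}", OF _ _ one two] unfolding bad_cover_def k_def by simp
  also have "real n * (real n - 1) * b \<le> real n ^ 2 * (a\<^sup>2 / r)"
  proof (intro mult_mono)
    show "b \<le> a\<^sup>2 / r" using ab r0 by (simp add: pos_le_divide_eq)
    show "0 \<le> b" unfolding b_def by (intro prod_nonneg) (auto intro!: less_imp_le[OF t0])
    show "real n * (real n - 1) \<le> (real n)\<^sup>2" by (simp add: power2_eq_square algebra_simps)
  qed auto
  finally have "k\<^sup>2 * ?p \<le> k + k\<^sup>2 / r - k\<^sup>2" by (simp add: k_def power_mult_distrib)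
  then have "?p \<le> (k + k\<^sup>2 / r - k\<^sup>2) / k\<^sup>2"
    using k0 by (simp add: pos_le_divide_eq mult.commute)
  also have "\<dots> = 1 / k + (1 / r - 1)"
    using k0 r0 by (simp add: field_simps power2_eq_square)
  also have "\<dots> \<le> 1 / (real n * s ^ n) + (1 / r - 1)"
  proof -
    have "real n * s ^ n \<le> k" unfolding k_def using a_ge by (intro mult_left_mono) auto
    moreover have "0 < real n * s ^ n" using n s0 by simp
    ultimately have "1 / k \<le> 1 / (real n * s ^ n)" using k0 by (intro divide_left_mono) auto
    then show ?thesis by simp
  qed
  finally show ?thesis by (simp add: r_def s_def L_def)
qed

lemma error_bounds_tendsto:
  "(\<lambda>n. 2 * exp (- (2 * ln (real n)))) \<longlonglongrightarrow> 0"
  "(\<lambda>n. 4 ^ n * exp (- (ln (real n) * real n / 108))) \<longlonglongrightarrow> 0"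
  "(\<lambda>n. 2 * ((3 * exp 1 * ln (real n) ^ 2) ^ 3 * exp (- (3 / 16 * ln (real n))))) \<longlonglongrightarrow> 0"
  "(\<lambda>n. 2 * (exp 1 ^ 4 / 27 / ln (real n))) \<longlonglongrightarrow> 0"
  "(\<lambda>n. real n * (real n * (close_bound n 1 + real n * close_bound n 2))) \<longlonglongrightarrow> 0"
  "(\<lambda>n. 1 / (real n * (1 - 3 / 4 * ln (real n) / (real n - 3)) ^ n) + (1 / (1 - 2 * ln (real n) / real n) - 1)) \<longlonglongrightarrow> 0"
proof -
  show "(\<lambda>n. 2 * exp (- (2 * ln (real n)))) \<longlonglongrightarrow> 0" by real_asymp
  show "(\<lambda>n. 4 ^ n * exp (- (ln (real n) * real n / 108))) \<longlonglongrightarrow> 0" by real_asymp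
  show "(\<lambda>n. 2 * ((3 * exp 1 * ln (real n) ^ 2) ^ 3 * exp (- (3 / 16 * ln (real n))))) \<longlonglongrightarrow> 0" by real_asymp
  show "(\<lambda>n. 2 * (exp 1 ^ 4 / 27 / ln (real n))) \<longlonglongrightarrow> 0" by real_asymp
  show "(\<lambda>n. real n * (real n * (close_bound n 1 + real n * close_bound n 2))) \<longlonglongrightarrow> 0"
    unfolding close_bound_def by real_asymp
  show "(\<lambda>n. 1 / (real n * (1 - 3 / 4 * ln (real n) / (real n - 3)) ^ n) + (1 / (1 - 2 * ln (real n) / real n) - 1)) \<longlonglongrightarrow> 0"
    by real_asymp
qed

section \<open>The graph at the time of connectivity\<close>

lemma separated_commute: "separated E X Y \<longleftrightarrow> separated E Y X"
  unfolding separated_def between_def by (auto simp: insert_commute) (metis insert_commute)+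

lemma separatedI: "(\<And>x y. x \<in> X \<Longrightarrow> y \<in> Y \<Longrightarrow> {x, y} \<notin> E) \<Longrightarrow> separated E X Y"
  by (auto simp: separated_def between_def)

lemma not_connected_cut:
  assumes "V \<noteq> {}" "\<not> graph_connected V E"
  obtains K where "K \<subseteq> V" "K \<noteq> {}" "K \<noteq> V" "separated E K (V - K)"
proof -
  let ?R = "{(x, y). {x, y} \<in> E}\<^sup>*"
  obtain u v where uv: "u \<in> V" "v \<in> V" "(u, v) \<notin> ?R"
    using assms by (auto simp: graph_connected_def)
  let ?K = "{w \<in> V. (u, w) \<in> ?R}"
  have "separated E ?K (V - ?K)"
  proof (rule separatedI)
    fix x y assume "x \<in> ?K" "y \<in> V - ?K"
    then show "{x, y} \<notin> E"
      using rtrancl_into_rtrancl[of u x "{(x, y). {x, y} \<in> E}" y] by auto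
  qed
  then show thesis using that[of ?K] uv by blast
qed

lemma connected_has_neighbour:
  assumes "graph_connected V E" "v \<in> V" "u \<in> V" "u \<noteq> v"
  shows "\<exists>w. {v, w} \<in> E"
proof -
  have "(v, u) \<in> {(x, y). {x, y} \<in> E}\<^sup>*" using assms by (auto simp: graph_connected_def)
  then show ?thesis using assms(4) by (cases rule: converse_rtranclE) auto
qed

lemma sum_degrees_le:
  assumes "finite E" "finite U" "\<And>e. e \<in> E \<Longrightarrow> card e = 2"
  shows "(\<Sum>v\<in>U. card {e \<in> E. v \<in> e}) \<le> 2 * card {e \<in> E. e \<inter> U \<noteq> {}}"
proof -
  let ?A = "{e \<in> E. e \<inter> U \<noteq> {}}"
  have "(\<Sum>v\<in>U. card {e \<in> E. v \<in> e}) = (\<Sum>v\<in>U. \<Sum>e\<in>?A. if v \<in> e then 1 else 0)"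
  proof (rule sum.cong[OF refl])
    fix v assume "v \<in> U"
    then have "{e \<in> E. v \<in> e} = {e \<in> ?A. v \<in> e}" by auto
    then show "card {e \<in> E. v \<in> e} = (\<Sum>e\<in>?A. if v \<in> e then 1 else 0)"
      using assms(1) by (simp add: sum.If_cases Int_def)
  qed
  also have "\<dots> = (\<Sum>e\<in>?A. \<Sum>v\<in>U. if v \<in> e then 1 else 0)" by (rule sum.swap)
  also have "\<dots> \<le> (\<Sum>e\<in>?A. 2)"
  proof (rule sum_mono)
    fix e assume e: "e \<in> ?A"
    then have "finite e" using assms(3)[of e] by (intro card_ge_0_finite) simp
    then have "card (U \<inter> e) \<le> 2" using card_mono[of e "U \<inter> e"] assms(3)[of e] e by simp
    then show "(\<Sum>v\<in>U. if v \<in> e then 1 else 0) \<le> (2::nat)"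
      using assms(2) by (simp add: sum.If_cases Int_def)
  qed
  finally show ?thesis by simp
qed

text \<open>
  If the expansion fails, then \<open>U\<close> and its neighbours are fewer than \<open>3 * card U\<close> vertices, but they
  span at least \<open>9 * card U\<close> edges.
\<close>

lemma edge_expansion:
  assumes E: "E \<subseteq> complete_edges V" and fin: "finite V" and U: "U \<subseteq> V" "U \<noteq> {}"
    and deg: "\<And>v. v \<in> U \<Longrightarrow> 18 \<le> card {e \<in> E. v \<in> e}"
    and sparse: "\<And>W. W \<subseteq> V \<Longrightarrow> W \<noteq> {} \<Longrightarrow> card W < 3 * card U \<Longrightarrow> card {e \<in> E. e \<subseteq> W} < 3 * card W"
  shows "2 * card U \<le> card {w \<in> V - U. \<exists>u\<in>U. {u, w} \<in> E}"
proof (rule ccontr)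
  define T where "T = {w \<in> V - U. \<exists>u\<in>U. {u, w} \<in> E}"
  assume "\<not> 2 * card U \<le> card {w \<in> V - U. \<exists>u\<in>U. {u, w} \<in> E}"
  then have T: "card T < 2 * card U" by (simp add: T_def)
  have finU: "finite U" using U(1) fin finite_subset by blast
  have finE: "finite E" using E fin finite_subset finite_complete_edges by blast
  have W: "card (U \<union> T) < 3 * card U" using card_Un_le[of U T] T by linarith
  have "e \<subseteq> U \<union> T" if e: "e \<in> E" "e \<inter> U \<noteq> {}" for e
  proof -
    have "e \<subseteq> V" "card e = 2" using e(1) E by (auto simp: complete_edges_def)
    then obtain a b where ab: "e = {a, b}" "a \<in> V" "b \<in> V" by (auto simp: card_2_iff)
    from e(2) ab(1) consider "a \<in> U" | "b \<in> U" by auto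
    then show ?thesis
    proof cases
      case 1
      then show ?thesis using ab e(1) by (auto simp: T_def)
    next
      case 2
      then show ?thesis using ab e(1) by (auto simp: T_def insert_commute)
    qed
  qed
  then have "card {e \<in> E. e \<inter> U \<noteq> {}} \<le> card {e \<in> E. e \<subseteq> U \<union> T}"
    using finE by (intro card_mono) auto
  also have "\<dots> < 3 * card (U \<union> T)"
    using U W by (intro sparse) (auto simp: T_def)
  finally have "card {e \<in> E. e \<inter> U \<noteq> {}} < 9 * card U" using W by linarith
  moreover have "18 * card U \<le> (\<Sum>v\<in>U. card {e \<in> E. v \<in> e})"
    using sum_bounded_below[of U 18 "\<lambda>v. card {e \<in> E. v \<in> e}"] deg by (simp add: mult.commute)
  moreover have "(\<Sum>v\<in>U. card {e \<in> E. v \<in> e}) \<le> 2 * card {e \<in> E. e \<inter> U \<noteq> {}}"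
    using E finE finU by (intro sum_degrees_le) (auto simp: complete_edges_def)
  ultimately show False by linarith
qed

text \<open>Excluding \<open>bad_cut\<close> and \<open>bad_cover\<close> places the time of
  connectivity between the two fixed times, so \<open>E0 \<subseteq> E \<subseteq> E1\<close>.
  Expansion is then inherited from \<open>E0\<close>, and the absence of close pairs in
  \<open>S\<close> from \<open>E1\<close>.\<close>

lemma acquaintance_time_good_ordering:
  assumes good: "good_size n" and es: "es \<in> permutations_of_set (pairs n)"
    and not_bad: "\<not> bad_cut n es" "\<not> bad_pair n es" "\<not> bad_expansion n es" "\<not> bad_dense n es"
      "\<not> bad_close n es" "\<not> bad_cover n es"
  shows "acquaintance_time {1..n} (process_edges es (connectivity_time n es)) \<le> enat (105 * n)"
proof -
  define V where "V = {1..n}"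
  define M where "M = connectivity_time n es"
  define E0 E E1 where "E0 = set (take (lower_time n) es)" and "E = set (take M es)"
    and "E1 = set (take (upper_time n) es)"
  define S where "S = {v \<in> V. low_degree n es v}"
  define k where "k = n div 8"
  note g = good_sizeD[OF good]
  have V: "finite V" "card V = n" "V \<noteq> {}" using g(1) by (auto simp: V_def)
  have "set es = pairs n" using es by (simp add: permutations_of_set_def)
  then have sub: "E0 \<subseteq> pairs n" "E \<subseteq> pairs n"
    unfolding E0_def E_def by (metis set_take_subset)+
  have conn: "graph_connected V E"
    using graph_connected_connectivity_time[of n es] es g(1)
    by (simp add: V_def E_def M_def process_edges_def random_edge_ordering_def)
  have nbr: "\<exists>w\<in>V. {v, w} \<in> E" if v: "v \<in> V" for v
  proof -
    have "\<exists>u\<in>V. u \<noteq> v"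
    proof (rule ccontr)
      assume "\<not> (\<exists>u\<in>V. u \<noteq> v)"
      then have "V \<subseteq> {v}" by blast
      then have "card V \<le> 1" using card_mono[of "{v}" V] by simp
      then show False using V g(1) by simp
    qed
    then obtain w where "{v, w} \<in> E" using connected_has_neighbour[OF conn v] by blast
    then show ?thesis using sub(2) by (auto simp: V_def complete_edges_def)
  qed
  have "graph_connected V E1"
  proof (rule ccontr)
    assume "\<not> graph_connected V E1"
    then obtain K where K: "K \<subseteq> V" "K \<noteq> {}" "K \<noteq> V" "separated E1 K (V - K)"
      using not_connected_cut[OF V(3)] by blast
    have bad: "bad_cut n es" if "K' \<subseteq> V" "K' \<noteq> {}" "2 * card K' \<le> n" "separated E1 K' (V - K')" for K'
    proof -
      have "card K' \<noteq> 0" using that V(1) finite_subset by fastforce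
      then have "card K' \<in> {1..n div 2}" using that(3) by auto
      moreover have "K' \<in> subsets_of_card {1..n} (card K')" using that(1) by (simp add: subsets_of_card_def V_def)
      ultimately show ?thesis using that(4) unfolding bad_cut_def E1_def V_def by blast
    qed
    have "card K + card (V - K) = n"
      using K(1) V by (metis card_Diff_subset card_mono finite_subset le_add_diff_inverse)
    then consider "2 * card K \<le> n" | "2 * card (V - K) \<le> n" by linarith
    then show False
    proof cases
      case 1
      then show False using bad[of K] K not_bad(1) by blast
    next
      case 2
      have "V - (V - K) = K" using K(1) by blast
      then show False using bad[of "V - K"] 2 K not_bad(1) by (auto simp: separated_commute)
    qed
  qed
  then have "M \<le> upper_time n"
    unfolding M_def connectivity_time_def by (intro Least_le) (simp add: V_def E1_def process_edges_def)
  then have EE1: "E \<subseteq> E1" unfolding E_def E1_def by (rule set_take_subset_set_take)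
  have "lower_time n \<le> M"
  proof (rule ccontr)
    assume "\<not> lower_time n \<le> M"
    then have "E \<subseteq> E0" unfolding E_def E0_def by (intro set_take_subset_set_take) simp
    moreover obtain v where v: "v \<in> V" "\<forall>e\<in>incident n v. e \<notin> E0"
      using not_bad(6) by (auto simp: bad_cover_def V_def E0_def)
    moreover obtain w where "{v, w} \<in> E" using nbr[OF v(1)] by blast
    ultimately show False using sub by (auto simp: incident_def)
  qed
  then have E0E: "E0 \<subseteq> E" unfolding E0_def E_def by (rule set_take_subset_set_take)
  have "acquaintance_time V E \<le> enat (105 * card V)"
  proof (rule acquaintance_time_expander[OF V(1) E0E])
    show "E \<subseteq> complete_edges V" using sub by (simp add: V_def)
    show "S \<subseteq> V" by (auto simp: S_def)
    show "\<exists>u\<in>V. {s, u} \<in> E" if "s \<in> S" for s using nbr that by (simp add: S_def)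
    show "{x, y} \<notin> E" if "x \<in> S" "y \<in> S" "x \<noteq> y" for x y
      using that not_bad(5) EE1 unfolding bad_close_def S_def V_def E1_def by blast
    show "\<not> ({x, z} \<in> E \<and> {y, z} \<in> E)" if xy: "x \<in> S" "y \<in> S" "x \<noteq> y" for x y z
    proof
      assume z: "{x, z} \<in> E \<and> {y, z} \<in> E"
      then have "{x, z} \<in> pairs n" "{y, z} \<in> pairs n" using sub(2) by auto
      then have "z \<in> {1..n}" "z \<noteq> x" "z \<noteq> y" by (auto simp: complete_edges_def)
      then show False
        using xy z not_bad(5) EE1 unfolding bad_close_def S_def V_def E1_def by blast
    qed
    show "2 * k < card V" using V(2) g(1) by (simp add: k_def)
    show "\<exists>x\<in>X. \<exists>y\<in>Y. {x, y} \<in> E0"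
      if "X \<subseteq> V" "Y \<subseteq> V" "X \<inter> Y = {}" "card X = k" "card Y = k" for X Y
    proof (rule ccontr)
      assume "\<not> (\<exists>x\<in>X. \<exists>y\<in>Y. {x, y} \<in> E0)"
      then have "separated E0 X Y" by (intro separatedI) blast
      then have "bad_pair n es"
        using that unfolding bad_pair_def subsets_of_card_def V_def k_def E0_def by blast
      then show False using not_bad(2) by contradiction
    qed
    show "2 * card U \<le> card {w \<in> V - U. \<exists>u\<in>U. {u, w} \<in> E0}"
      if U: "U \<subseteq> V - S" "U \<noteq> {}" "card U \<le> 2 * k" for U
    \<comment> \<open>The threshold is chosen such that, in the second case, every \<open>W\<close>
      smaller than \<open>3 * card U\<close> is within the range of
      \<open>bad_dense\<close>.\<close>
    proof (cases "real n < 3 * real (card U) * ln (real n) ^ 2")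
      case True
      define T where "T = {w \<in> V - U. \<exists>u\<in>U. {u, w} \<in> E0}"
      have U4: "4 * card U \<le> n" using U(3) by (simp add: k_def)
      show ?thesis
      proof (rule ccontr)
        assume "\<not> 2 * card U \<le> card {w \<in> V - U. \<exists>u\<in>U. {u, w} \<in> E0}"
        then have T: "card T < 2 * card U" by (simp add: T_def)
        have TV: "T \<subseteq> V" by (auto simp: T_def)
        then have finT: "finite T" using V(1) finite_subset by blast
        \<comment> \<open>\<open>T\<close> is enlarged to the exact size demanded by
          \<open>bad_expansion\<close>. The added vertices, even those in \<open>U\<close>, can only
          shrink the set that must be separated from \<open>U\<close>.\<close>
        have "2 * card U - card T \<le> card (V - T)"
          using U4 V(2) finT TV by (simp add: card_Diff_subset)
        then obtain D where D: "D \<subseteq> V - T" "card D = 2 * card U - card T" "finite D"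
          by (rule obtain_subset_with_card_n)
        have "card (T \<union> D) = 2 * card U"
          using D finT T by (subst card_Un_disjoint) auto
        then have "T \<union> D \<in> subsets_of_card {1..n} (2 * card U)"
          using D(1) TV by (auto simp: subsets_of_card_def V_def)
        moreover have "U \<in> subsets_of_card {1..n} (card U)"
          using U(1) by (auto simp: subsets_of_card_def V_def)
        moreover have "separated E0 U ({1..n} - U - (T \<union> D))"
          by (rule separatedI) (auto simp: T_def V_def)
        ultimately have "bad_expansion n es"
          using True U4 unfolding bad_expansion_def E0_def by blast
        then show False using not_bad(3) by contradiction
      qed
    next
      case False
      show ?thesis
      proof (rule edge_expansion[OF _ V(1) _ U(2)])
        show "E0 \<subseteq> complete_edges V" using sub by (simp add: V_def)
        show "U \<subseteq> V" using U(1) by blast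
        show "18 \<le> card {e \<in> E0. v \<in> e}" if "v \<in> U" for v
          using that U(1) by (auto simp: S_def low_degree_def E0_def)
        fix W assume W: "W \<subseteq> V" "W \<noteq> {}" "card W < 3 * card U"
        show "card {e \<in> E0. e \<subseteq> W} < 3 * card W"
        proof (rule ccontr)
          assume "\<not> card {e \<in> E0. e \<subseteq> W} < 3 * card W"
          then have "3 * card W \<le> card {e \<in> E0. e \<subseteq> W}" by simp
          then obtain A where A: "A \<subseteq> {e \<in> E0. e \<subseteq> W}" "card A = 3 * card W" "finite A"
            by (rule obtain_subset_with_card_n)
          have "0 < card W" using W V(1) finite_subset card_gt_0_iff by blast
          moreover have "real (card W) * ln (real n) ^ 2 \<le> real n"
          proof -
            have "real (card W) \<le> 3 * real (card U)" using W(3) by simp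
            then have "real (card W) * ln (real n) ^ 2 \<le> 3 * real (card U) * ln (real n) ^ 2"
              by (intro mult_right_mono) auto
            then show ?thesis using False by linarith
          qed
          moreover have "W \<in> subsets_of_card {1..n} (card W)"
            using W(1) by (simp add: subsets_of_card_def V_def)
          moreover have "A \<in> subsets_of_card (complete_edges W) (3 * card W)"
            using A sub(1) by (auto simp: subsets_of_card_def complete_edges_def)
          moreover have "\<forall>e\<in>A. e \<in> set (take (lower_time n) es)" using A(1) by (auto simp: E0_def)
          ultimately have "bad_dense n es" unfolding bad_dense_def by blast
          then show False using not_bad(4) by contradiction
        qed
      qed
    qed
  qed
  then show ?thesis by (simp add: V_def E_def M_def process_edges_def)
qed

theorem theorem1p2:
  shows "\<exists>C::real. C > 0 \<and>
    (\<lambda>n. measure_pmf.prob (random_edge_ordering n)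
       {es. ereal_of_enat (acquaintance_time {1..n} (process_edges es (connectivity_time n es)))
            \<le> ereal (C * real n)}) \<longlonglongrightarrow> 1"
proof (intro exI[of _ 105] conjI)
  let ?G = "\<lambda>n es. ereal_of_enat (acquaintance_time {1..n} (process_edges es (connectivity_time n es)))
            \<le> ereal (105 * real n)"
  define f where "f n = 2 * exp (- (2 * ln (real n))) + 4 ^ n * exp (- (ln (real n) * real n / 108))
     + 2 * ((3 * exp 1 * ln (real n) ^ 2) ^ 3 * exp (- (3 / 16 * ln (real n))))
     + 2 * (exp 1 ^ 4 / 27 / ln (real n))
     + real n * (real n * (close_bound n 1 + real n * close_bound n 2))
     + (1 / (real n * (1 - 3 / 4 * ln (real n) / (real n - 3)) ^ n) + (1 / (1 - 2 * ln (real n) / real n) - 1))"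
    for n :: nat
  have "f \<longlonglongrightarrow> 0 + 0 + 0 + 0 + 0 + 0"
    unfolding f_def by (intro tendsto_add error_bounds_tendsto)
  then have lim: "(\<lambda>n. 1 - f n) \<longlonglongrightarrow> 1" using tendsto_diff[OF tendsto_const[of "1::real"]] by fastforce
  have "\<forall>\<^sub>F n in sequentially. (3 * exp 1 * ln (real n) ^ 2) ^ 3 * exp (- (3 / 16 * ln (real n))) \<le> 1 / 2"
    by real_asymp
  moreover have "\<forall>\<^sub>F n in sequentially. exp 1 ^ 4 / 27 / ln (real n) \<le> 1 / 2" by real_asymp
  moreover have "\<forall>\<^sub>F n in sequentially. 2 * ln (real n) / real n < 1" by real_asymp
  moreover have "\<forall>\<^sub>F n in sequentially. 3 / 4 * ln (real n) / (real n - 3) < 1" by real_asymp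
  ultimately have lower: "\<forall>\<^sub>F n in sequentially. 1 - f n \<le> measure_pmf.prob (random_edge_ordering n) {es. ?G n es}"
    using eventually_good_size
  proof eventually_elim
    case (elim n)
    \<comment> \<open>The nesting mirrors the sum in \<open>f\<close>, so that repeated use of
      \<open>perm_prob_disj\<close> pairs each event with its own bound.\<close>
    let ?bad = "\<lambda>es. ((((bad_cut n es \<or> bad_pair n es) \<or> bad_expansion n es) \<or> bad_dense n es) \<or> bad_close n es) \<or> bad_cover n es"
    have "perm_prob (pairs n) ?bad \<le> f n"
      unfolding f_def
      by (intro order_trans[OF perm_prob_disj] add_mono prob_bad_cut prob_bad_pair prob_bad_expansion
          prob_bad_dense prob_bad_close prob_bad_cover elim)
    then have "1 - f n \<le> perm_prob (pairs n) (\<lambda>es. \<not> ?bad es)"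
      unfolding perm_prob_not by simp
    also have "\<dots> \<le> perm_prob (pairs n) (?G n)"
    proof (rule perm_prob_mono)
      fix es assume "es \<in> permutations_of_set (pairs n)" "\<not> ?bad es"
      then have "acquaintance_time {1..n} (process_edges es (connectivity_time n es)) \<le> enat (105 * n)"
        using elim by (intro acquaintance_time_good_ordering) auto
      then have "ereal_of_enat (acquaintance_time {1..n} (process_edges es (connectivity_time n es)))
          \<le> ereal_of_enat (enat (105 * n))"
        by (simp only: ereal_of_enat_le_iff)
      then show "?G n es" by simp
    qed simp
    finally show ?case by (simp add: perm_prob_def random_edge_ordering_def)
  qed
  show "(\<lambda>n. measure_pmf.prob (random_edge_ordering n) {es. ?G n es}) \<longlonglongrightarrow> 1"
    by (rule tendsto_sandwich[OF lower _ lim tendsto_const]) simp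
qed simp

end
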